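(* Let $M$ be a smooth Riemannian manifold (not necessarily geodesically complete) and assume that $\mathrm{Ric}\ge -C^2$ for some constant $C\in\mathbb{R}$, meaning that $\mathrm{Ric}(X,X)\ge -C^2|X|^2$ for all smooth vector fields $X$ on $M$. Then for every $\varepsilon>0$ and every $u\in C^\infty_{\mathrm{c}}(M)$ one has $$\|\mathrm{Hess}(u)\|_2^2\le\frac{C^2\varepsilon^2}{2}\|u\|_2^2+\left(1+\frac{C^2}{2\varepsilon^2}\right)\|\Delta u\|_2^2.$$
   Context: Manifolds are smooth and without boundary. $\|\cdot\|_2$ are $\mathsf{L}^2$-norms with respect to the Riemannian volume measure, of functions or of pointwise norms of tensors (induced by the metric). $\mathrm{Ric}$ is the Ricci curvature, $\mathrm{Hess}(u)=\nabla\mathrm{d}u$ with $\nabla$ the Levi-Civita connection, and $\Delta u=-\mathrm{tr}(\mathrm{Hess}(u))$. *)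

theory Defs
  imports "HOL-Analysis.Analysis"
begin

section \<open>Smooth functions on open subsets of Euclidean space\<close>

definition partial_deriv :: "'n \<Rightarrow> (real^'n \<Rightarrow> real) \<Rightarrow> real^'n \<Rightarrow> real" where
  "partial_deriv i f x = frechet_derivative f (at x) (axis i 1)"

text \<open>\<open>Ck_on k S f\<close> and \<open>smooth_on S f\<close> are meant for open \<open>S\<close>.\<close>

primrec Ck_on :: "nat \<Rightarrow> (real^'n) set \<Rightarrow> (real^'n \<Rightarrow> real) \<Rightarrow> bool" where
  "Ck_on 0 S f \<longleftrightarrow> continuous_on S f"
| "Ck_on (Suc k) S f \<longleftrightarrow> f differentiable_on S \<and> (\<forall>i. Ck_on k S (partial_deriv i f))"

definition smooth_on :: "(real^'n) set \<Rightarrow> (real^'n \<Rightarrow> real) \<Rightarrow> bool" where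
  "smooth_on S f \<longleftrightarrow> (\<forall>k. Ck_on k S f)"


section \<open>Smooth manifolds\<close>

text \<open>A chart consists of its domain and its coordinate map. The manifold is the whole type
  \<open>'a\<close>, which is Hausdorff and second countable by its type class; its dimension is
  \<open>CARD('n)\<close>. Coordinate maps are only ever used on the domain of the chart.\<close>

datatype ('a, 'n::finite) chart = Chart (cdom: "'a set") (coord: "'a \<Rightarrow> real^'n")

definition cinv :: "('a, 'n::finite) chart \<Rightarrow> real^'n \<Rightarrow> 'a" where
  "cinv c = inv_into (cdom c) (coord c)"

text \<open>The representation of \<open>f\<close> in the coordinates of \<open>c\<close> is smooth on the part of the chart
  that lies in the open set \<open>W\<close>.\<close>

definition smooth_in :: "('a, 'n::finite) chart \<Rightarrow> 'a set \<Rightarrow> ('a \<Rightarrow> real) \<Rightarrow> bool" where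
  "smooth_in c W f \<longleftrightarrow> smooth_on (coord c ` (cdom c \<inter> W)) (f \<circ> cinv c)"

definition smooth_atlas ::
  "('a::{t2_space,second_countable_topology}, 'n::finite) chart set \<Rightarrow> bool" where
  "smooth_atlas A \<longleftrightarrow>
     (\<forall>c\<in>A. open (cdom c) \<and> open (coord c ` cdom c) \<and>
        homeomorphism (cdom c) (coord c ` cdom c) (coord c) (cinv c)) \<and>
     (\<Union>c\<in>A. cdom c) = UNIV \<and>
     (\<forall>c\<in>A. \<forall>d\<in>A. \<forall>k. smooth_in c (cdom d) (\<lambda>p. coord d p $ k))"

definition smooth_fun :: "('a, 'n::finite) chart set \<Rightarrow> ('a \<Rightarrow> real) \<Rightarrow> bool" where
  "smooth_fun A u \<longleftrightarrow> (\<forall>c\<in>A. smooth_in c UNIV u)"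

definition smooth_compact_support ::
  "('a::topological_space, 'n::finite) chart set \<Rightarrow> ('a \<Rightarrow> real) \<Rightarrow> bool" where
  "smooth_compact_support A u \<longleftrightarrow> smooth_fun A u \<and> compact (closure {p. u p \<noteq> 0})"

text \<open>The coordinate derivative \<open>\<partial>f/\<partial>x\<^sup>i\<close> at the point \<open>p\<close>, where \<open>x\<close> are the coordinates of
  \<open>c\<close>. In particular, if \<open>y\<close> are the coordinates of \<open>d\<close>, then \<open>jacobian c d p $ k $ i\<close> is
  \<open>\<partial>y\<^sup>k/\<partial>x\<^sup>i\<close>.\<close>

definition pd :: "('a, 'n::finite) chart \<Rightarrow> 'n \<Rightarrow> ('a \<Rightarrow> real) \<Rightarrow> 'a \<Rightarrow> real" where
  "pd c i f p = partial_deriv i (f \<circ> cinv c) (coord c p)"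

definition jacobian :: "('a, 'n::finite) chart \<Rightarrow> ('a, 'n) chart \<Rightarrow> 'a \<Rightarrow> real^'n^'n" where
  "jacobian c d p = (\<chi> k i. pd c i (\<lambda>q. coord d q $ k) p)"

text \<open>Tensor fields are families of components, one for each chart, that satisfy the
  transformation law on overlaps. So \<open>X c p\<close> is the coordinate vector of the tangent vector
  \<open>X\<^sub>p\<close> with respect to the basis \<open>\<partial>/\<partial>x\<^sup>1, \<dots>, \<partial>/\<partial>x\<^sup>n\<close> given by \<open>c\<close>; it is
  relevant only for \<open>c \<in> A\<close> and \<open>p \<in> cdom c\<close>.\<close>

definition smooth_vector_field ::
  "('a, 'n::finite) chart set \<Rightarrow> (('a, 'n) chart \<Rightarrow> 'a \<Rightarrow> real^'n) \<Rightarrow> bool" where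
  "smooth_vector_field A X \<longleftrightarrow>
     (\<forall>c\<in>A. \<forall>i. smooth_in c UNIV (\<lambda>p. X c p $ i)) \<and>
     (\<forall>c\<in>A. \<forall>d\<in>A. \<forall>p \<in> cdom c \<inter> cdom d. X d p = jacobian c d p *v X c p)"


section \<open>Riemannian metrics\<close>

text \<open>\<open>g c p $ i $ j\<close> is \<open>g\<^sub>p(\<partial>/\<partial>x\<^sup>i, \<partial>/\<partial>x\<^sup>j)\<close>.\<close>

type_synonym ('a, 'n) metric = "('a, 'n) chart \<Rightarrow> 'a \<Rightarrow> real^'n^'n"

definition riemannian_metric ::
  "('a, 'n::finite) chart set \<Rightarrow> ('a, 'n) metric \<Rightarrow> bool" where
  "riemannian_metric A g \<longleftrightarrow>
     (\<forall>c\<in>A. \<forall>i j. smooth_in c UNIV (\<lambda>p. g c p $ i $ j)) \<and>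
     (\<forall>c\<in>A. \<forall>p\<in>cdom c. transpose (g c p) = g c p \<and> (\<forall>v. v \<noteq> 0 \<longrightarrow> 0 < v \<bullet> (g c p *v v))) \<and>
     (\<forall>c\<in>A. \<forall>d\<in>A. \<forall>p \<in> cdom c \<inter> cdom d.
        g c p = transpose (jacobian c d p) ** g d p ** jacobian c d p)"

definition riemannian_manifold ::
  "('a::{t2_space,second_countable_topology}, 'n::finite) chart set \<Rightarrow> ('a, 'n) metric \<Rightarrow> bool"
  where "riemannian_manifold A g \<longleftrightarrow> smooth_atlas A \<and> riemannian_metric A g"

text \<open>The Riemannian volume measure is the Borel measure that is given by
  \<open>\<surd>det(g\<^sub>i\<^sub>j) dx\<^sup>1\<dots>dx\<^sup>n\<close> in every chart. It exists by the change of variables formula, and it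
  is unique because countably many charts cover the manifold.\<close>

definition riemannian_volume ::
  "('a::{t2_space,second_countable_topology}, 'n::finite) chart set \<Rightarrow> ('a, 'n) metric
    \<Rightarrow> 'a measure" where
  "riemannian_volume A g =
     (THE \<mu>. sets \<mu> = sets borel \<and>
        (\<forall>c\<in>A. \<forall>B\<in>sets borel. B \<subseteq> cdom c \<longrightarrow>
           emeasure \<mu> B =
             (\<integral>\<^sup>+x\<in>coord c ` B. ennreal (sqrt (det (g c (cinv c x)))) \<partial>lborel)))"

definition L2_norm :: "'a measure \<Rightarrow> ('a \<Rightarrow> real) \<Rightarrow> real" where
  "L2_norm \<mu> f = sqrt (\<integral>p. (f p)\<^sup>2 \<partial>\<mu>)"


section \<open>Levi-Civita connection\<close>

text \<open>\<open>christoffel g c p i j k\<close> is the coefficient \<open>\<Gamma>\<^sup>k\<^sub>i\<^sub>j\<close> in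
  \<open>\<nabla>\<^sub>i \<partial>\<^sub>j = \<Sum>\<^sub>k \<Gamma>\<^sup>k\<^sub>i\<^sub>j \<partial>\<^sub>k\<close>. The lemmas below show that these are the coefficients of the
  unique torsion-free connection that is compatible with the metric.\<close>

definition christoffel ::
  "('a, 'n::finite) metric \<Rightarrow> ('a, 'n) chart \<Rightarrow> 'a \<Rightarrow> 'n \<Rightarrow> 'n \<Rightarrow> 'n \<Rightarrow> real" where
  "christoffel g c p i j k =
     (\<Sum>l\<in>UNIV. matrix_inv (g c p) $ k $ l *
        (pd c i (\<lambda>q. g c q $ j $ l) p + pd c j (\<lambda>q. g c q $ i $ l) p
           - pd c l (\<lambda>q. g c q $ i $ j) p)) / 2"

text \<open>Covariant derivatives in the direction \<open>\<partial>\<^sub>i\<close> of a vector field and of a covector field,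
  both given by their components in the chart \<open>c\<close>.\<close>

definition cov_deriv ::
  "('a, 'n::finite) metric \<Rightarrow> ('a, 'n) chart \<Rightarrow> 'n \<Rightarrow> ('a \<Rightarrow> real^'n) \<Rightarrow> 'a \<Rightarrow> real^'n" where
  "cov_deriv g c i Y p =
     (\<chi> k. pd c i (\<lambda>q. Y q $ k) p + (\<Sum>j\<in>UNIV. christoffel g c p i j k * Y p $ j))"

definition cov_deriv_form ::
  "('a, 'n::finite) metric \<Rightarrow> ('a, 'n) chart \<Rightarrow> 'n \<Rightarrow> ('a \<Rightarrow> real^'n) \<Rightarrow> 'a \<Rightarrow> real^'n" where
  "cov_deriv_form g c i \<omega> p =
     (\<chi> j. pd c i (\<lambda>q. \<omega> q $ j) p - (\<Sum>k\<in>UNIV. christoffel g c p i j k * \<omega> p $ k))"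


section \<open>Ricci curvature, Hessian and Laplacian\<close>

text \<open>The curvature \<open>R(\<partial>\<^sub>i, \<partial>\<^sub>j)\<partial>\<^sub>k = \<nabla>\<^sub>i\<nabla>\<^sub>j\<partial>\<^sub>k - \<nabla>\<^sub>j\<nabla>\<^sub>i\<partial>\<^sub>k\<close>; coordinate vector fields
  commute. The Ricci tensor is \<open>Ric(Y, Z) = tr (V \<mapsto> R(V, Y)Z)\<close>, which is positive on round
  spheres.\<close>

definition curvature ::
  "('a, 'n::finite) metric \<Rightarrow> ('a, 'n) chart \<Rightarrow> 'n \<Rightarrow> 'n \<Rightarrow> 'n \<Rightarrow> 'a \<Rightarrow> real^'n" where
  "curvature g c i j k p =
     cov_deriv g c i (cov_deriv g c j (\<lambda>_. axis k 1)) p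
     - cov_deriv g c j (cov_deriv g c i (\<lambda>_. axis k 1)) p"

definition ricci_matrix ::
  "('a, 'n::finite) metric \<Rightarrow> ('a, 'n) chart \<Rightarrow> 'a \<Rightarrow> real^'n^'n" where
  "ricci_matrix g c p = (\<chi> j k. \<Sum>i\<in>UNIV. curvature g c i j k p $ i)"

definition diff_form ::
  "('a, 'n::finite) chart \<Rightarrow> ('a \<Rightarrow> real) \<Rightarrow> 'a \<Rightarrow> real^'n" where
  "diff_form c u p = (\<chi> j. pd c j u p)"

definition hess_matrix ::
  "('a, 'n::finite) metric \<Rightarrow> ('a, 'n) chart \<Rightarrow> ('a \<Rightarrow> real) \<Rightarrow> 'a \<Rightarrow> real^'n^'n" where
  "hess_matrix g c u p = (\<chi> i j. cov_deriv_form g c i (diff_form c u) p $ j)"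

text \<open>The following scalar quantities do not depend on the chart, so that they can be evaluated
  in an arbitrarily chosen chart around the point.\<close>

definition chart_at :: "('a, 'n::finite) chart set \<Rightarrow> 'a \<Rightarrow> ('a, 'n) chart" where
  "chart_at A p = (SOME c. c \<in> A \<and> p \<in> cdom c)"

definition metric_inner ::
  "('a, 'n::finite) chart set \<Rightarrow> ('a, 'n) metric \<Rightarrow> (('a, 'n) chart \<Rightarrow> 'a \<Rightarrow> real^'n)
    \<Rightarrow> (('a, 'n) chart \<Rightarrow> 'a \<Rightarrow> real^'n) \<Rightarrow> 'a \<Rightarrow> real" where
  "metric_inner A g X Y p = (let c = chart_at A p in X c p \<bullet> (g c p *v Y c p))"

definition metric_norm ::
  "('a, 'n::finite) chart set \<Rightarrow> ('a, 'n) metric \<Rightarrow> (('a, 'n) chart \<Rightarrow> 'a \<Rightarrow> real^'n)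
    \<Rightarrow> 'a \<Rightarrow> real" where
  "metric_norm A g X p = sqrt (metric_inner A g X X p)"

definition Ric ::
  "('a, 'n::finite) chart set \<Rightarrow> ('a, 'n) metric \<Rightarrow> (('a, 'n) chart \<Rightarrow> 'a \<Rightarrow> real^'n)
    \<Rightarrow> (('a, 'n) chart \<Rightarrow> 'a \<Rightarrow> real^'n) \<Rightarrow> 'a \<Rightarrow> real" where
  "Ric A g X Y p = (let c = chart_at A p in X c p \<bullet> (ricci_matrix g c p *v Y c p))"

text \<open>With \<open>G\<close> the inverse of the metric matrix,
  \<open>|H|\<^sup>2 = \<Sum>\<^sub>i\<^sub>j\<^sub>k\<^sub>l G\<^sup>i\<^sup>k G\<^sup>j\<^sup>l H\<^sub>i\<^sub>j H\<^sub>k\<^sub>l\<close> and \<open>tr H = \<Sum>\<^sub>i\<^sub>j G\<^sup>i\<^sup>j H\<^sub>i\<^sub>j\<close> for a 2-tensor \<open>H\<close>.\<close>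

definition hess_norm ::
  "('a, 'n::finite) chart set \<Rightarrow> ('a, 'n) metric \<Rightarrow> ('a \<Rightarrow> real) \<Rightarrow> 'a \<Rightarrow> real" where
  "hess_norm A g u p =
     (let c = chart_at A p; G = matrix_inv (g c p); H = hess_matrix g c u p
      in sqrt (\<Sum>i\<in>UNIV. \<Sum>j\<in>UNIV. \<Sum>k\<in>UNIV. \<Sum>l\<in>UNIV.
                 G $ i $ k * G $ j $ l * H $ i $ j * H $ k $ l))"

definition laplacian ::
  "('a, 'n::finite) chart set \<Rightarrow> ('a, 'n) metric \<Rightarrow> ('a \<Rightarrow> real) \<Rightarrow> 'a \<Rightarrow> real" where
  "laplacian A g u p =
     (let c = chart_at A p; G = matrix_inv (g c p); H = hess_matrix g c u p
      in - (\<Sum>i\<in>UNIV. \<Sum>j\<in>UNIV. G $ i $ j * H $ i $ j))"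


section \<open>The Christoffel symbols define the Levi-Civita connection\<close>

lemma matrix_inv_inverse:
  fixes M :: "real^'n^'n"
  assumes "invertible M"
  shows "M ** matrix_inv M = mat 1" "matrix_inv M ** M = mat 1"
  using assms unfolding invertible_def matrix_inv_def by (metis (mono_tags, lifting) someI_ex)+

lemma riemannian_metric_sym:
  assumes "riemannian_metric A g" "c \<in> A" "p \<in> cdom c"
  shows "g c p $ i $ j = g c p $ j $ i"
proof -
  have "transpose (g c p) = g c p" using assms unfolding riemannian_metric_def by blast
  then have "transpose (g c p) $ j $ i = g c p $ j $ i" by simp
  then show ?thesis by (simp add: transpose_def)
qed

lemma riemannian_metric_invertible:
  assumes "riemannian_metric A g" "c \<in> A" "p \<in> cdom c"
  shows "invertible (g c p)"
proof -
  have "v = 0" if "g c p *v v = 0" for v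
  proof (rule ccontr)
    assume "v \<noteq> 0"
    then have "0 < v \<bullet> (g c p *v v)" using assms unfolding riemannian_metric_def by blast
    then show False using that by simp
  qed
  then show ?thesis
    by (simp add: invertible_left_inverse matrix_left_invertible_ker)
qed

lemma pd_cong:
  assumes A: "smooth_atlas A" "c \<in> A" "p \<in> cdom c" and eq: "\<And>q. q \<in> cdom c \<Longrightarrow> f q = h q"
  shows "pd c i f p = pd c i h p"
proof -
  let ?S = "coord c ` cdom c"
  have S: "open ?S" "coord c p \<in> ?S" using A unfolding smooth_atlas_def by auto
  have agree: "(f \<circ> cinv c) y = (h \<circ> cinv c) y" if "y \<in> ?S" for y
    using that eq by (auto simp: cinv_def inv_into_into)
  have "(f \<circ> cinv c has_derivative D) (at (coord c p))
          = (h \<circ> cinv c has_derivative D) (at (coord c p))" for D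
    using has_derivative_transform_within_open[of "f \<circ> cinv c" D "coord c p" UNIV ?S "h \<circ> cinv c"]
      has_derivative_transform_within_open[of "h \<circ> cinv c" D "coord c p" UNIV ?S "f \<circ> cinv c"]
      S agree by metis
  then show ?thesis
    unfolding pd_def partial_deriv_def frechet_derivative_def by simp
qed

lemma pd_metric_sym:
  assumes "riemannian_manifold A g" "c \<in> A" "p \<in> cdom c"
  shows "pd c k (\<lambda>q. g c q $ i $ j) p = pd c k (\<lambda>q. g c q $ j $ i) p"
proof (rule pd_cong)
  show "smooth_atlas A" using assms(1) by (simp add: riemannian_manifold_def)
  show "g c q $ i $ j = g c q $ j $ i" if "q \<in> cdom c" for q
    using assms(1,2) that riemannian_metric_sym by (auto simp: riemannian_manifold_def)
qed (use assms in auto)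

lemma christoffel_torsion_free:
  assumes "riemannian_manifold A g" "c \<in> A" "p \<in> cdom c"
  shows "christoffel g c p i j k = christoffel g c p j i k"
proof -
  have "pd c l (\<lambda>q. g c q $ i $ j) p = pd c l (\<lambda>q. g c q $ j $ i) p" for l
    using assms by (rule pd_metric_sym)
  then show ?thesis
    unfolding christoffel_def by (simp only: add.commute)
qed

lemma christoffel_lowered:
  assumes "riemannian_manifold A g" "c \<in> A" "p \<in> cdom c"
  shows "(\<Sum>k\<in>UNIV. g c p $ m $ k * christoffel g c p i j k) =
           (pd c i (\<lambda>q. g c q $ j $ m) p + pd c j (\<lambda>q. g c q $ i $ m) p
             - pd c m (\<lambda>q. g c q $ i $ j) p) / 2"
proof -
  define w :: "real^'b" where
    "w = (\<chi> l. (pd c i (\<lambda>q. g c q $ j $ l) p + pd c j (\<lambda>q. g c q $ i $ l) p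
             - pd c l (\<lambda>q. g c q $ i $ j) p) / 2)"
  have inv: "invertible (g c p)"
    using assms by (auto simp: riemannian_manifold_def intro: riemannian_metric_invertible)
  have chr: "christoffel g c p i j k = (matrix_inv (g c p) *v w) $ k" for k
    by (simp add: christoffel_def w_def matrix_vector_mult_def sum_divide_distrib)
  have "(\<Sum>k\<in>UNIV. g c p $ m $ k * christoffel g c p i j k)
          = (g c p *v (matrix_inv (g c p) *v w)) $ m"
    unfolding chr by (simp add: matrix_vector_mult_def)
  also have "\<dots> = w $ m"
    using inv by (simp add: matrix_vector_mul_assoc matrix_inv_inverse)
  finally show ?thesis by (simp add: w_def)
qed

lemma christoffel_metric:
  assumes "riemannian_manifold A g" "c \<in> A" "p \<in> cdom c"
  shows "pd c i (\<lambda>q. g c q $ j $ k) p =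
           (\<Sum>l\<in>UNIV. christoffel g c p i j l * g c p $ l $ k)
           + (\<Sum>l\<in>UNIV. christoffel g c p i k l * g c p $ j $ l)"
proof -
  have sym: "g c p $ l $ k = g c p $ k $ l" for l
    using assms by (auto simp: riemannian_manifold_def intro: riemannian_metric_sym)
  show ?thesis
    using christoffel_lowered[OF assms, of k i j] christoffel_lowered[OF assms, of j i k]
      pd_metric_sym[OF assms, of i j k] pd_metric_sym[OF assms, of k i j]
      pd_metric_sym[OF assms, of j i k]
    unfolding sym by (simp only: mult.commute) argo
qed

lemma christoffel_unique:
  assumes "riemannian_manifold A g" "c \<in> A" "p \<in> cdom c"
    and tf: "\<And>i j k. \<Gamma> i j k = \<Gamma> j i k"
    and met: "\<And>i j k. pd c i (\<lambda>q. g c q $ j $ k) p =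
           (\<Sum>l\<in>UNIV. \<Gamma> i j l * g c p $ l $ k) + (\<Sum>l\<in>UNIV. \<Gamma> i k l * g c p $ j $ l)"
  shows "\<Gamma> i j k = christoffel g c p i j k"
proof -
  note M = assms(1-3)
  have sym: "g c p $ l $ k = g c p $ k $ l" for l k
    using M by (auto simp: riemannian_manifold_def intro: riemannian_metric_sym)
  have inv: "invertible (g c p)"
    using M by (auto simp: riemannian_manifold_def intro: riemannian_metric_invertible)
  define L where "L i j m = (\<Sum>l\<in>UNIV. \<Gamma> i j l * g c p $ m $ l)" for i j m
  have L: "pd c i (\<lambda>q. g c q $ j $ k) p = L i j k + L i k j" for i j k
    using met[of i j k] by (simp add: L_def sym[of _ k])
  have Ls: "L i j m = L j i m" for i j m
    by (simp add: L_def tf[of i j])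
  have "L i j m = (\<Sum>k\<in>UNIV. g c p $ m $ k * christoffel g c p i j k)" for m
    unfolding christoffel_lowered[OF M] L
    using Ls[of i j m] Ls[of m i j] Ls[of m j i] Ls[of j m i] by (simp add: L_def[symmetric])
  then have "g c p *v (\<chi> k. \<Gamma> i j k) = g c p *v (\<chi> k. christoffel g c p i j k)"
    by (simp add: vec_eq_iff matrix_vector_mult_def L_def mult.commute)
  then have "(\<chi> k. \<Gamma> i j k) = (\<chi> k. christoffel g c p i j k)"
    using inv by (metis matrix_inv_inverse(2) matrix_vector_mul_assoc matrix_vector_mul_lid)
  then show ?thesis by (simp add: vec_eq_iff)
qed

end

theory Submission
  imports Defs
begin

text \<open>Let \<open>X\<close> be the gradient of \<open>u\<close> and \<open>B = \<nabla>X\<close>, so that \<open>|Hess(u)|\<^sup>2 = tr(B\<^sup>2)\<close> and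
  \<open>\<Delta>u = - tr(B)\<close>. Commuting covariant derivatives gives
  \<open>div(\<nabla>\<^sub>X X - (div X) X) = tr(B\<^sup>2) - (tr B)\<^sup>2 + Ric(X, X)\<close>, and the divergence theorem turns this
  into \<open>\<parallel>Hess(u)\<parallel>\<^sup>2 = \<parallel>\<Delta>u\<parallel>\<^sup>2 - \<integral>Ric(X, X) \<le> \<parallel>\<Delta>u\<parallel>\<^sup>2 + C\<^sup>2 \<integral>|X|\<^sup>2\<close>. Likewise \<open>div(u X) = |X|\<^sup>2 - u \<Delta>u\<close>
  gives \<open>\<integral>|X|\<^sup>2 = \<integral>u \<Delta>u\<close>, which is estimated with Young's inequality. Completeness plays no role
  since both vector fields have compact support, where the divergence theorem reduces by a
  partition of unity to the vanishing of \<open>\<integral>\<partial>\<^sub>i F\<close> for compactly supported \<open>F\<close> on Euclidean space.\<close>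


section \<open>Calculus on open subsets of Euclidean space\<close>

text \<open>All geometry is done with components, so every global object has to be carried between
  charts. The transformation law of the Christoffel symbols is obtained from uniqueness of the
  Levi-Civita connection; after that, divergence and Hessian norm are traces of matrices that change
  by conjugation. Subtracting \<open>(div X) X\<close> removes the third derivatives of
  \<open>u\<close>: one divergence contributes \<open>X^j \<nabla>_i \<nabla>_j X^i\<close>, the
  other \<open>X^j \<nabla>_j \<nabla>_i X^i\<close>, and the difference is
  \<open>Ric(X, X)\<close>. That \<open>|Hess(u)|^2\<close> is the trace of the plain square of
  \<open>B\<close> reflects that \<open>B\<close> is self-adjoint for the metric. The volume measure
  is a definite description, so no integral can be evaluated before existence and uniqueness are
  proved. As the Bochner integral of a non-integrable function is 0, integrability is tracked
  throughout; it comes from continuity with compact support. One continuous derivative is enough for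
  the cut-off functions, so they are built from \<open>(max 0 t)^2\<close>.\<close>

lemma sum_axis: "(\<Sum>k\<in>UNIV. axis i (1::real) $ k * c k) = c i"
  by (simp add: axis_def if_distrib[of "\<lambda>y. y * _"] cong: if_cong)

lemma partial_deriv_eq:
  "(f has_derivative D) (at x) \<Longrightarrow> partial_deriv i f x = D (axis i 1)"
  by (simp add: partial_deriv_def frechet_derivative_at[symmetric])

lemma has_derivative_partial_deriv:
  assumes "f differentiable at x"
  shows "(f has_derivative (\<lambda>v. \<Sum>i\<in>UNIV. v $ i * partial_deriv i f x)) (at x)"
proof -
  obtain D where D: "(f has_derivative D) (at x)" using assms by (auto simp: differentiable_def)
  then have lin: "linear D" by (rule has_derivative_linear)
  have "D v = (\<Sum>i\<in>UNIV. v $ i * partial_deriv i f x)" for v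
  proof -
    have "D v = D (\<Sum>i\<in>UNIV. v $ i *\<^sub>R axis i 1)"
      using basis_expansion[of v] by (simp add: scalar_mult_eq_scaleR)
    also have "\<dots> = (\<Sum>i\<in>UNIV. v $ i * D (axis i 1))"
      by (simp add: linear_sum[OF lin] linear_scale[OF lin] o_def)
    finally show ?thesis by (simp add: partial_deriv_eq[OF D])
  qed
  then have "D = (\<lambda>v. \<Sum>i\<in>UNIV. v $ i * partial_deriv i f x)" by blast
  with D show ?thesis by simp
qed

lemma has_derivative_cong_open:
  assumes "open S" "x \<in> S" "\<And>y. y \<in> S \<Longrightarrow> f y = h y"
  shows "(f has_derivative D) (at x) \<longleftrightarrow> (h has_derivative D) (at x)"
  using has_derivative_transform_within_open[of f D x UNIV S h]
    has_derivative_transform_within_open[of h D x UNIV S f] assms by metis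

text \<open>\<open>frechet_derivative\<close> is a choice among all derivatives. The two functions
  have the same derivatives at \<open>x\<close>, so the choice is the same, even at points where
  neither is differentiable.\<close>

lemma partial_deriv_cong:
  assumes "open S" "x \<in> S" "\<And>y. y \<in> S \<Longrightarrow> f y = h y"
  shows "partial_deriv i f x = partial_deriv i h x"
  unfolding partial_deriv_def frechet_derivative_def
  using has_derivative_cong_open[where f = f and h = h, OF assms(1,2)] assms(3) by simp

lemma differentiable_cong_open:
  assumes "open S" "x \<in> S" "\<And>y. y \<in> S \<Longrightarrow> f y = h y"
  shows "f differentiable at x \<longleftrightarrow> h differentiable at x"
  unfolding differentiable_def
  using has_derivative_cong_open[where f = f and h = h, OF assms(1,2)] assms(3) by simp

lemma Ck_on_Suc_iff:
  assumes "open S"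
  shows "Ck_on (Suc k) S f \<longleftrightarrow> (\<forall>x\<in>S. f differentiable at x) \<and> (\<forall>i. Ck_on k S (partial_deriv i f))"
  by (simp add: differentiable_on_eq_differentiable_at[OF assms])

lemma Ck_on_cong:
  assumes "open S" "\<And>x. x \<in> S \<Longrightarrow> f x = h x"
  shows "Ck_on k S f \<longleftrightarrow> Ck_on k S h"
  using assms(2)
proof (induction k arbitrary: f h)
  case 0
  then show ?case using continuous_on_cong[of S S f h] by simp
next
  case (Suc k)
  have "Ck_on k S (partial_deriv i f) \<longleftrightarrow> Ck_on k S (partial_deriv i h)" for i
    by (rule Suc.IH) (rule partial_deriv_cong[OF assms(1) _ Suc.prems])
  moreover have "f differentiable at x \<longleftrightarrow> h differentiable at x" if "x \<in> S" for x
    by (rule differentiable_cong_open[OF assms(1) that Suc.prems])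
  ultimately show ?case by (simp add: Ck_on_Suc_iff[OF assms(1)] del: Ck_on.simps)
qed

lemma Ck_on_SucD: "open S \<Longrightarrow> Ck_on (Suc k) S f \<Longrightarrow> Ck_on k S f"
proof (induction k arbitrary: f)
  case 0
  then show ?case by (simp add: differentiable_imp_continuous_on)
qed auto

lemma Ck_on_const: "open (S :: (real^'a) set) \<Longrightarrow> Ck_on k S (\<lambda>x. a)"
proof (induction k arbitrary: a)
  case (Suc k)
  have "partial_deriv i (\<lambda>x::real^'a. a) = (\<lambda>x. 0)" for i
    by (intro ext partial_deriv_eq[where D = "\<lambda>_. 0", THEN trans]) (auto intro!: derivative_eq_intros)
  with Suc show ?case by simp
qed simp

lemma partial_deriv_add:
  assumes "f differentiable at x" "h differentiable at x"
  shows "partial_deriv i (\<lambda>x. f x + h x) x = partial_deriv i f x + partial_deriv i h x"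
  using partial_deriv_eq[OF has_derivative_add[OF has_derivative_partial_deriv has_derivative_partial_deriv, OF assms]]
  by (simp add: sum_axis)

lemma partial_deriv_mult:
  assumes "f differentiable at x" "h differentiable at x"
  shows "partial_deriv i (\<lambda>x. f x * h x) x = f x * partial_deriv i h x + partial_deriv i f x * h x"
  using partial_deriv_eq[OF has_derivative_mult[OF has_derivative_partial_deriv has_derivative_partial_deriv, OF assms]]
  by (simp add: sum_axis)

text \<open>The right side is written with products only, the shape on which the induction in
  \<open>Ck_on_inverse\<close> can use \<open>Ck_on_mult\<close> and
  \<open>Ck_on_const\<close>.\<close>

lemma partial_deriv_inverse:
  fixes f :: "real^'n \<Rightarrow> real"
  assumes "f differentiable at x" "f x \<noteq> 0"
  shows "partial_deriv i (\<lambda>x. inverse (f x)) x = (- 1) * (partial_deriv i f x * (inverse (f x) * inverse (f x)))"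
  using partial_deriv_eq[OF Deriv.has_derivative_inverse[OF assms(2) has_derivative_partial_deriv[OF assms(1)]]]
  by (simp add: sum_axis)

lemma differentiable_inverse_real:
  fixes f :: "real^'n \<Rightarrow> real"
  assumes "f differentiable at x" "f x \<noteq> 0"
  shows "(\<lambda>x. inverse (f x)) differentiable at x"
  using Deriv.has_derivative_inverse[OF assms(2) has_derivative_partial_deriv[OF assms(1)]]
  by (rule differentiableI)

lemma Ck_on_add: "open S \<Longrightarrow> Ck_on k S f \<Longrightarrow> Ck_on k S h \<Longrightarrow> Ck_on k S (\<lambda>x. f x + h x)"
proof (induction k arbitrary: f h)
  case 0
  then show ?case by (simp add: continuous_on_add)
next
  case (Suc k)
  have d: "f differentiable at x" "h differentiable at x" if "x \<in> S" for x
    using Suc.prems that by (auto simp: Ck_on_Suc_iff simp del: Ck_on.simps)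
  have "Ck_on k S (partial_deriv i (\<lambda>x. f x + h x))" for i
  proof -
    have "Ck_on k S (\<lambda>x. partial_deriv i f x + partial_deriv i h x)"
      using Suc by (intro Suc.IH) auto
    then show ?thesis
      by (rule Ck_on_cong[THEN iffD1, rotated 2]) (use Suc d in \<open>auto simp: partial_deriv_add\<close>)
  qed
  with d show ?case using Suc.prems(1) by (simp add: Ck_on_Suc_iff differentiable_add del: Ck_on.simps)
qed

lemma Ck_on_mult: "open S \<Longrightarrow> Ck_on k S f \<Longrightarrow> Ck_on k S h \<Longrightarrow> Ck_on k S (\<lambda>x. f x * h x)"
proof (induction k arbitrary: f h)
  case 0
  then show ?case by (simp add: continuous_on_mult)
next
  case (Suc k)
  have d: "f differentiable at x" "h differentiable at x" if "x \<in> S" for x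
    using Suc.prems that by (auto simp: Ck_on_Suc_iff simp del: Ck_on.simps)
  have "Ck_on k S (partial_deriv i (\<lambda>x. f x * h x))" for i
  proof -
    \<comment> \<open>The Leibniz terms contain \<open>f\<close> and \<open>h\<close>
      undifferentiated, so both are needed at level \<open>k\<close> as well.\<close>
    have "Ck_on k S (\<lambda>x. f x * partial_deriv i h x + partial_deriv i f x * h x)"
      using Suc Ck_on_SucD[OF Suc.prems(1,2)] Ck_on_SucD[OF Suc.prems(1,3)]
      by (intro Ck_on_add Suc.IH) auto
    then show ?thesis
      by (rule Ck_on_cong[THEN iffD1, rotated 2]) (use Suc d in \<open>auto simp: partial_deriv_mult\<close>)
  qed
  with d show ?case using Suc.prems(1) by (simp add: Ck_on_Suc_iff differentiable_mult del: Ck_on.simps)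
qed

text \<open>The derivative of \<open>1/f\<close> is built from the derivative of \<open>f\<close>
  and two copies of \<open>1/f\<close>, so the induction hypothesis for \<open>1/f\<close> itself
  carries the step.\<close>

lemma Ck_on_inverse:
  fixes f :: "real^'n \<Rightarrow> real"
  shows "open S \<Longrightarrow> (\<And>x. x \<in> S \<Longrightarrow> f x \<noteq> 0) \<Longrightarrow> Ck_on k S f \<Longrightarrow> Ck_on k S (\<lambda>x. inverse (f x))"
proof (induction k)
  case 0
  then show ?case by (simp add: continuous_on_inverse)
next
  case (Suc k)
  have d: "f differentiable at x" if "x \<in> S" for x
    using Suc.prems that by (auto simp: Ck_on_Suc_iff simp del: Ck_on.simps)
  have "Ck_on k S (\<lambda>x. inverse (f x))"
    using Suc Ck_on_SucD by blast
  moreover have "Ck_on k S (partial_deriv i f)" for i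
    using Suc.prems by simp
  ultimately have "Ck_on k S (\<lambda>x. (- 1) * (partial_deriv i f x * (inverse (f x) * inverse (f x))))" for i
    using Suc.prems(1) by (intro Ck_on_mult Ck_on_const) auto
  then have "Ck_on k S (partial_deriv i (\<lambda>x. inverse (f x)))" for i
    by (rule Ck_on_cong[THEN iffD1, rotated 2]) (use Suc.prems d in \<open>auto simp: partial_deriv_inverse\<close>)
  with d show ?case using Suc.prems(1,2)
    by (simp add: Ck_on_Suc_iff differentiable_inverse_real del: Ck_on.simps)
qed

lemma smooth_on_cong:
  "open S \<Longrightarrow> (\<And>x. x \<in> S \<Longrightarrow> f x = h x) \<Longrightarrow> smooth_on S f \<longleftrightarrow> smooth_on S h"
  unfolding smooth_on_def using Ck_on_cong by blast

lemma smooth_on_const: "open S \<Longrightarrow> smooth_on S (\<lambda>x. a)"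
  by (simp add: smooth_on_def Ck_on_const)

lemma smooth_on_add: "open S \<Longrightarrow> smooth_on S f \<Longrightarrow> smooth_on S h \<Longrightarrow> smooth_on S (\<lambda>x. f x + h x)"
  by (simp add: smooth_on_def Ck_on_add)

lemma smooth_on_mult: "open S \<Longrightarrow> smooth_on S f \<Longrightarrow> smooth_on S h \<Longrightarrow> smooth_on S (\<lambda>x. f x * h x)"
  by (simp add: smooth_on_def Ck_on_mult)

lemma smooth_on_inverse:
  "open S \<Longrightarrow> (\<And>x. x \<in> S \<Longrightarrow> f x \<noteq> 0) \<Longrightarrow> smooth_on S f \<Longrightarrow> smooth_on S (\<lambda>x. inverse (f x))"
  by (simp add: smooth_on_def Ck_on_inverse)

lemma smooth_on_sum:
  "open S \<Longrightarrow> (\<And>a. a \<in> I \<Longrightarrow> smooth_on S (f a)) \<Longrightarrow> smooth_on S (\<lambda>x. \<Sum>a\<in>I. f a x)"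
  by (induction I rule: infinite_finite_induct) (auto intro!: smooth_on_const smooth_on_add)

lemma smooth_on_prod:
  "open S \<Longrightarrow> (\<And>a. a \<in> I \<Longrightarrow> smooth_on S (f a)) \<Longrightarrow> smooth_on S (\<lambda>x. \<Prod>a\<in>I. f a x)"
  by (induction I rule: infinite_finite_induct) (auto intro!: smooth_on_const smooth_on_mult)

lemma smooth_on_partial_deriv: "smooth_on S f \<Longrightarrow> smooth_on S (partial_deriv i f)"
  unfolding smooth_on_def using Ck_on.simps(2) by blast

lemma smooth_on_differentiable: "open S \<Longrightarrow> smooth_on S f \<Longrightarrow> x \<in> S \<Longrightarrow> f differentiable at x"
  unfolding smooth_on_def using Ck_on_Suc_iff by blast

lemma smooth_on_continuous: "smooth_on S f \<Longrightarrow> continuous_on S f"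
  unfolding smooth_on_def using Ck_on.simps(1) by blast

text \<open>The second difference is the increment of
  \<open>s \<mapsto> f(x + s a + h b) - f(x + s a)\<close> over \<open>[0, h]\<close>. The mean
  value theorem in \<open>s\<close> and then in \<open>t\<close> turns it into a mixed derivative at
  some \<open>x + s a + t b\<close>, whose distance from \<open>x\<close> is at most
  \<open>s + t\<close>.\<close>

lemma second_difference_mean_value:
  fixes f :: "real^'n \<Rightarrow> real"
  assumes S: "ball x r \<subseteq> S" and h: "0 < h" "2 * h < r"
    and f: "\<And>y. y \<in> S \<Longrightarrow> f differentiable at y"
    and fi: "\<And>y. y \<in> S \<Longrightarrow> partial_deriv i f differentiable at y"
  shows "\<exists>y. dist y x \<le> 2 * h \<and>
    f (x + h *\<^sub>R axis i 1 + h *\<^sub>R axis j 1) - f (x + h *\<^sub>R axis i 1) - f (x + h *\<^sub>R axis j 1) + f x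
      = h * h * partial_deriv j (partial_deriv i f) y"
proof -
  define a b :: "real^'n" where "a = axis i 1" and "b = axis j 1"
  have norm: "norm a = 1" "norm b = 1" by (simp_all add: a_def b_def)
  have dist: "dist (x + s *\<^sub>R a + t *\<^sub>R b) x \<le> 2 * h" if "0 \<le> s" "s \<le> h" "0 \<le> t" "t \<le> h" for s t
  proof -
    have "norm (s *\<^sub>R a + t *\<^sub>R b) \<le> s + t"
      using norm that by (intro norm_triangle_le) simp
    then show ?thesis using that by (simp add: dist_norm algebra_simps)
  qed
  have inS: "x + s *\<^sub>R a + t *\<^sub>R b \<in> S" if "0 \<le> s" "s \<le> h" "0 \<le> t" "t \<le> h" for s t
    using dist[OF that] S h by (auto simp: dist_commute subset_iff)
  have da: "((\<lambda>s. f (x + s *\<^sub>R a + t *\<^sub>R b)) has_real_derivative partial_deriv i f (x + s *\<^sub>R a + t *\<^sub>R b)) (at s)"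
    if "0 \<le> s" "s \<le> h" "0 \<le> t" "t \<le> h" for s t
  proof -
    have "(f \<circ> (\<lambda>s. x + s *\<^sub>R a + t *\<^sub>R b) has_derivative
        (\<lambda>v. \<Sum>k\<in>UNIV. v $ k * partial_deriv k f (x + s *\<^sub>R a + t *\<^sub>R b)) \<circ> (\<lambda>s. s *\<^sub>R a)) (at s)"
      using inS[OF that] by (intro diff_chain_at has_derivative_partial_deriv f)
        (auto intro!: derivative_eq_intros)
    then show ?thesis
      by (simp add: has_field_derivative_def o_def a_def mult.assoc sum_distrib_left[symmetric] sum_axis
          mult_commute_abs)
  qed
  have db: "((\<lambda>t. partial_deriv i f (x + s *\<^sub>R a + t *\<^sub>R b)) has_real_derivative
      partial_deriv j (partial_deriv i f) (x + s *\<^sub>R a + t *\<^sub>R b)) (at t)"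
    if "0 \<le> s" "s \<le> h" "0 \<le> t" "t \<le> h" for s t
  proof -
    have "(partial_deriv i f \<circ> (\<lambda>t. x + s *\<^sub>R a + t *\<^sub>R b) has_derivative
        (\<lambda>v. \<Sum>k\<in>UNIV. v $ k * partial_deriv k (partial_deriv i f) (x + s *\<^sub>R a + t *\<^sub>R b))
          \<circ> (\<lambda>t. t *\<^sub>R b)) (at t)"
      using inS[OF that] by (intro diff_chain_at has_derivative_partial_deriv fi)
        (auto intro!: derivative_eq_intros)
    then show ?thesis
      by (simp add: has_field_derivative_def o_def b_def mult.assoc sum_distrib_left[symmetric] sum_axis
          mult_commute_abs)
  qed
  have "\<exists>s>0. s < h \<and>
      (f (x + h *\<^sub>R a + h *\<^sub>R b) - f (x + h *\<^sub>R a + 0 *\<^sub>R b)) - (f (x + 0 *\<^sub>R a + h *\<^sub>R b) - f (x + 0 *\<^sub>R a + 0 *\<^sub>R b))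
       = (h - 0) * (partial_deriv i f (x + s *\<^sub>R a + h *\<^sub>R b) - partial_deriv i f (x + s *\<^sub>R a + 0 *\<^sub>R b))"
    using h by (intro MVT2 DERIV_diff da) auto
  then obtain s where s: "0 < s" "s < h" and
    eq1: "(f (x + h *\<^sub>R a + h *\<^sub>R b) - f (x + h *\<^sub>R a)) - (f (x + h *\<^sub>R b) - f x)
       = h * (partial_deriv i f (x + s *\<^sub>R a + h *\<^sub>R b) - partial_deriv i f (x + s *\<^sub>R a))"
    by auto
  have "\<exists>t>0. t < h \<and> partial_deriv i f (x + s *\<^sub>R a + h *\<^sub>R b) - partial_deriv i f (x + s *\<^sub>R a + 0 *\<^sub>R b)
       = (h - 0) * partial_deriv j (partial_deriv i f) (x + s *\<^sub>R a + t *\<^sub>R b)"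
    using h s by (intro MVT2 db) auto
  then obtain t where t: "0 < t" "t < h" and
    eq2: "partial_deriv i f (x + s *\<^sub>R a + h *\<^sub>R b) - partial_deriv i f (x + s *\<^sub>R a)
       = h * partial_deriv j (partial_deriv i f) (x + s *\<^sub>R a + t *\<^sub>R b)"
    by auto
  show ?thesis
    using dist[of s t] s t eq1 eq2 by (intro exI[of _ "x + s *\<^sub>R a + t *\<^sub>R b"]) (auto simp: a_def b_def)
qed

text \<open>The second difference is symmetric in the two directions. Evaluating it in both orders
  gives equal values of the two mixed derivatives at points close to \<open>x\<close>, and
  continuity carries this to \<open>x\<close>.\<close>

lemma partial_deriv_commute:
  assumes S: "open S" "x \<in> S" and f: "Ck_on 2 S f"
  shows "partial_deriv i (partial_deriv j f) x = partial_deriv j (partial_deriv i f) x"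
proof (rule ccontr)
  let ?F = "\<lambda>i j. partial_deriv i (partial_deriv j f)"
  assume ne: "?F i j x \<noteq> ?F j i x"
  \<comment> \<open>Half the supposed gap: two equal values that are both closer than
    \<open>e\<close> to the respective limits contradict it.\<close>
  define e where "e = \<bar>?F i j x - ?F j i x\<bar> / 2"
  have e: "e > 0" using ne by (simp add: e_def)
  have f2: "Ck_on (Suc (Suc 0)) S f" using f by (simp add: numeral_2_eq_2)
  have d1: "f differentiable at y" and d2: "partial_deriv k f differentiable at y" if "y \<in> S" for y k
    using f2 that S(1) by (auto simp: Ck_on_Suc_iff simp del: Ck_on.simps)
  have c: "isCont (?F k l) x" for k l
    using f2 S by (auto simp: continuous_on_eq_continuous_at)
  obtain r where r: "r > 0" "ball x r \<subseteq> S" using S open_contains_ball by metis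
  obtain d where d: "d > 0" "\<And>y. dist y x < d \<Longrightarrow> dist (?F i j y) (?F i j x) < e"
    using c[of i j] e unfolding continuous_at_eps_delta by metis
  obtain d' where d': "d' > 0" "\<And>y. dist y x < d' \<Longrightarrow> dist (?F j i y) (?F j i x) < e"
    using c[of j i] e unfolding continuous_at_eps_delta by metis
  \<comment> \<open>Dividing by 3 makes \<open>2 * h\<close>, the radius from the mean value lemma,
    smaller than all three radii.\<close>
  define h where "h = min r (min d d') / 3"
  have h: "0 < h" "2 * h < r" "2 * h < d" "2 * h < d'"
    using r(1) d(1) d'(1) by (auto simp: h_def min_def)
  obtain y where y: "dist y x \<le> 2 * h" and
    ey: "f (x + h *\<^sub>R axis i 1 + h *\<^sub>R axis j 1) - f (x + h *\<^sub>R axis i 1) - f (x + h *\<^sub>R axis j 1) + f x = h * h * ?F j i y"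
    using second_difference_mean_value[OF r(2) h(1,2) d1 d2] by blast
  obtain z where z: "dist z x \<le> 2 * h" and
    ez: "f (x + h *\<^sub>R axis j 1 + h *\<^sub>R axis i 1) - f (x + h *\<^sub>R axis j 1) - f (x + h *\<^sub>R axis i 1) + f x = h * h * ?F i j z"
    using second_difference_mean_value[OF r(2) h(1,2) d1 d2] by blast
  have "x + h *\<^sub>R axis j 1 + h *\<^sub>R axis i 1 = x + h *\<^sub>R axis i 1 + h *\<^sub>R axis j 1"
    by (simp add: add_ac)
  with ey ez h(1) have "?F j i y = ?F i j z" by (auto simp: algebra_simps)
  moreover have "dist (?F i j z) (?F i j x) < e" using d(2)[of z] z h by simp
  moreover have "dist (?F j i y) (?F j i x) < e" using d'(2)[of y] y h by simp
  ultimately show False unfolding dist_real_def e_def by argo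
qed


text \<open>By translation invariance the difference quotients have vanishing integrals.\<close>

lemma integral_partial_deriv_eq_0:
  fixes F :: "real^'n \<Rightarrow> real"
  assumes F: "\<And>x. F differentiable at x" and cont: "continuous_on UNIV (partial_deriv i F)"
    and K: "compact K" and zero: "\<And>x. x \<notin> K \<Longrightarrow> F x = 0"
  shows "integrable lborel (partial_deriv i F)" "(\<integral>x. partial_deriv i F x \<partial>lborel) = 0"
proof -
  let ?D = "partial_deriv i F"
  let ?a = "axis i 1 :: real^'n"
  have D0: "?D x = 0" if "x \<notin> K" for x
  proof -
    have "?D x = partial_deriv i (\<lambda>_. 0) x"
      using K that zero by (intro partial_deriv_cong[of "- K"]) (auto simp: compact_imp_closed)
    then show ?thesis by (simp add: partial_deriv_eq[OF has_derivative_const])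
  qed
  have cF: "continuous_on UNIV F"
    using F by (auto intro!: differentiable_imp_continuous_on simp: differentiable_on_def)
  have "integrable lborel (\<lambda>x. indicator K x *\<^sub>R ?D x)" "integrable lborel (\<lambda>x. indicator K x *\<^sub>R F x)"
    using K cont cF by (intro borel_integrable_compact; blast intro: continuous_on_subset)+
  moreover have "(\<lambda>x. indicator K x *\<^sub>R ?D x) = ?D" "(\<lambda>x. indicator K x *\<^sub>R F x) = F"
    using D0 zero by (auto simp: fun_eq_iff indicator_def)
  ultimately have intF: "integrable lborel F" and intD: "integrable lborel ?D" by simp_all
  show "integrable lborel ?D" by (rule intD)
  have "compact (?D ` K)"
    using K cont by (intro compact_continuous_image) (auto elim: continuous_on_subset)
  then obtain B where B: "\<And>x. x \<in> K \<Longrightarrow> \<bar>?D x\<bar> \<le> B"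
    by (metis compact_imp_bounded bounded_real imageI)
  \<comment> \<open>\<open>K\<close> may be empty, in which case \<open>B\<close> need not be
    nonnegative.\<close>
  define B' where "B' = max B 0"
  have B': "\<bar>?D x\<bar> \<le> B'" for x
    using B[of x] D0[of x] by (cases "x \<in> K") (auto simp: B'_def)
  obtain R where R: "K \<subseteq> cball 0 R"
    using compact_imp_bounded[OF K] by (auto simp: bounded_iff subset_iff)
  define h where "h n = inverse (real (Suc n))" for n
  have h: "0 < h n" "h n \<le> 1" for n
    by (auto simp: h_def inverse_le_1_iff)
  define q where "q n x = (F (h n *\<^sub>R ?a + x) - F x) / h n" for n x
  have line: "((\<lambda>s. F (s *\<^sub>R ?a + x)) has_real_derivative ?D (s *\<^sub>R ?a + x)) (at s)" for s x
  proof -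
    have "(F \<circ> (\<lambda>s. s *\<^sub>R ?a + x) has_derivative
        (\<lambda>v. \<Sum>k\<in>UNIV. v $ k * partial_deriv k F (s *\<^sub>R ?a + x)) \<circ> (\<lambda>s. s *\<^sub>R ?a)) (at s)"
      by (intro diff_chain_at has_derivative_partial_deriv F) (auto intro!: derivative_eq_intros)
    then show ?thesis
      by (simp add: has_field_derivative_def o_def mult.assoc sum_distrib_left[symmetric] sum_axis
          mult_commute_abs)
  qed
  \<comment> \<open>A shift by \<open>h n \<le> 1\<close> cannot bring a point from outside the ball
    of radius \<open>R + 1\<close> into \<open>K\<close>, so one integrable function dominates all
    difference quotients.\<close>
  have bound: "\<bar>q n x\<bar> \<le> B' * indicator (cball 0 (R + 1)) x" for n x
  proof (cases "x \<in> cball 0 (R + 1)")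
    case True
    have "\<exists>s>0. s < h n \<and> F (h n *\<^sub>R ?a + x) - F (0 *\<^sub>R ?a + x) = (h n - 0) * ?D (s *\<^sub>R ?a + x)"
      using h by (intro MVT2 line) auto
    then obtain s where "F (h n *\<^sub>R ?a + x) - F x = h n * ?D (s *\<^sub>R ?a + x)" by auto
    then have "q n x = ?D (s *\<^sub>R ?a + x)" using h(1)[of n] by (simp add: q_def)
    with True B' show ?thesis by (simp add: indicator_def)
  next
    case False
    have "norm x \<le> norm (h n *\<^sub>R ?a + x) + h n"
      using norm_triangle_ineq2[of x "- h n *\<^sub>R ?a"] h[of n] by (simp add: algebra_simps)
    with False R h[of n] have "x \<notin> K" "h n *\<^sub>R ?a + x \<notin> K" by (auto simp: subset_iff)
    then show ?thesis using False by (simp add: q_def zero)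
  qed
  have qlim: "(\<lambda>n. q n x) \<longlonglongrightarrow> ?D x" for x
  proof -
    have "((\<lambda>s. (F (s *\<^sub>R ?a + x) - F x) / s) \<longlongrightarrow> ?D x) (at 0)"
      using line[of x 0] by (simp add: has_field_derivative_iff)
    moreover have "filterlim h (at 0) sequentially"
      using LIMSEQ_inverse_real_of_nat h(1) unfolding h_def[abs_def]
      by (auto simp: filterlim_at eventually_at_filter intro!: always_eventually)
    ultimately show ?thesis unfolding q_def by (rule filterlim_compose)
  qed
  have shift: "has_bochner_integral lborel (\<lambda>x. F (c + x)) (integral\<^sup>L lborel F)" for c
  proof -
    have "has_bochner_integral (distr lborel borel ((+) c)) F (integral\<^sup>L lborel F)"
      using intF by (simp add: lborel_distr_plus has_bochner_integral_iff)
    then show ?thesis by (simp add: has_bochner_integral_iff integral_distr integrable_distr_eq cF borel_measurable_continuous_onI)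
  qed
  have q0: "integral\<^sup>L lborel (q n) = 0" for n
    using shift[of "h n *\<^sub>R ?a"] intF unfolding q_def
    by (simp add: has_bochner_integral_iff)
  have "(\<lambda>n. integral\<^sup>L lborel (q n)) \<longlonglongrightarrow> integral\<^sup>L lborel ?D"
  proof (rule integral_dominated_convergence[where w = "\<lambda>x. B' * indicator (cball 0 (R + 1)) x"])
    show "?D \<in> borel_measurable lborel" using cont by (simp add: borel_measurable_continuous_onI)
    show "q n \<in> borel_measurable lborel" for n
      using shift[of "h n *\<^sub>R ?a"] intF unfolding q_def by (auto simp: has_bochner_integral_iff)
    show "integrable lborel (\<lambda>x. B' * indicator (cball 0 (R + 1)) x)"
      by (intro integrable_mult_right integrable_real_indicator) (use emeasure_bounded_finite[OF bounded_cball] in auto)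
  qed (use qlim bound in auto)
  then show "integral\<^sup>L lborel ?D = 0" by (simp add: q0 LIMSEQ_const_iff)
qed

text \<open>The radial profile of the bump functions. Squaring smooths the corner of
  \<open>max 0 t\<close> just enough to make the derivative continuous.\<close>

lemma has_real_derivative_max_0_squared: "((\<lambda>t::real. (max 0 t)\<^sup>2) has_real_derivative 2 * max 0 t) (at t)"
proof -
  consider "t > 0" | "t < 0" | "t = 0" by linarith
  then show ?thesis
  proof cases
    case 1
    have "((\<lambda>t::real. t\<^sup>2) has_real_derivative 2 * t) (at t)" by (auto intro!: derivative_eq_intros)
    then have "((\<lambda>t::real. (max 0 t)\<^sup>2) has_real_derivative 2 * t) (at t)"
      by (rule DERIV_cong_ev[THEN iffD1, rotated 3])
        (use 1 eventually_nhds_in_open[of "{0<..}" t] in \<open>auto elim!: eventually_mono\<close>)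
    with 1 show ?thesis by simp
  next
    case 2
    have "((\<lambda>t::real. (max 0 t)\<^sup>2) has_real_derivative 0) (at t)"
      by (rule DERIV_cong_ev[THEN iffD1, rotated 3, OF DERIV_const[of 0]])
        (use 2 eventually_nhds_in_open[of "{..<0}" t] in \<open>auto elim!: eventually_mono\<close>)
    with 2 show ?thesis by simp
  next
    case 3
    have "((\<lambda>h::real. (max 0 h)\<^sup>2 / h) \<longlongrightarrow> 0) (at 0)"
      by (rule Lim_null_comparison[OF _ tendsto_norm_zero[OF tendsto_ident_at]])
        (auto simp: max_def power2_eq_square)
    with 3 show ?thesis by (simp add: has_field_derivative_iff)
  qed
qed


section \<open>Determinants and positive definite matrices\<close>

text \<open>Jacobi's formula. Differentiating the permutation expansion gives a sum of determinants,
  in each of which one row is replaced by its derivative; Cramer's rule evaluates them.\<close>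

lemma has_derivative_det:
  fixes B :: "real^'m \<Rightarrow> real^'n^'n"
  assumes B: "\<And>i j. ((\<lambda>x. B x $ i $ j) has_derivative D i j) (at x)" and inv: "invertible (B x)"
  shows "((\<lambda>x. det (B x)) has_derivative
     (\<lambda>v. det (B x) * (\<Sum>k\<in>UNIV. \<Sum>l\<in>UNIV. matrix_inv (B x) $ l $ k * D k l v))) (at x)"
proof -
  let ?P = "{p. p permutes (UNIV :: 'n set)}"
  define M where "M v k = (\<chi> i. if i = k then (\<chi> l. D k l v) else row i (B x))" for v k
  have "((\<lambda>x. det (B x)) has_derivative (\<lambda>v. \<Sum>p\<in>?P. of_int (sign p) *
      (\<Sum>k\<in>UNIV. D k (p k) v * (\<Prod>j\<in>UNIV - {k}. B x $ j $ p j)))) (at x)"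
    unfolding det_def by (intro has_derivative_sum has_derivative_mult_right has_derivative_prod B)
  moreover have "(\<Sum>p\<in>?P. of_int (sign p) * (\<Sum>k\<in>UNIV. D k (p k) v * (\<Prod>j\<in>UNIV - {k}. B x $ j $ p j)))
      = (\<Sum>k\<in>UNIV. det (M v k))" for v
  proof -
    have "D k (p k) v * (\<Prod>j\<in>UNIV - {k}. B x $ j $ p j) = (\<Prod>j\<in>UNIV. M v k $ j $ p j)" for k p
    proof -
      have "(\<Prod>j\<in>UNIV - {k}. B x $ j $ p j) = (\<Prod>j\<in>UNIV - {k}. M v k $ j $ p j)"
        by (intro prod.cong) (auto simp: M_def row_def)
      moreover have "D k (p k) v = M v k $ k $ p k" by (simp add: M_def)
      ultimately show ?thesis by (simp add: prod.remove[of UNIV k])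
    qed
    then show ?thesis
      unfolding det_def sum_distrib_left by (subst sum.swap) simp
  qed
  moreover have "det (M v k) = (\<Sum>l\<in>UNIV. matrix_inv (B x) $ l $ k * D k l v) * det (B x)" for v k
  proof -
    \<comment> \<open>The coefficients of the differentiated row in the basis of rows of
      \<open>B x\<close>. In the determinant only the coefficient of row \<open>k\<close>
      survives.\<close>
    define y where "y = (\<chi> i. \<Sum>l\<in>UNIV. D k l v * matrix_inv (B x) $ l $ i)"
    have y: "(\<Sum>i\<in>UNIV. y $ i *s row i (B x)) = (\<chi> l. D k l v)"
    proof -
      have "(\<Sum>i\<in>UNIV. (\<Sum>l'\<in>UNIV. D k l' v * matrix_inv (B x) $ l' $ i) * B x $ i $ l) = D k l v" for l
      proof -
        have id: "(\<Sum>i\<in>UNIV. matrix_inv (B x) $ l' $ i * B x $ i $ l) = (if l' = l then 1 else 0)" for l'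
          using matrix_inv_inverse(2)[OF inv] by (simp add: matrix_matrix_mult_def mat_def vec_eq_iff)
        have "D k l v = (\<Sum>l'\<in>UNIV. D k l' v * (\<Sum>i\<in>UNIV. matrix_inv (B x) $ l' $ i * B x $ i $ l))"
          unfolding id by (simp add: if_distrib cong: if_cong)
        also have "\<dots> = (\<Sum>i\<in>UNIV. \<Sum>l'\<in>UNIV. D k l' v * matrix_inv (B x) $ l' $ i * B x $ i $ l)"
          unfolding sum_distrib_left by (subst sum.swap) (simp add: mult.assoc)
        finally show ?thesis by (simp add: sum_distrib_right)
      qed
      then show ?thesis by (simp add: vec_eq_iff y_def row_def)
    qed
    have "M v k = (\<chi> i. if i = k then \<Sum>i\<in>UNIV. y $ i *s row i (B x) else row i (B x))"
      by (simp only: M_def y)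
    then have "det (M v k) = y $ k * det (B x)" by (simp add: cramer_lemma_transpose)
    then show ?thesis by (simp add: y_def mult.commute)
  qed
  ultimately show ?thesis by (simp add: sum_distrib_left mult.commute)
qed

text \<open>Cramer's rule, which reduces smoothness of the inverse matrix to polynomials and one
  reciprocal.\<close>

lemma matrix_inv_entry:
  fixes A :: "real^'n^'n"
  assumes "invertible A"
  shows "matrix_inv A $ k $ l = det (\<chi> i j. if j = k then axis l 1 $ i else A $ i $ j) * inverse (det A)"
proof -
  have "A *v (matrix_inv A *v axis l 1) = axis l 1"
    by (simp add: matrix_vector_mul_assoc matrix_inv_inverse[OF assms])
  then have "matrix_inv A *v axis l 1
      = (\<chi> k. det (\<chi> i j. if j = k then axis l 1 $ i else A $ i $ j) / det A)"
    using assms by (simp add: cramer invertible_det_nz)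
  then show ?thesis by (simp add: matrix_vector_mult_basis column_def vec_eq_iff divide_inverse)
qed

lemma smooth_on_det:
  fixes B :: "real^'m \<Rightarrow> real^'n^'n"
  assumes "open S" "\<And>i j. smooth_on S (\<lambda>x. B x $ i $ j)"
  shows "smooth_on S (\<lambda>x. det (B x))"
  unfolding det_def using assms
  by (intro smooth_on_sum smooth_on_mult smooth_on_const smooth_on_prod)

lemma smooth_on_matrix_inv:
  fixes B :: "real^'m \<Rightarrow> real^'n^'n"
  assumes S: "open S" and B: "\<And>i j. smooth_on S (\<lambda>x. B x $ i $ j)"
    and inv: "\<And>x. x \<in> S \<Longrightarrow> invertible (B x)"
  shows "smooth_on S (\<lambda>x. matrix_inv (B x) $ k $ l)"
proof -
  have "smooth_on S (\<lambda>x. (\<chi> i j. if j = k then axis l 1 $ i else B x $ i $ j) $ i $ j)" for i j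
    using B S by (cases "j = k") (simp_all add: smooth_on_const)
  then have "smooth_on S (\<lambda>x. det (\<chi> i j. if j = k then axis l 1 $ i else B x $ i $ j) * inverse (det (B x)))"
    using inv S B by (intro smooth_on_mult smooth_on_det smooth_on_inverse) (auto simp: invertible_det_nz)
  then show ?thesis
    by (rule smooth_on_cong[OF S, THEN iffD1, rotated]) (simp add: matrix_inv_entry inv)
qed

text \<open>The segment from the identity matrix to \<open>A\<close> consists of invertible matrices.\<close>

lemma det_pos_if_positive_definite:
  fixes A :: "real^'n^'n"
  assumes pos: "\<And>v. v \<noteq> 0 \<Longrightarrow> 0 < v \<bullet> (A *v v)"
  shows "0 < det A"
proof (rule ccontr)
  assume neg: "\<not> 0 < det A"
  define P where "P t = (1 - t) *\<^sub>R mat 1 + t *\<^sub>R A" for t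
  have nz: "det (P t) \<noteq> 0" if "0 \<le> t" "t \<le> 1" for t
  proof -
    have "v = 0" if v: "P t *v v = 0" for v
    proof (rule ccontr)
      assume "v \<noteq> 0"
      then have "0 < v \<bullet> v" "0 < v \<bullet> (A *v v)" using pos by auto
      moreover have "v \<bullet> (P t *v v) = (1 - t) * (v \<bullet> v) + t * (v \<bullet> (A *v v))"
        by (simp add: P_def matrix_vector_mult_add_rdistrib scaleR_matrix_vector_assoc[symmetric]
            inner_right_distrib)
      ultimately have "0 < v \<bullet> (P t *v v)"
        using \<open>0 \<le> t\<close> \<open>t \<le> 1\<close>
        by (cases "t = 0") (auto intro!: add_nonneg_pos)
      with v show False by simp
    qed
    then show ?thesis
      by (simp add: invertible_det_nz[symmetric] invertible_left_inverse matrix_left_invertible_ker)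
  qed
  have "continuous_on {0..1} (\<lambda>t. det (P t))"
    unfolding det_def P_def by (simp, intro continuous_intros)
  moreover have "det (P 0) = 1" "det (P 1) = det A" by (simp_all add: P_def)
  ultimately obtain t where "0 \<le> t" "t \<le> 1" "det (P t) = 0"
    using IVT2'[of "\<lambda>t. det (P t)" 1 0 0] neg by auto
  with nz show False by blast
qed

text \<open>Induction by taking Schur complements of \<open>G\<close>, each of which splits off a rank one matrix.\<close>

lemma sum_mult_nonneg_if_semidefinite:
  fixes G M :: "'i \<Rightarrow> 'i \<Rightarrow> real"
  assumes "finite T" and sym: "\<And>j l. G j l = G l j"
    and "\<And>x j. j \<in> T \<Longrightarrow> x j \<noteq> 0 \<Longrightarrow> 0 < (\<Sum>j\<in>T. \<Sum>l\<in>T. G j l * x j * x l)"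
    and "\<And>x. 0 \<le> (\<Sum>j\<in>T. \<Sum>l\<in>T. M j l * x j * x l)"
  shows "0 \<le> (\<Sum>j\<in>T. \<Sum>l\<in>T. G j l * M j l)"
  using assms
proof (induction T arbitrary: G rule: finite_induct)
  case (insert t T)
  have ins: "(\<Sum>j\<in>insert t T. \<Sum>l\<in>insert t T. f j l)
      = f t t + (\<Sum>l\<in>T. f t l) + (\<Sum>j\<in>T. f j t) + (\<Sum>j\<in>T. \<Sum>l\<in>T. f j l)" for f :: "'i \<Rightarrow> 'i \<Rightarrow> real"
    using insert.hyps by (simp add: sum.distrib)
  define a where "a = G t t"
  have a: "a > 0"
  proof -
    have z: "(\<Sum>l\<in>T. G t l * of_bool (l = t)) = 0" "(\<Sum>l\<in>T. G l t * of_bool (l = t)) = 0"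
      "(\<Sum>j\<in>T. \<Sum>l\<in>T. G j l * of_bool (j = t) * of_bool (l = t)) = 0"
      using insert.hyps by (auto intro!: sum.neutral)
    have "0 < (\<Sum>j\<in>insert t T. \<Sum>l\<in>insert t T. G j l * of_bool (j = t) * of_bool (l = t))"
      by (rule insert.prems(2)[of t]) auto
    then show ?thesis using z by (simp add: ins a_def)
  qed
  \<comment> \<open>The Schur complement of the entry \<open>G t t\<close>.\<close>
  define G' where "G' j l = G j l - G j t * G t l / a" for j l
  have "0 \<le> (\<Sum>j\<in>T. \<Sum>l\<in>T. G' j l * M j l)"
  proof (rule insert.IH)
    show "G' j l = G' l j" for j l
      using insert.prems(1) by (simp add: G'_def mult.commute)
    show "0 < (\<Sum>j\<in>T. \<Sum>l\<in>T. G' j l * x j * x l)" if "j \<in> T" "x j \<noteq> 0" for x j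
    proof -
      define s where "s = (\<Sum>l\<in>T. G t l * x l)"
      \<comment> \<open>The value \<open>- s / a\<close> at \<open>t\<close> minimizes the quadratic
        form of \<open>G\<close> with the other coordinates fixed, and the minimum is the quadratic
        form of \<open>G'\<close> at \<open>x\<close>.\<close>
      define y where "y i = (if i = t then - s / a else x i)" for i
      have yT: "y i = x i" if "i \<in> T" for i using that insert.hyps by (auto simp: y_def)
      have "0 < (\<Sum>j\<in>insert t T. \<Sum>l\<in>insert t T. G j l * y j * y l)"
        using that yT by (intro insert.prems(2)[of j]) auto
      also have "\<dots> = a * (s / a)\<^sup>2 - (s / a) * s - s * (s / a) + (\<Sum>j\<in>T. \<Sum>l\<in>T. G j l * x j * x l)"
      proof -
        have "(\<Sum>l\<in>T. G t l * y t * y l) = - (s / a) * s"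
        proof -
          have "(\<Sum>l\<in>T. G t l * y t * y l) = (\<Sum>l\<in>T. - (s / a) * (G t l * x l))"
            by (intro sum.cong) (auto simp: yT y_def[of t])
          then show ?thesis by (simp only: sum_distrib_left[symmetric] s_def[symmetric])
        qed
        moreover have "(\<Sum>j\<in>T. G j t * y j * y t) = - (s / a) * s"
        proof -
          have "(\<Sum>j\<in>T. G j t * y j * y t) = (\<Sum>j\<in>T. - (s / a) * (G t j * x j))"
            using insert.prems(1)[of _ t] by (intro sum.cong) (auto simp: yT y_def[of t])
          then show ?thesis by (simp only: sum_distrib_left[symmetric] s_def[symmetric])
        qed
        moreover have "(\<Sum>j\<in>T. \<Sum>l\<in>T. G j l * y j * y l) = (\<Sum>j\<in>T. \<Sum>l\<in>T. G j l * x j * x l)"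
          by (simp add: yT)
        ultimately show ?thesis by (simp add: ins a_def y_def power2_eq_square)
      qed
      also have "\<dots> = (\<Sum>j\<in>T. \<Sum>l\<in>T. G j l * x j * x l) - s * s / a"
        using a by (simp add: power2_eq_square field_simps)
      also have "s * s / a = (\<Sum>j\<in>T. \<Sum>l\<in>T. G j t * G t l / a * x j * x l)"
      proof -
        have "s * s / a = (\<Sum>j\<in>T. \<Sum>l\<in>T. G t j * x j * (G t l * x l) / a)"
          by (simp add: s_def sum_product sum_divide_distrib)
        also have "\<dots> = (\<Sum>j\<in>T. \<Sum>l\<in>T. G j t * G t l / a * x j * x l)"
          by (intro sum.cong refl) (simp add: insert.prems(1)[of t])
        finally show ?thesis .
      qed
      finally show ?thesis by (simp add: G'_def sum_subtractf left_diff_distrib)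
    qed
    show "0 \<le> (\<Sum>j\<in>T. \<Sum>l\<in>T. M j l * x j * x l)" for x
    proof -
      have *: "(\<Sum>j\<in>insert t T. \<Sum>l\<in>insert t T. M j l * (if j = t then 0 else x j) * (if l = t then 0 else x l))
          = (\<Sum>j\<in>T. \<Sum>l\<in>T. M j l * x j * x l)"
        using insert.hyps by (simp add: ins) (intro sum.cong; auto)
      show ?thesis
        using insert.prems(3)[of "\<lambda>j. if j = t then 0 else x j"] unfolding * .
    qed
  qed
  \<comment> \<open>The rank one matrix split off from \<open>G\<close> pairs with \<open>M\<close>
    to the quadratic form of \<open>M\<close> at the column \<open>G _ t\<close>, divided by
    \<open>a > 0\<close>.\<close>
  moreover have "(\<Sum>j\<in>insert t T. \<Sum>l\<in>insert t T. G j l * M j l)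
      = (\<Sum>j\<in>insert t T. \<Sum>l\<in>insert t T. M j l * G j t * G t l) / a + (\<Sum>j\<in>T. \<Sum>l\<in>T. G' j l * M j l)"
  proof -
    have "(\<Sum>l\<in>T. M t l * G t t * G t l) = a * (\<Sum>l\<in>T. G t l * M t l)"
      "(\<Sum>j\<in>T. M j t * G j t * G t t) = a * (\<Sum>j\<in>T. G j t * M j t)"
      by (simp_all add: a_def sum_distrib_left mult_ac)
    moreover have "(\<Sum>j\<in>T. \<Sum>l\<in>T. G' j l * M j l)
        = (\<Sum>j\<in>T. \<Sum>l\<in>T. G j l * M j l) - (\<Sum>j\<in>T. \<Sum>l\<in>T. M j l * G j t * G t l) / a"
      by (simp add: G'_def sum_subtractf sum_divide_distrib algebra_simps)
    ultimately show ?thesis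
      using a unfolding ins a_def[symmetric] by (simp add: field_simps)
  qed
  moreover have "(\<Sum>j\<in>insert t T. \<Sum>l\<in>insert t T. M j l * G j t * G t l)
      = (\<Sum>j\<in>insert t T. \<Sum>l\<in>insert t T. M j l * G j t * G l t)"
    by (intro sum.cong refl arg_cong2[where f = "(*)"] insert.prems(1))
  ultimately show ?case
    using insert.prems(3)[of "\<lambda>j. G j t"] a by simp
qed simp

section \<open>Sums of matrices and traces of similar matrices\<close>

lemma matrix_add_mul_distrib: "(A + B) ** C = A ** C + B ** (C :: real^'n^'n)"
  by (simp add: matrix_matrix_mult_def vec_eq_iff distrib_right sum.distrib)

lemma transpose_plus: "transpose (A + B) = transpose A + transpose (B :: real^'n^'n)"
  by (simp add: transpose_def vec_eq_iff)

lemma sum_matrix_mul: "finite I \<Longrightarrow> (\<Sum>r\<in>I. F r) ** B = (\<Sum>r\<in>I. F r ** (B :: real^'n^'n))"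
  by (induction I rule: finite_induct) (simp_all add: matrix_add_mul_distrib)

lemma matrix_mul_sum: "finite I \<Longrightarrow> B ** (\<Sum>r\<in>I. F r) = (\<Sum>r\<in>I. B ** (F r :: real^'n^'n))"
  by (induction I rule: finite_induct) (simp_all add: matrix_add_ldistrib)

lemma transpose_sum: "finite I \<Longrightarrow> transpose (\<Sum>r\<in>I. F r) = (\<Sum>r\<in>I. transpose (F r :: real^'n^'n))"
  by (induction I rule: finite_induct) (simp_all add: transpose_plus transpose_def[of 0] vec_eq_iff[of _ 0])

lemma sum_matrix_vector_mul: "finite I \<Longrightarrow> (\<Sum>r\<in>I. F r) *v x = (\<Sum>r\<in>I. (F r :: real^'n^'n) *v x)"
  by (induction I rule: finite_induct) (simp_all add: matrix_vector_mult_add_rdistrib)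

text \<open>Similarity is stated as an intertwining relation, the form in which the transformation
  law of covariant derivatives is proved.\<close>

lemma trace_similar:
  fixes M N J :: "real^'n^'n"
  assumes "J ** M = N ** J" "K ** J = mat 1" "J ** K = mat 1"
  shows "trace M = trace N" "trace (M ** M) = trace (N ** N)"
proof -
  have similar: "trace P = trace Q" if "J ** P = Q ** J" for P Q
  proof -
    have "P = K ** (Q ** J)" using that assms(2) by (metis matrix_mul_assoc matrix_mul_lid)
    then have "trace P = trace ((Q ** J) ** K)" by (simp only: trace_mul_sym[of K])
    also have "(Q ** J) ** K = Q ** (J ** K)" by (rule matrix_mul_assoc[symmetric])
    finally show ?thesis by (simp add: assms(3))
  qed
  show "trace M = trace N" by (rule similar) fact
  have "J ** (M ** M) = (N ** J) ** M" by (simp only: matrix_mul_assoc assms(1))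
  also have "\<dots> = N ** (N ** J)" by (simp only: matrix_mul_assoc[symmetric] assms(1))
  finally show "trace (M ** M) = trace (N ** N)" by (intro similar) (simp only: matrix_mul_assoc)
qed


section \<open>Change of variables\<close>

text \<open>The change of variables theorem of the library requires a well-ordered index type, so it is
  transferred along an enumeration of the index type.\<close>

typedef 'n ordered_copy = "UNIV :: 'n set" by auto

instance ordered_copy :: (finite) finite
proof
  have "UNIV = Abs_ordered_copy ` (UNIV :: 'a set)"
    by (auto intro: Rep_ordered_copy_inverse[symmetric] image_eqI)
  then show "finite (UNIV :: 'a ordered_copy set)" by (metis finite finite_imageI)
qed

instantiation ordered_copy :: (finite) wellorder
begin

definition ordered_copy_index :: "'a ordered_copy \<Rightarrow> nat" where
  "ordered_copy_index x = to_nat_on (UNIV :: 'a set) (Rep_ordered_copy x)"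

definition less_eq_ordered_copy :: "'a ordered_copy \<Rightarrow> 'a ordered_copy \<Rightarrow> bool" where
  "less_eq_ordered_copy x y \<longleftrightarrow> ordered_copy_index x \<le> ordered_copy_index y"

definition less_ordered_copy :: "'a ordered_copy \<Rightarrow> 'a ordered_copy \<Rightarrow> bool" where
  "less_ordered_copy x y \<longleftrightarrow> ordered_copy_index x < ordered_copy_index y"

lemma ordered_copy_index_inj: "ordered_copy_index x = ordered_copy_index y \<Longrightarrow> x = (y :: 'a ordered_copy)"
  using inj_on_to_nat_on[of "UNIV :: 'a set"]
  by (auto simp: ordered_copy_index_def Rep_ordered_copy_inject countable_finite dest: inj_onD)

instance
proof
  fix P :: "'a ordered_copy \<Rightarrow> bool" and a
  assume step: "\<And>x. (\<And>y. y < x \<Longrightarrow> P y) \<Longrightarrow> P x"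
  show "P a"
    by (induction a rule: measure_induct_rule[of ordered_copy_index])
      (auto intro: step simp: less_ordered_copy_def)
qed (auto simp: less_eq_ordered_copy_def less_ordered_copy_def intro: ordered_copy_index_inj)

end

section \<open>Relabelling the coordinates of Euclidean space\<close>

definition reindex :: "real^'n \<Rightarrow> real^('n::finite ordered_copy)" where
  "reindex x = (\<chi> i. x $ Rep_ordered_copy i)"

definition unreindex :: "real^('n::finite ordered_copy) \<Rightarrow> real^'n" where
  "unreindex y = (\<chi> i. y $ Abs_ordered_copy i)"

lemma reindex_inverse [simp]: "unreindex (reindex x) = x" "reindex (unreindex y) = y"
  by (simp_all add: reindex_def unreindex_def Abs_ordered_copy_inverse Rep_ordered_copy_inverse)

lemma bounded_linear_reindex: "bounded_linear reindex" "bounded_linear unreindex"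
  by (auto simp: reindex_def unreindex_def linear_conv_bounded_linear[symmetric] vec_eq_iff intro!: linearI)

lemma bij_Rep_ordered_copy: "bij Rep_ordered_copy"
  by (metis bij_betw_def inj_def Rep_ordered_copy_inject surj_def Abs_ordered_copy_inverse UNIV_I)

lemma measurable_reindex [measurable]:
  "reindex \<in> borel_measurable borel" "unreindex \<in> borel_measurable borel"
  using bounded_linear_reindex
  by (auto intro!: borel_measurable_continuous_onI linear_continuous_on)

lemma prod_Basis_vec: "(\<Prod>b\<in>(Basis :: (real^'n) set). f b) = (\<Prod>i\<in>UNIV. f (axis i 1))"
proof -
  have "(Basis :: (real^'n) set) = range (\<lambda>i. axis i 1)" by (auto simp: Basis_vec_def)
  moreover have "inj (\<lambda>i::'n. axis i (1::real))" by (simp add: inj_def axis_eq_axis)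
  ultimately show ?thesis using prod.reindex[of "\<lambda>i::'n. axis i (1::real)" UNIV f] by (simp only: o_def)
qed

text \<open>Lebesgue measure is determined by the volumes of boxes, and relabelling turns a box into
  a box with the same side lengths.\<close>

lemma lborel_eq_distr_reindex: "lborel = distr lborel borel reindex"
proof (rule lborel_eqI)
  fix l u :: "real^'a ordered_copy"
  assume "\<And>b. b \<in> Basis \<Longrightarrow> l \<bullet> b \<le> u \<bullet> b"
  then have le: "l $ i \<le> u $ i" for i by (metis axis_in_Basis_iff inner_axis inner_real_def Basis_real_def insertI1 mult.right_neutral)
  have "reindex -` box l u = box (unreindex l) (unreindex u)"
  proof -
    have "(\<forall>i. l $ i < x $ Rep_ordered_copy i \<and> x $ Rep_ordered_copy i < u $ i) \<longleftrightarrow>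
        (\<forall>i. l $ Abs_ordered_copy i < x $ i \<and> x $ i < u $ Abs_ordered_copy i)" for x :: "real^'a"
      by (metis Rep_ordered_copy_inverse Abs_ordered_copy_inverse UNIV_I)
    then show ?thesis by (auto simp: mem_box_cart reindex_def unreindex_def)
  qed
  then have "emeasure (distr lborel borel reindex) (box l u) = emeasure lborel (box (unreindex l) (unreindex u))"
    by (simp add: emeasure_distr)
  also have "\<dots> = (\<Prod>b\<in>Basis. (unreindex u - unreindex l) \<bullet> b)"
    using le by (intro emeasure_lborel_box) (auto simp: Basis_vec_def inner_axis unreindex_def)
  also have "(\<Prod>b\<in>Basis. (unreindex u - unreindex l) \<bullet> b) = (\<Prod>b\<in>Basis. (u - l) \<bullet> b)"
    unfolding prod_Basis_vec
    by (rule prod.reindex_bij_witness[of _ Rep_ordered_copy Abs_ordered_copy])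
      (auto simp: inner_axis unreindex_def Abs_ordered_copy_inverse Rep_ordered_copy_inverse)
  finally show "emeasure (distr lborel borel reindex) (box l u) = (\<Prod>b\<in>Basis. (u - l) \<bullet> b)" .
qed simp

lemma nn_integral_lborel_reindex:
  assumes "h \<in> borel_measurable borel"
  shows "(\<integral>\<^sup>+y. h y \<partial>lborel) = (\<integral>\<^sup>+x. h (reindex x) \<partial>lborel)"
  using assms by (subst lborel_eq_distr_reindex) (simp add: nn_integral_distr)

text \<open>Conjugation by \<open>f\<close> is a sign preserving bijection between the permutations
  of the two index types.\<close>

lemma det_reindex:
  fixes M :: "real^'n^'n" and f :: "'m::finite \<Rightarrow> 'n"
  assumes f: "bij f"
  shows "det (\<chi> i j. M $ f i $ f j) = det M"
proof -
  have inj: "inj f" and surj: "surj f" using f by (auto simp: bij_def)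
  have app: "map_permutation UNIV f p (f i) = f (p i)" if "p permutes UNIV" for p i
    using inj by (intro map_permutation_apply) auto
  show ?thesis
    unfolding det_def
  proof (rule sum.reindex_bij_witness[of _ "map_permutation UNIV (inv f)" "map_permutation UNIV f"])
    fix p assume p: "p \<in> {p. p permutes (UNIV :: 'm set)}"
    then show "map_permutation UNIV (inv f) (map_permutation UNIV f p) = p"
      using inj surj by (intro map_permutation_compose_inv[of _ _ UNIV]) (auto simp: f)
    show "map_permutation UNIV f p \<in> {p. p permutes UNIV}"
      using p f by (auto intro: map_permutation_permutes)
    have "(\<Prod>i\<in>UNIV. M $ i $ map_permutation UNIV f p i) = (\<Prod>i\<in>UNIV. M $ f i $ map_permutation UNIV f p (f i))"
      by (rule prod.reindex_bij_betw[OF f, symmetric])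
    then show "of_int (sign (map_permutation UNIV f p)) * (\<Prod>i\<in>UNIV. M $ i $ map_permutation UNIV f p i) =
      of_int (sign p) * (\<Prod>i\<in>UNIV. (\<chi> i j. M $ f i $ f j) $ i $ p i)"
      using p inj by (simp add: sign_map_permutation app)
  next
    fix q assume q: "q \<in> {p. p permutes (UNIV :: 'n set)}"
    then show "map_permutation UNIV f (map_permutation UNIV (inv f) q) = q"
      using inj surj f by (intro map_permutation_compose_inv[of _ _ UNIV]) (auto simp: bij_imp_bij_inv surj_f_inv_f)
    show "map_permutation UNIV (inv f) q \<in> {p. p permutes UNIV}"
      using q f by (auto intro: map_permutation_permutes bij_imp_bij_inv)
  qed
qed

text \<open>The change of variables theorem speaks of absolutely integrable functions with values in
  some \<open>real^'m\<close>. For nonnegative scalar functions, \<open>real^1\<close> translates it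
  into \<open>has_integral\<close>.\<close>

lemma has_integral_vec1_iff:
  fixes h :: "'a::euclidean_space \<Rightarrow> real"
  assumes "\<And>x. x \<in> X \<Longrightarrow> 0 \<le> h x"
  shows "(h has_integral b) X \<longleftrightarrow>
    (\<lambda>x. vec (h x) :: real^1) absolutely_integrable_on X \<and> integral X (\<lambda>x. vec (h x) :: real^1) = vec b"
proof
  assume h: "(h has_integral b) X"
  have "bounded_linear (vec :: real \<Rightarrow> real^1)"
    by (auto simp: linear_conv_bounded_linear[symmetric] vec_eq_iff intro!: linearI)
  from has_integral_linear[OF h this]
  have v: "((\<lambda>x. vec (h x) :: real^1) has_integral vec b) X" by (simp add: o_def)
  have "(\<lambda>x. norm (vec (h x) :: real^1)) integrable_on X"
    by (rule integrable_eq[of h]) (use h assms in \<open>auto simp: norm_vector_1\<close>)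
  with v show "(\<lambda>x. vec (h x) :: real^1) absolutely_integrable_on X \<and> integral X (\<lambda>x. vec (h x) :: real^1) = vec b"
    by (auto intro!: absolutely_integrable_onI integral_unique)
next
  assume "(\<lambda>x. vec (h x) :: real^1) absolutely_integrable_on X \<and> integral X (\<lambda>x. vec (h x) :: real^1) = vec b"
  then have "((\<lambda>x. vec (h x) :: real^1) has_integral vec b) X"
    by (metis has_integral_iff set_lebesgue_integral_eq_integral(1))
  from has_integral_linear[OF this bounded_linear_vec_nth[of 1]]
  show "(h has_integral b) X" by (simp add: o_def)
qed

text \<open>For nonnegative functions, having integral \<open>b\<close> means having Lebesgue
  integral \<open>ennreal b\<close>. The theorem on \<open>has_integral\<close> thus matches finite
  values, and infinite ones follow by exclusion.\<close>

lemma nn_integral_change_of_variables_wellorder: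
  fixes \<tau> :: "real^'n::{finite,wellorder} \<Rightarrow> real^'n::_" and f :: "real^'n::_ \<Rightarrow> real"
  assumes S: "S \<in> sets borel" and T: "\<tau> ` S \<in> sets borel"
    and der: "\<And>x. x \<in> S \<Longrightarrow> (\<tau> has_derivative (*v) (J x)) (at x)"
    and inj: "inj_on \<tau> S" and nonneg: "\<And>y. y \<in> \<tau> ` S \<Longrightarrow> 0 \<le> f y"
    and m1: "(\<lambda>y. indicator (\<tau> ` S) y * f y) \<in> borel_measurable borel"
    and m2: "(\<lambda>x. indicator S x * (\<bar>det (J x)\<bar> * f (\<tau> x))) \<in> borel_measurable borel"
  shows "(\<integral>\<^sup>+y. ennreal (indicator (\<tau> ` S) y * f y) \<partial>lborel)
    = (\<integral>\<^sup>+x. ennreal (indicator S x * (\<bar>det (J x)\<bar> * f (\<tau> x))) \<partial>lborel)"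
    (is "?I = ?K")
proof -
  have key: "((\<lambda>x. \<bar>det (J x)\<bar> * f (\<tau> x)) has_integral b) S \<longleftrightarrow> (f has_integral b) (\<tau> ` S)" for b
  proof -
    have "(\<lambda>x. \<bar>det (matrix ((*v) (J x)))\<bar> *\<^sub>R vec (f (\<tau> x)) :: real^1) absolutely_integrable_on S \<and>
        integral S (\<lambda>x. \<bar>det (matrix ((*v) (J x)))\<bar> *\<^sub>R vec (f (\<tau> x))) = (vec b :: real^1)
        \<longleftrightarrow> (\<lambda>y. vec (f y) :: real^1) absolutely_integrable_on (\<tau> ` S)
          \<and> integral (\<tau> ` S) (\<lambda>y. vec (f y)) = (vec b :: real^1)"
      using S inj by (intro has_absolute_integral_change_of_variables)
        (auto intro: der has_derivative_at_withinI)
    moreover have "(\<lambda>x. \<bar>det (matrix ((*v) (J x)))\<bar> *\<^sub>R vec (f (\<tau> x)) :: real^1)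
        = (\<lambda>x. vec (\<bar>det (J x)\<bar> * f (\<tau> x)))" by (simp add: vec_eq_iff fun_eq_iff)
    ultimately show ?thesis
      using has_integral_vec1_iff[of S "\<lambda>x. \<bar>det (J x)\<bar> * f (\<tau> x)" b] has_integral_vec1_iff[of "\<tau> ` S" f b] nonneg
      by simp
  qed
  have nn: "(h has_integral b) X \<longleftrightarrow> (\<integral>\<^sup>+x. ennreal (indicator X x * h x) \<partial>lborel) = ennreal b \<and> 0 \<le> b"
    if "\<And>x. x \<in> X \<Longrightarrow> 0 \<le> h x" and m: "(\<lambda>x. indicator X x * h x) \<in> borel_measurable borel"
    for h :: "real^'n::_ \<Rightarrow> real" and X b
  proof -
    have "(h has_integral b) X \<longleftrightarrow> ((\<lambda>x. indicator X x * h x) has_integral b) UNIV"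
      by (subst has_integral_restrict_UNIV[symmetric], rule has_integral_cong) (simp add: indicator_def)
    also have "\<dots> \<longleftrightarrow> (\<lambda>x. indicator X x * h x) \<in> lebesgue \<rightarrow>\<^sub>M borel
        \<and> (\<integral>\<^sup>+x. ennreal (indicator X x * h x) \<partial>lebesgue) = ennreal b \<and> 0 \<le> b"
      using that by (intro has_integral_iff_nn_integral_lebesgue) (auto simp: indicator_def)
    finally show ?thesis
      using m by (simp add: nn_integral_completion measurable_completion)
  qed
  \<comment> \<open>Holding for every real \<open>b\<close>, this rules out that exactly one of the
    two sides is infinite.\<close>
  have iff: "?K = ennreal b \<and> 0 \<le> b \<longleftrightarrow> ?I = ennreal b \<and> 0 \<le> b" for b
    using key[of b] nonneg m1 m2 by (simp add: nn)
  show ?thesis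
  proof (cases ?I)
    case (real r)
    then show ?thesis using iff[of r] by simp
  next
    case top
    show ?thesis
    proof (cases ?K)
      case (real r)
      then show ?thesis using iff[of r] by simp
    qed (use top in simp)
  qed
qed

text \<open>The map is conjugated by \<open>reindex\<close>, which changes neither Lebesgue
  integrals nor the determinant of the derivative.\<close>

lemma nn_integral_change_of_variables:
  fixes \<tau> :: "real^'n \<Rightarrow> real^'n" and f :: "real^'n \<Rightarrow> real"
  assumes S: "S \<in> sets borel" and T: "\<tau> ` S \<in> sets borel"
    and der: "\<And>x. x \<in> S \<Longrightarrow> (\<tau> has_derivative (*v) (J x)) (at x)"
    and inj: "inj_on \<tau> S" and nonneg: "\<And>y. y \<in> \<tau> ` S \<Longrightarrow> 0 \<le> f y"
    and m1: "(\<lambda>y. indicator (\<tau> ` S) y * f y) \<in> borel_measurable borel"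
    and m2: "(\<lambda>x. indicator S x * (\<bar>det (J x)\<bar> * f (\<tau> x))) \<in> borel_measurable borel"
  shows "(\<integral>\<^sup>+y. ennreal (indicator (\<tau> ` S) y * f y) \<partial>lborel)
    = (\<integral>\<^sup>+x. ennreal (indicator S x * (\<bar>det (J x)\<bar> * f (\<tau> x))) \<partial>lborel)"
proof -
  define S' where "S' = reindex ` S"
  define \<tau>' where "\<tau>' = reindex \<circ> \<tau> \<circ> unreindex"
  define f' where "f' = f \<circ> unreindex"
  define J' :: "_ \<Rightarrow> real^'n ordered_copy^'n ordered_copy" where
    "J' x = (\<chi> i j. J (unreindex x) $ Rep_ordered_copy i $ Rep_ordered_copy j)" for x
  have mem: "reindex x \<in> reindex ` X \<longleftrightarrow> x \<in> X" "y \<in> reindex ` X \<longleftrightarrow> unreindex y \<in> X" for x y and X :: "(real^'n) set"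
    by (metis (no_types, lifting) imageE imageI reindex_inverse)+
  have sets: "reindex ` X \<in> sets borel" if "X \<in> sets borel" for X :: "(real^'n) set"
  proof -
    have "reindex ` X = unreindex -` X \<inter> space borel" using mem(2) by auto
    then show ?thesis using measurable_sets[OF measurable_reindex(2) that] by simp
  qed
  have im: "\<tau>' ` S' = reindex ` (\<tau> ` S)" by (simp add: \<tau>'_def S'_def image_image)
  have det: "det (J' (reindex x)) = det (J x)" for x
    unfolding J'_def using det_reindex[OF bij_Rep_ordered_copy, of "J x"] by simp
  have eq1: "indicator (\<tau>' ` S') y * f' y = indicator (\<tau> ` S) (unreindex y) * f (unreindex y)" for y
    unfolding im by (simp add: mem indicator_def f'_def)
  have eq2: "indicator S' x * (\<bar>det (J' x)\<bar> * f' (\<tau>' x))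
      = indicator S (unreindex x) * (\<bar>det (J (unreindex x))\<bar> * f (\<tau> (unreindex x)))" for x
    using det[of "unreindex x"] by (simp add: S'_def mem indicator_def f'_def \<tau>'_def)
  note m1' = measurable_compose[OF measurable_reindex(2) m1]
  note m2' = measurable_compose[OF measurable_reindex(2) m2]
  have "(\<integral>\<^sup>+y. ennreal (indicator (\<tau>' ` S') y * f' y) \<partial>lborel)
    = (\<integral>\<^sup>+x. ennreal (indicator S' x * (\<bar>det (J' x)\<bar> * f' (\<tau>' x))) \<partial>lborel)"
  proof (rule nn_integral_change_of_variables_wellorder)
    show "S' \<in> sets borel" using S sets by (simp add: S'_def)
    show "\<tau>' ` S' \<in> sets borel" unfolding im using T by (rule sets)
    show "(\<tau>' has_derivative (*v) (J' x)) (at x)" if "x \<in> S'" for x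
    proof -
      have "unreindex x \<in> S" using that mem by (simp add: S'_def)
      then have "(\<tau>' has_derivative reindex \<circ> (*v) (J (unreindex x)) \<circ> unreindex) (at x)"
        unfolding \<tau>'_def
        by (intro diff_chain_at bounded_linear.has_derivative[OF bounded_linear_reindex(1), unfolded o_def[symmetric]])
          (auto intro!: bounded_linear_imp_has_derivative bounded_linear_reindex der)
      moreover have "(reindex \<circ> (*v) (J (unreindex x)) \<circ> unreindex) v = J' x *v v" for v
      proof -
        have "(\<Sum>j\<in>UNIV. J (unreindex x) $ i $ j * v $ Abs_ordered_copy j)
            = (\<Sum>j\<in>UNIV. J (unreindex x) $ i $ Rep_ordered_copy j * v $ j)" for i
          by (rule sum.reindex_bij_witness[of _ Rep_ordered_copy Abs_ordered_copy])
            (auto simp: Abs_ordered_copy_inverse Rep_ordered_copy_inverse)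
        then show ?thesis
          by (simp add: vec_eq_iff reindex_def unreindex_def[of v] matrix_vector_mult_def J'_def)
      qed
      then have "reindex \<circ> (*v) (J (unreindex x)) \<circ> unreindex = (*v) (J' x)" by auto
      ultimately show ?thesis by simp
    qed
    show "inj_on \<tau>' S'"
      using inj mem unfolding \<tau>'_def S'_def inj_on_def by (metis comp_apply reindex_inverse)
    show "0 \<le> f' y" if "y \<in> \<tau>' ` S'" for y
      using that nonneg unfolding im by (auto simp: f'_def)
  qed (use m1' m2' in \<open>simp_all add: eq1 eq2\<close>)
  then show ?thesis
    unfolding eq1 eq2 using m1' m2' by (simp add: nn_integral_lborel_reindex)
qed


section \<open>Calculus in charts\<close>

definition differentiable_in :: "('a, 'n::finite) chart \<Rightarrow> 'a \<Rightarrow> ('a \<Rightarrow> real) \<Rightarrow> bool" where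
  "differentiable_in c p f \<longleftrightarrow> (f \<circ> cinv c) differentiable (at (coord c p))"

text \<open>A local notion, so that fields multiplied by cut-off functions, extended by zero or read
  in another chart stay within it. Continuity of \<open>f\<close> itself follows from
  differentiability.\<close>

definition C1_at :: "('a::topological_space, 'n::finite) chart \<Rightarrow> 'a \<Rightarrow> ('a \<Rightarrow> real) \<Rightarrow> bool" where
  "C1_at c p f \<longleftrightarrow> (\<exists>W. open W \<and> p \<in> W \<and> W \<subseteq> cdom c \<and>
     (\<forall>q\<in>W. differentiable_in c q f) \<and> (\<forall>i. continuous_on W (pd c i f)))"

lemma pd_const: "pd c i (\<lambda>q. a) p = 0"
  by (simp add: pd_def o_def partial_deriv_eq[OF has_derivative_const])

lemma differentiable_in_const: "differentiable_in c p (\<lambda>q. a)"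
  by (simp add: differentiable_in_def o_def)

lemma differentiable_in_add:
  "differentiable_in c p f \<Longrightarrow> differentiable_in c p h \<Longrightarrow> differentiable_in c p (\<lambda>q. f q + h q)"
  by (simp add: differentiable_in_def o_def differentiable_add)

lemma differentiable_in_mult:
  "differentiable_in c p f \<Longrightarrow> differentiable_in c p h \<Longrightarrow> differentiable_in c p (\<lambda>q. f q * h q)"
  by (simp add: differentiable_in_def o_def differentiable_mult)

lemma differentiable_in_sum:
  "(\<And>a. a \<in> I \<Longrightarrow> differentiable_in c p (f a)) \<Longrightarrow> differentiable_in c p (\<lambda>q. \<Sum>a\<in>I. f a q)"
  by (induction I rule: infinite_finite_induct) (auto intro!: differentiable_in_const differentiable_in_add)

lemma differentiable_in_diff:
  "differentiable_in c p f \<Longrightarrow> differentiable_in c p h \<Longrightarrow> differentiable_in c p (\<lambda>q. f q - h q)"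
  using differentiable_in_add[OF _ differentiable_in_mult[OF differentiable_in_const[of _ _ "-1"]], of c p f h]
  by simp

lemmas differentiable_in_intros = differentiable_in_const differentiable_in_add
  differentiable_in_mult differentiable_in_sum differentiable_in_diff

lemma pd_add:
  "differentiable_in c p f \<Longrightarrow> differentiable_in c p h \<Longrightarrow>
     pd c i (\<lambda>q. f q + h q) p = pd c i f p + pd c i h p"
  by (simp add: differentiable_in_def pd_def o_def partial_deriv_add)

lemma pd_sum:
  "(\<And>a. a \<in> I \<Longrightarrow> differentiable_in c p (f a)) \<Longrightarrow> pd c i (\<lambda>q. \<Sum>a\<in>I. f a q) p = (\<Sum>a\<in>I. pd c i (f a) p)"
  by (induction I rule: infinite_finite_induct) (simp_all add: pd_const pd_add differentiable_in_sum)

text \<open>\<open>pd\<close> sees \<open>f\<close> only through \<open>f \<circ> cinv c\<close>.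
  The conditions on the values at \<open>p\<close> reconcile this with \<open>f p\<close>; on the
  domain of a chart of the atlas, \<open>cinv_coord\<close> discharges them.\<close>

lemma pd_mult:
  "differentiable_in c p f \<Longrightarrow> differentiable_in c p h \<Longrightarrow> f (cinv c (coord c p)) = f p \<Longrightarrow>
     h (cinv c (coord c p)) = h p \<Longrightarrow>
     pd c i (\<lambda>q. f q * h q) p = f p * pd c i h p + pd c i f p * h p"
  using partial_deriv_mult[of "f \<circ> cinv c" "coord c p" "h \<circ> cinv c" i]
  by (simp add: differentiable_in_def pd_def o_def)

lemma pd_diff:
  "differentiable_in c p f \<Longrightarrow> differentiable_in c p h \<Longrightarrow> f (cinv c (coord c p)) = f p \<Longrightarrow>
     h (cinv c (coord c p)) = h p \<Longrightarrow> pd c i (\<lambda>q. f q - h q) p = pd c i f p - pd c i h p"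
  using pd_add[of c p f "\<lambda>q. (- 1) * h q" i] pd_mult[of c p "\<lambda>_. - 1" h i]
    differentiable_in_mult[OF differentiable_in_const, of c p h "- 1"]
  by (simp add: pd_const differentiable_in_const)

lemma pd_inverse:
  "differentiable_in c p f \<Longrightarrow> f (cinv c (coord c p)) = f p \<Longrightarrow> f p \<noteq> 0 \<Longrightarrow>
     pd c i (\<lambda>q. inverse (f q)) p = - (pd c i f p * (inverse (f p) * inverse (f p)))"
  using partial_deriv_inverse[of "f \<circ> cinv c" "coord c p" i]
  by (simp add: differentiable_in_def pd_def o_def)

lemma differentiable_in_inverse:
  "differentiable_in c p f \<Longrightarrow> f (cinv c (coord c p)) \<noteq> 0 \<Longrightarrow> differentiable_in c p (\<lambda>q. inverse (f q))"
  using differentiable_inverse_real[of "f \<circ> cinv c" "coord c p"]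
  by (simp add: differentiable_in_def o_def)

section \<open>Differentiation on a smooth manifold and change of chart\<close>

locale smooth_manifold =
  fixes A :: "('a::{t2_space,second_countable_topology}, 'n::finite) chart set"
  assumes atlas: "smooth_atlas A"
begin

lemma
  assumes "c \<in> A"
  shows open_cdom: "open (cdom c)" and open_image_cdom: "open (coord c ` cdom c)"
    and homeomorphism_coord: "homeomorphism (cdom c) (coord c ` cdom c) (coord c) (cinv c)"
  using atlas assms unfolding smooth_atlas_def by auto

lemma in_chart: obtains c where "c \<in> A" "p \<in> cdom c"
proof -
  have "(\<Union>c\<in>A. cdom c) = UNIV" using atlas unfolding smooth_atlas_def by blast
  then have "p \<in> (\<Union>c\<in>A. cdom c)" by blast
  then show ?thesis using that by blast
qed

lemma
  shows chart_at_in: "chart_at A p \<in> A" and in_chart_at: "p \<in> cdom (chart_at A p)"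
proof -
  have "\<exists>c. c \<in> A \<and> p \<in> cdom c" using in_chart by metis
  then have "chart_at A p \<in> A \<and> p \<in> cdom (chart_at A p)" unfolding chart_at_def by (rule someI_ex)
  then show "chart_at A p \<in> A" "p \<in> cdom (chart_at A p)" by auto
qed

lemma cinv_coord [simp]: "c \<in> A \<Longrightarrow> p \<in> cdom c \<Longrightarrow> cinv c (coord c p) = p"
  using homeomorphism_coord by (auto simp: homeomorphism_def)

lemma coord_cinv: "c \<in> A \<Longrightarrow> x \<in> coord c ` cdom c \<Longrightarrow> coord c (cinv c x) = x"
  by auto

lemma cinv_in: "c \<in> A \<Longrightarrow> x \<in> coord c ` cdom c \<Longrightarrow> cinv c x \<in> cdom c"
  by auto

lemma continuous_on_coord: "c \<in> A \<Longrightarrow> continuous_on (cdom c) (coord c)"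
  and continuous_on_cinv: "c \<in> A \<Longrightarrow> continuous_on (coord c ` cdom c) (cinv c)"
  using homeomorphism_coord by (auto simp: homeomorphism_def)

lemma open_image_coord:
  assumes "c \<in> A" "open W"
  shows "open (coord c ` (cdom c \<inter> W))"
proof -
  have "openin (top_of_set (cdom c)) (cdom c \<inter> W)"
    using assms by (simp add: openin_open_Int)
  then have "openin (top_of_set (coord c ` cdom c)) (coord c ` (cdom c \<inter> W))"
    using homeomorphism_imp_open_map[OF homeomorphism_coord] assms by blast
  then show ?thesis using open_image_cdom[OF assms(1)] openin_open_trans by blast
qed

lemma pd_eq_partial_deriv:
  "c \<in> A \<Longrightarrow> x \<in> coord c ` cdom c \<Longrightarrow> pd c i f (cinv c x) = partial_deriv i (f \<circ> cinv c) x"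
  by (simp add: pd_def coord_cinv)

lemma
  assumes "c \<in> A" "open W" "p \<in> W" "p \<in> cdom c" "\<And>q. q \<in> W \<Longrightarrow> q \<in> cdom c \<Longrightarrow> f q = h q"
  shows pd_cong_open: "pd c i f p = pd c i h p"
    and differentiable_in_cong_open: "differentiable_in c p f \<longleftrightarrow> differentiable_in c p h"
proof -
  let ?S = "coord c ` (cdom c \<inter> W)"
  have "open ?S" "coord c p \<in> ?S" using assms open_image_coord by auto
  moreover have "(f \<circ> cinv c) x = (h \<circ> cinv c) x" if "x \<in> ?S" for x
    using that assms by auto
  ultimately show "pd c i f p = pd c i h p" "differentiable_in c p f \<longleftrightarrow> differentiable_in c p h"
    unfolding pd_def differentiable_in_def
    using partial_deriv_cong[of ?S "coord c p" "f \<circ> cinv c" "h \<circ> cinv c"]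
      differentiable_cong_open[of ?S "coord c p" "f \<circ> cinv c" "h \<circ> cinv c"] by blast+
qed

lemma smooth_in_const: "c \<in> A \<Longrightarrow> open W \<Longrightarrow> smooth_in c W (\<lambda>q. a)"
  unfolding smooth_in_def o_def by (intro smooth_on_const open_image_coord)

lemma smooth_in_add:
  "c \<in> A \<Longrightarrow> open W \<Longrightarrow> smooth_in c W f \<Longrightarrow> smooth_in c W h \<Longrightarrow> smooth_in c W (\<lambda>q. f q + h q)"
  unfolding smooth_in_def o_def by (intro smooth_on_add open_image_coord)

lemma smooth_in_mult:
  "c \<in> A \<Longrightarrow> open W \<Longrightarrow> smooth_in c W f \<Longrightarrow> smooth_in c W h \<Longrightarrow> smooth_in c W (\<lambda>q. f q * h q)"
  unfolding smooth_in_def o_def by (intro smooth_on_mult open_image_coord)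

lemma smooth_in_sum:
  "c \<in> A \<Longrightarrow> open W \<Longrightarrow> (\<And>a. a \<in> I \<Longrightarrow> smooth_in c W (f a)) \<Longrightarrow> smooth_in c W (\<lambda>q. \<Sum>a\<in>I. f a q)"
  unfolding smooth_in_def o_def by (intro smooth_on_sum open_image_coord)

lemma smooth_in_diff:
  assumes "c \<in> A" "open W" "smooth_in c W f" "smooth_in c W h"
  shows "smooth_in c W (\<lambda>q. f q - h q)"
  using smooth_in_add[OF assms(1-3) smooth_in_mult[OF assms(1,2) smooth_in_const[OF assms(1,2), of "-1"] assms(4)]]
  by simp

lemma smooth_in_divide_const:
  assumes "c \<in> A" "open W" "smooth_in c W f"
  shows "smooth_in c W (\<lambda>q. f q / a)"
  using smooth_in_mult[OF assms(1-3) smooth_in_const[OF assms(1,2), of "inverse a"]]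
  by (simp add: divide_inverse)

lemmas smooth_in_intros = smooth_in_const smooth_in_add smooth_in_mult smooth_in_sum smooth_in_diff
  smooth_in_divide_const

lemma smooth_in_pd:
  assumes "c \<in> A" "open W" "smooth_in c W f"
  shows "smooth_in c W (pd c i f)"
proof -
  have "smooth_on (coord c ` (cdom c \<inter> W)) (partial_deriv i (f \<circ> cinv c))"
    using assms unfolding smooth_in_def by (intro smooth_on_partial_deriv)
  then show ?thesis unfolding smooth_in_def
    by (rule smooth_on_cong[THEN iffD1, rotated 2])
      (use assms open_image_coord in \<open>auto simp: pd_def\<close>)
qed

lemma smooth_in_differentiable:
  assumes "c \<in> A" "open W" "smooth_in c W f" "p \<in> cdom c" "p \<in> W"
  shows "differentiable_in c p f"
  unfolding differentiable_in_def
  by (rule smooth_on_differentiable[OF open_image_coord[OF assms(1,2)]])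
    (use assms in \<open>auto simp: smooth_in_def\<close>)

lemma continuous_on_if_cinv:
  assumes "c \<in> A" "continuous_on (coord c ` (cdom c \<inter> W)) (f \<circ> cinv c)"
  shows "continuous_on (cdom c \<inter> W) f"
proof -
  have "continuous_on (cdom c \<inter> W) (\<lambda>q. (f \<circ> cinv c) (coord c q))"
    using assms continuous_on_coord[OF assms(1)]
    by (intro continuous_on_compose2[OF assms(2)]) (auto elim: continuous_on_subset)
  then show ?thesis
    by (rule continuous_on_cong[THEN iffD1, rotated 2]) (use assms in auto)
qed

lemma smooth_in_continuous_on:
  "c \<in> A \<Longrightarrow> smooth_in c W f \<Longrightarrow> continuous_on (cdom c \<inter> W) f"
  by (intro continuous_on_if_cinv) (auto simp: smooth_in_def dest: smooth_on_continuous)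

lemma pd_commute:
  assumes "c \<in> A" "open W" "smooth_in c W f" "p \<in> cdom c" "p \<in> W"
  shows "pd c i (pd c j f) p = pd c j (pd c i f) p"
proof -
  let ?S = "coord c ` (cdom c \<inter> W)"
  have S: "open ?S" "coord c p \<in> ?S" using assms open_image_coord by auto
  have "pd c i (pd c j f) p = partial_deriv i (partial_deriv j (f \<circ> cinv c)) (coord c p)" for i j
    unfolding pd_def[of c i "pd c j f"]
    by (rule partial_deriv_cong[OF S]) (use assms in \<open>auto simp: pd_def\<close>)
  then show ?thesis
    using partial_deriv_commute[OF S] assms(3) by (simp add: smooth_in_def smooth_on_def)
qed

lemma smooth_in_coord: "c \<in> A \<Longrightarrow> d \<in> A \<Longrightarrow> smooth_in c (cdom d) (\<lambda>q. coord d q $ k)"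
  using atlas unfolding smooth_atlas_def by blast

lemma smooth_in_jacobian: "c \<in> A \<Longrightarrow> d \<in> A \<Longrightarrow> smooth_in c (cdom d) (\<lambda>q. jacobian c d q $ k $ i)"
  by (simp add: jacobian_def smooth_in_pd open_cdom smooth_in_coord)

lemma has_derivative_transition:
  assumes "c \<in> A" "d \<in> A" "p \<in> cdom c" "p \<in> cdom d"
  shows "(coord d \<circ> cinv c has_derivative (*v) (jacobian c d p)) (at (coord c p))"
proof -
  have k: "((\<lambda>x. (coord d \<circ> cinv c) x $ k) has_derivative (\<lambda>v. (jacobian c d p *v v) $ k)) (at (coord c p))" for k
  proof -
    have "differentiable_in c p (\<lambda>q. coord d q $ k)"
      using assms smooth_in_coord open_cdom by (intro smooth_in_differentiable)
    then show ?thesis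
      using has_derivative_partial_deriv[of "(\<lambda>q. coord d q $ k) \<circ> cinv c" "coord c p"]
      by (simp add: differentiable_in_def jacobian_def matrix_vector_mult_def o_def pd_def mult.commute)
  qed
  then show ?thesis
    by (subst has_derivative_componentwise_within)
      (auto simp: Basis_vec_def inner_axis)
qed

lemma
  assumes "c \<in> A" "d \<in> A" "p \<in> cdom c" "p \<in> cdom d" "differentiable_in d p f"
  shows differentiable_in_change: "differentiable_in c p f"
    and pd_change: "pd c i f p = (\<Sum>k\<in>UNIV. jacobian c d p $ k $ i * pd d k f p)"
proof -
  let ?D = "\<lambda>v. \<Sum>k\<in>UNIV. v $ k * partial_deriv k (f \<circ> cinv d) (coord d p)"
  have "(f \<circ> cinv d has_derivative ?D) (at ((coord d \<circ> cinv c) (coord c p)))"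
    using assms has_derivative_partial_deriv[of "f \<circ> cinv d" "coord d p"]
    by (simp add: differentiable_in_def)
  with has_derivative_transition[OF assms(1-4)]
  have "((f \<circ> cinv d) \<circ> (coord d \<circ> cinv c) has_derivative ?D \<circ> (*v) (jacobian c d p)) (at (coord c p))"
    by (rule diff_chain_at)
  \<comment> \<open>The factorization through the transition map holds only on the image of the
    overlap, which is open; derivatives do not notice the rest.\<close>
  moreover have "((f \<circ> cinv d) \<circ> (coord d \<circ> cinv c)) x = (f \<circ> cinv c) x"
    if "x \<in> coord c ` (cdom c \<inter> cdom d)" for x using that assms by auto
  ultimately have D: "(f \<circ> cinv c has_derivative ?D \<circ> (*v) (jacobian c d p)) (at (coord c p))"
    using has_derivative_cong_open[OF open_image_coord[OF assms(1) open_cdom[OF assms(2)]]] assms(3,4)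
    by (metis (no_types, lifting) IntI imageI)
  show "differentiable_in c p f" using D by (auto simp: differentiable_in_def differentiable_def)
  show "pd c i f p = (\<Sum>k\<in>UNIV. jacobian c d p $ k $ i * pd d k f p)"
    using partial_deriv_eq[OF D, of i]
    by (simp add: pd_def matrix_vector_mult_basis column_def)
qed

lemma pd_coord:
  assumes "c \<in> A" "p \<in> cdom c"
  shows "pd c i (\<lambda>q. coord c q $ k) p = (if k = i then 1 else 0)"
proof -
  have "partial_deriv i ((\<lambda>q. coord c q $ k) \<circ> cinv c) (coord c p) = partial_deriv i (\<lambda>x. x $ k) (coord c p)"
    using assms open_image_cdom by (intro partial_deriv_cong[of "coord c ` cdom c"]) auto
  also have "\<dots> = (if k = i then 1 else 0)"
    by (subst partial_deriv_eq[OF bounded_linear.has_derivative[OF bounded_linear_vec_nth has_derivative_ident]])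
      (simp add: axis_def)
  finally show ?thesis by (simp add: pd_def)
qed

text \<open>The chain rule applied to the coordinate functions of \<open>c\<close>, whose
  derivatives in \<open>c\<close> itself form the identity matrix.\<close>

lemma jacobian_inverse:
  assumes "c \<in> A" "d \<in> A" "p \<in> cdom c" "p \<in> cdom d"
  shows "jacobian d c p ** jacobian c d p = mat 1"
proof -
  have "pd c i (\<lambda>q. coord c q $ k) p = (\<Sum>l\<in>UNIV. jacobian c d p $ l $ i * pd d l (\<lambda>q. coord c q $ k) p)" for i k
    using assms smooth_in_coord open_cdom by (intro pd_change smooth_in_differentiable[where W = "cdom c"])
  then show ?thesis using assms
    by (simp add: pd_coord matrix_matrix_mult_def mat_def vec_eq_iff jacobian_def mult.commute)
qed


lemma differentiable_in_isCont:
  assumes "c \<in> A" "p \<in> cdom c" "differentiable_in c p f"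
  shows "isCont f p"
proof -
  have o: "open (cdom c)" using assms open_cdom by auto
  have "isCont (coord c) p"
    using assms continuous_on_coord continuous_on_eq_continuous_at[OF o] by blast
  moreover have "isCont (f \<circ> cinv c) (coord c p)"
    using assms(3) by (simp add: differentiable_in_def differentiable_imp_continuous_within)
  ultimately have "isCont (\<lambda>q. (f \<circ> cinv c) (coord c q)) p" by (rule isCont_o2)
  moreover have "\<forall>\<^sub>F q in nhds p. (f \<circ> cinv c) (coord c q) = f q"
    using eventually_nhds_in_open[OF o assms(2)] by eventually_elim (use assms in auto)
  ultimately show ?thesis using isCont_cong by fast
qed

lemma C1_atE:
  assumes "C1_at c p f" "c \<in> A"
  obtains W where "open W" "p \<in> W" "W \<subseteq> cdom c" "\<And>q. q \<in> W \<Longrightarrow> differentiable_in c q f"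
    "\<And>i. continuous_on W (pd c i f)" "continuous_on W f"
proof -
  obtain W where W: "open W" "p \<in> W" "W \<subseteq> cdom c" "\<And>q. q \<in> W \<Longrightarrow> differentiable_in c q f"
    "\<And>i. continuous_on W (pd c i f)"
    using assms(1) unfolding C1_at_def by blast
  moreover have "continuous_on W f"
    using W assms(2) differentiable_in_isCont by (intro continuous_at_imp_continuous_on) blast
  ultimately show ?thesis using that by blast
qed

lemma C1_at_differentiable: "C1_at c p f \<Longrightarrow> differentiable_in c p f"
  by (auto simp: C1_at_def)

lemma C1_at_isCont: "c \<in> A \<Longrightarrow> C1_at c p f \<Longrightarrow> isCont f p"
  by (erule C1_atE) (auto simp: continuous_on_eq_continuous_at)

lemma C1_at_isCont_pd: "c \<in> A \<Longrightarrow> C1_at c p f \<Longrightarrow> isCont (pd c i f) p"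
  by (erule C1_atE) (auto simp: continuous_on_eq_continuous_at)

lemma smooth_in_C1_at:
  assumes "c \<in> A" "open W" "smooth_in c W f" "p \<in> cdom c" "p \<in> W"
  shows "C1_at c p f"
  unfolding C1_at_def using assms open_cdom[OF assms(1)] smooth_in_pd[OF assms(1-3)]
  by (intro exI[of _ "cdom c \<inter> W"])
    (auto intro: smooth_in_differentiable smooth_in_continuous_on)

lemma C1_at_cong:
  assumes "c \<in> A" "open V" "p \<in> V" "\<And>q. q \<in> V \<Longrightarrow> f q = h q" "C1_at c p f"
  shows "C1_at c p h"
proof -
  obtain W where W: "open W" "p \<in> W" "W \<subseteq> cdom c" "\<And>q. q \<in> W \<Longrightarrow> differentiable_in c q f"
    "\<And>i. continuous_on W (pd c i f)"
    using assms(5) unfolding C1_at_def by blast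
  have "pd c i f q = pd c i h q" if "q \<in> W \<inter> V" for q i
    by (rule pd_cong_open[where W = V]) (use that W(3) assms in auto)
  moreover have D: "differentiable_in c q f \<longleftrightarrow> differentiable_in c q h" if "q \<in> W \<inter> V" for q
    by (rule differentiable_in_cong_open[where W = V]) (use that W(3) assms in auto)
  moreover have "continuous_on (W \<inter> V) (pd c i f)" for i
    using W(5)[of i] by (rule continuous_on_subset) auto
  ultimately have "continuous_on (W \<inter> V) (pd c i h)" for i
    using continuous_on_cong[of "W \<inter> V" "W \<inter> V" "pd c i f" "pd c i h"] by blast
  with W assms D show ?thesis
    unfolding C1_at_def by (intro exI[of _ "W \<inter> V"]) auto
qed

lemma C1_at_const: "c \<in> A \<Longrightarrow> p \<in> cdom c \<Longrightarrow> C1_at c p (\<lambda>q. a)"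
  by (rule smooth_in_C1_at[of _ UNIV]) (auto intro: smooth_in_const)

text \<open>The common pattern for sums and products: \<open>k'\<close> is the explicit formula for
  the derivative, valid on the intersection of the two neighbourhoods.\<close>

lemma C1_at_combine:
  assumes "c \<in> A" "C1_at c p f" "C1_at c p h"
    and "\<And>q. q \<in> cdom c \<Longrightarrow> differentiable_in c q f \<Longrightarrow> differentiable_in c q h \<Longrightarrow> differentiable_in c q k"
    and "\<And>q i. q \<in> cdom c \<Longrightarrow> differentiable_in c q f \<Longrightarrow> differentiable_in c q h \<Longrightarrow> pd c i k q = k' i q"
    and "\<And>W i. continuous_on W f \<Longrightarrow> continuous_on W h \<Longrightarrow> continuous_on W (pd c i f) \<Longrightarrow>
      continuous_on W (pd c i h) \<Longrightarrow> continuous_on W (k' i)"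
  shows "C1_at c p k"
proof -
  obtain W where W: "open W" "p \<in> W" "W \<subseteq> cdom c" "\<And>q. q \<in> W \<Longrightarrow> differentiable_in c q f"
    "\<And>i. continuous_on W (pd c i f)" "continuous_on W f" using assms(1,2) C1_atE by metis
  obtain V where V: "open V" "p \<in> V" "V \<subseteq> cdom c" "\<And>q. q \<in> V \<Longrightarrow> differentiable_in c q h"
    "\<And>i. continuous_on V (pd c i h)" "continuous_on V h" using assms(1,3) C1_atE by metis
  have "continuous_on (W \<inter> V) (k' i)" for i
    using W V by (intro assms(6); blast intro: continuous_on_subset)
  then have "continuous_on (W \<inter> V) (pd c i k)" for i
    by (rule continuous_on_cong[THEN iffD1, rotated 2]) (use W V assms(5) in auto)
  moreover have "differentiable_in c q k" if "q \<in> W \<inter> V" for q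
    using that W V by (intro assms(4)) auto
  ultimately show ?thesis
    unfolding C1_at_def using W V by (intro exI[of _ "W \<inter> V"]) auto
qed

lemma C1_at_add:
  assumes "c \<in> A" "C1_at c p f" "C1_at c p h"
  shows "C1_at c p (\<lambda>q. f q + h q)"
  by (rule C1_at_combine[OF assms, where k' = "\<lambda>i q. pd c i f q + pd c i h q"])
    (auto intro: differentiable_in_add pd_add continuous_on_add)

lemma C1_at_mult:
  assumes "c \<in> A" "C1_at c p f" "C1_at c p h"
  shows "C1_at c p (\<lambda>q. f q * h q)"
  using assms(1) by (intro C1_at_combine[OF assms, where k' = "\<lambda>i q. f q * pd c i h q + pd c i f q * h q"])
    (auto intro!: differentiable_in_mult pd_mult continuous_intros)

lemma C1_at_sum:
  assumes "c \<in> A" "p \<in> cdom c" "\<And>a. a \<in> I \<Longrightarrow> C1_at c p (f a)"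
  shows "C1_at c p (\<lambda>q. \<Sum>a\<in>I. f a q)"
  using assms(3)
  by (induction I rule: infinite_finite_induct) (auto intro!: C1_at_const C1_at_add assms(1,2))

lemma C1_at_inverse:
  assumes "c \<in> A" "C1_at c p f" "f p \<noteq> 0"
  shows "C1_at c p (\<lambda>q. inverse (f q))"
proof -
  obtain W where W: "open W" "p \<in> W" "W \<subseteq> cdom c" "\<And>q. q \<in> W \<Longrightarrow> differentiable_in c q f"
    "\<And>i. continuous_on W (pd c i f)" "continuous_on W f" using assms(1,2) C1_atE by metis
  \<comment> \<open>Continuity of \<open>f\<close> makes this smaller neighbourhood, where the
    reciprocal is harmless, open.\<close>
  define V where "V = {q \<in> W. f q \<noteq> 0}"
  have V: "open V" "p \<in> V" "V \<subseteq> W"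
    using W assms(3) continuous_on_open_vimage[OF W(1), of f] open_Compl[OF closed_singleton[of "0::real"]]
    by (auto simp: V_def vimage_def Int_def Compl_eq conj_commute)
  have "continuous_on V (\<lambda>q. - (pd c i f q * (inverse (f q) * inverse (f q))))" for i
    using W(5)[of i] W(6) V(3)
    by (intro continuous_intros) (auto elim: continuous_on_subset simp: V_def)
  then have "continuous_on V (pd c i (\<lambda>q. inverse (f q)))" for i
    by (rule continuous_on_cong[THEN iffD1, rotated 2])
      (use V W assms(1) in \<open>auto simp: V_def subset_iff intro!: pd_inverse[symmetric]\<close>)
  moreover have "differentiable_in c q (\<lambda>q. inverse (f q))" if "q \<in> V" for q
    using that W assms(1) by (intro differentiable_in_inverse) (auto simp: V_def subset_iff)
  ultimately show ?thesis
    unfolding C1_at_def using W V by (intro exI[of _ V]) auto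
qed

lemma C1_at_change:
  assumes "c \<in> A" "d \<in> A" "p \<in> cdom c" "C1_at d p f"
  shows "C1_at c p f"
proof -
  obtain W where W: "open W" "p \<in> W" "W \<subseteq> cdom d" "\<And>q. q \<in> W \<Longrightarrow> differentiable_in d q f"
    "\<And>i. continuous_on W (pd d i f)" using assms(2,4) C1_atE by metis
  let ?V = "W \<inter> cdom c"
  have "continuous_on ?V (\<lambda>q. \<Sum>k\<in>UNIV. jacobian c d q $ k $ i * pd d k f q)" for i
  proof (intro continuous_on_sum continuous_on_mult)
    show "continuous_on ?V (pd d k f)" for k
      using W(5) by (rule continuous_on_subset) auto
    show "continuous_on ?V (\<lambda>q. jacobian c d q $ k $ i)" for k
      using smooth_in_continuous_on[OF assms(1) smooth_in_jacobian[OF assms(1,2)]]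
      by (rule continuous_on_subset) (use W(3) in auto)
  qed
  then have "continuous_on ?V (pd c i f)" for i
    by (rule continuous_on_cong[THEN iffD1, rotated 2])
      (use W assms in \<open>auto simp: subset_iff intro!: pd_change[symmetric]\<close>)
  moreover have "differentiable_in c q f" if "q \<in> ?V" for q
    using that W assms by (intro differentiable_in_change[OF assms(1,2)]) auto
  ultimately show ?thesis
    unfolding C1_at_def using W open_cdom[OF assms(1)] assms(3) by (intro exI[of _ ?V]) auto
qed

section \<open>Bump functions and partitions of unity\<close>

definition C1_fun :: "('a \<Rightarrow> real) \<Rightarrow> bool" where
  "C1_fun f \<longleftrightarrow> (\<forall>c\<in>A. \<forall>p\<in>cdom c. C1_at c p f)"

text \<open>In coordinates the bump is \<open>(max 0 (r^2 - |x - x0|^2))^2\<close>, supported in a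
  closed ball inside the image of the chart, and it is continued by zero.\<close>

lemma exists_bump:
  obtains c \<psi> K where "c \<in> A" "C1_fun \<psi>" "\<psi> p > 0" "\<And>q. \<psi> q \<ge> 0" "compact K" "K \<subseteq> cdom c"
    "\<And>q. q \<notin> K \<Longrightarrow> \<psi> q = 0"
proof -
  obtain c where c: "c \<in> A" "p \<in> cdom c" using in_chart .
  define x0 where "x0 = coord c p"
  have "x0 \<in> coord c ` cdom c" using c by (simp add: x0_def)
  then obtain r where r: "r > 0" "cball x0 r \<subseteq> coord c ` cdom c"
    using open_image_cdom[OF c(1)] open_contains_cball by blast
  define s where "s x = r\<^sup>2 - (x - x0) \<bullet> (x - x0)" for x
  define \<phi> where "\<phi> x = (max 0 (s x))\<^sup>2" for x
  have D\<phi>: "(\<phi> has_derivative (\<lambda>v. 2 * max 0 (s x) * (- 2 * ((x - x0) \<bullet> v)))) (at x)" for x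
  proof -
    have "(s has_derivative (\<lambda>v. - 2 * ((x - x0) \<bullet> v))) (at x)"
      unfolding s_def by (auto intro!: derivative_eq_intros simp: inner_commute)
    then have "((\<lambda>t. (max 0 t)\<^sup>2) \<circ> s has_derivative ((*) (2 * max 0 (s x))) \<circ> (\<lambda>v. - 2 * ((x - x0) \<bullet> v))) (at x)"
      by (rule diff_chain_at)
        (rule has_real_derivative_max_0_squared[of "s x", unfolded has_field_derivative_def])
    then show ?thesis by (simp add: o_def \<phi>_def[abs_def])
  qed
  have D2: "partial_deriv i \<phi> = (\<lambda>x. 2 * max 0 (s x) * (- 2 * (x - x0) $ i))" for i
    by (intro ext) (simp add: partial_deriv_eq[OF D\<phi>] inner_axis)
  define K where "K = cinv c ` cball x0 r"
  have K: "compact K" "K \<subseteq> cdom c"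
    unfolding K_def using c(1) r continuous_on_subset[OF continuous_on_cinv]
    by (auto intro!: compact_continuous_image)
  define \<psi> where "\<psi> q = (if q \<in> cdom c then \<phi> (coord c q) else 0)" for q
  have zero: "\<psi> q = 0" if "q \<notin> K" for q
  proof (cases "q \<in> cdom c")
    case True
    then have "coord c q \<notin> cball x0 r" using that c(1) by (force simp: K_def image_iff)
    then have "r < norm (coord c q - x0)" by (simp add: dist_norm norm_minus_commute)
    then have "r\<^sup>2 < (norm (coord c q - x0))\<^sup>2" using r(1) by (intro power_strict_mono) auto
    then show ?thesis by (simp add: \<psi>_def \<phi>_def s_def power2_norm_eq_inner)
  qed (simp add: \<psi>_def)
  have C1: "C1_at c q \<psi>" if "q \<in> cdom c" for q
  proof -
    have eq: "(\<psi> \<circ> cinv c) x = \<phi> x" if "x \<in> coord c ` cdom c" for x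
      using that c(1) by (auto simp: \<psi>_def)
    have "differentiable_in c q' \<psi>" "pd c i \<psi> q' = partial_deriv i \<phi> (coord c q')" if "q' \<in> cdom c" for q' i
      using that differentiable_cong_open[where f = "\<psi> \<circ> cinv c" and h = \<phi>, OF open_image_cdom[OF c(1)] _ eq]
        partial_deriv_cong[where f = "\<psi> \<circ> cinv c" and h = \<phi>, OF open_image_cdom[OF c(1)] _ eq]
        differentiableI[OF D\<phi>]
      by (simp_all add: differentiable_in_def pd_def)
    moreover have "continuous_on (cdom c) (\<lambda>q. partial_deriv i \<phi> (coord c q))" for i
      unfolding D2 s_def by (intro continuous_intros continuous_on_coord c)
    ultimately have "continuous_on (cdom c) (pd c i \<psi>)" for i
      using continuous_on_cong[of "cdom c" "cdom c" "pd c i \<psi>" "\<lambda>q. partial_deriv i \<phi> (coord c q)"] by blast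
    then show ?thesis
      unfolding C1_at_def using that open_cdom[OF c(1)] \<open>\<And>q'. q' \<in> cdom c \<Longrightarrow> differentiable_in c q' \<psi>\<close>
      by (intro exI[of _ "cdom c"]) auto
  qed
  have "C1_fun \<psi>"
    unfolding C1_fun_def
  proof safe
    fix d q assume d: "d \<in> A" "q \<in> cdom d"
    show "C1_at d q \<psi>"
    proof (cases "q \<in> cdom c")
      case True
      with d c C1 show ?thesis by (intro C1_at_change[of d c]) auto
    next
      case False
      \<comment> \<open>The Hausdorff property makes the compact set \<open>K\<close> closed, so the
        bump vanishes near every point outside the chart.\<close>
      have "open (- K)" "q \<in> - K" using K False by (auto simp: compact_imp_closed open_Compl)
      then show ?thesis
        by (rule C1_at_cong[OF d(1), where f = "\<lambda>_. 0"]) (simp_all add: zero C1_at_const d)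
    qed
  qed
  moreover have "\<psi> p > 0" using c r(1) by (simp add: \<psi>_def \<phi>_def s_def x0_def)
  moreover have "\<psi> q \<ge> 0" for q by (simp add: \<psi>_def \<phi>_def)
  ultimately show ?thesis using that[of c \<psi> K] c K zero by blast
qed

text \<open>The sum is 1 on a neighbourhood \<open>W\<close> of \<open>K\<close> and not just on
  \<open>K\<close>, because it will be differentiated at points of \<open>K\<close>.\<close>

lemma partition_of_unity:
  assumes "compact K"
  obtains I :: "'a set" and c \<eta> L W where "finite I" "open W" "K \<subseteq> W"
    "\<And>a. a \<in> I \<Longrightarrow> c a \<in> A" "\<And>a. a \<in> I \<Longrightarrow> compact (L a)" "\<And>a. a \<in> I \<Longrightarrow> L a \<subseteq> cdom (c a)"
    "\<And>a q. a \<in> I \<Longrightarrow> q \<notin> L a \<Longrightarrow> \<eta> a q = 0"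
    "\<And>a d q. a \<in> I \<Longrightarrow> d \<in> A \<Longrightarrow> q \<in> cdom d \<Longrightarrow> q \<in> W \<Longrightarrow> C1_at d q (\<eta> a)"
    "\<And>q. q \<in> W \<Longrightarrow> (\<Sum>a\<in>I. \<eta> a q) = 1"
proof -
  have "\<exists>c \<psi> L. c \<in> A \<and> C1_fun \<psi> \<and> \<psi> p > 0 \<and> (\<forall>q. \<psi> q \<ge> 0) \<and> compact L \<and> L \<subseteq> cdom c \<and>
    (\<forall>q. q \<notin> L \<longrightarrow> \<psi> q = 0)" for p
    by (rule exists_bump[of p]) blast
  then obtain c \<psi> L where b: "\<And>p. c p \<in> A" "\<And>p. C1_fun (\<psi> p)" "\<And>p. \<psi> p p > 0" "\<And>p q. \<psi> p q \<ge> 0"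
    "\<And>p. compact (L p)" "\<And>p. L p \<subseteq> cdom (c p)" "\<And>p q. q \<notin> L p \<Longrightarrow> \<psi> p q = 0"
    by metis
  have cont: "continuous_on UNIV (\<psi> p)" for p
    using b(2)[of p] in_chart C1_at_isCont
    by (metis C1_fun_def continuous_at_imp_continuous_on)
  have op: "open {q. \<psi> p q > 0}" for p
    using cont[of p] by (intro open_Collect_less) auto
  have "K \<subseteq> (\<Union>p\<in>K. {q. \<psi> p q > 0})" using b(3) by auto
  then obtain I where I: "I \<subseteq> K" "finite I" "K \<subseteq> (\<Union>p\<in>I. {q. \<psi> p q > 0})"
    using compactE_image[OF assms, of K "\<lambda>p. {q. \<psi> p q > 0}"] op by metis
  define \<Psi> where "\<Psi> q = (\<Sum>p\<in>I. \<psi> p q)" for q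
  define W where "W = (\<Union>p\<in>I. {q. \<psi> p q > 0})"
  have \<Psi>: "\<Psi> q > 0" if q: "q \<in> W" for q
  proof -
    obtain p where "p \<in> I" "\<psi> p q > 0" using q by (auto simp: W_def)
    then show ?thesis unfolding \<Psi>_def using I(2) b(4) by (intro sum_pos2[of I p]) auto
  qed
  \<comment> \<open>On \<open>W\<close> the denominator is positive. Outside \<open>W\<close> every
    bump of the finite family vanishes, and so does \<open>\<eta> a\<close> for
    \<open>a \<in> I\<close>, whatever its denominator.\<close>
  define \<eta> where "\<eta> a q = \<psi> a q * inverse (\<Psi> q)" for a q
  show ?thesis
  proof (rule that[of I W c L \<eta>])
    show "open W" using op by (auto simp: W_def)
    show "C1_at d q (\<eta> a)" if "d \<in> A" "q \<in> cdom d" "q \<in> W" for a d q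
      unfolding \<eta>_def using that b(2) \<Psi>[OF that(3)]
      by (intro C1_at_mult C1_at_inverse) (auto simp: \<Psi>_def C1_fun_def intro!: C1_at_sum)
    show "(\<Sum>a\<in>I. \<eta> a q) = 1" if "q \<in> W" for q
      using \<Psi>[OF that] by (simp add: \<eta>_def sum_distrib_right[symmetric] \<Psi>_def)
  qed (use I b in \<open>auto simp: W_def \<eta>_def\<close>)
qed

end


section \<open>Covariant derivatives\<close>

locale riemannian = smooth_manifold A
  for A :: "('a::{t2_space,second_countable_topology}, 'n::finite) chart set" +
  fixes g :: "('a, 'n) metric"
  assumes metric: "riemannian_metric A g"
begin

lemma manifold: "riemannian_manifold A g"
  using atlas metric by (simp add: riemannian_manifold_def)

lemma smooth_in_metric: "c \<in> A \<Longrightarrow> smooth_in c UNIV (\<lambda>q. g c q $ i $ j)"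
  using metric unfolding riemannian_metric_def by blast

lemma metric_pos: "c \<in> A \<Longrightarrow> p \<in> cdom c \<Longrightarrow> v \<noteq> 0 \<Longrightarrow> 0 < v \<bullet> (g c p *v v)"
  using metric unfolding riemannian_metric_def by blast

lemma transpose_metric: "c \<in> A \<Longrightarrow> p \<in> cdom c \<Longrightarrow> transpose (g c p) = g c p"
  using metric unfolding riemannian_metric_def by blast

lemma metric_change:
  "c \<in> A \<Longrightarrow> d \<in> A \<Longrightarrow> p \<in> cdom c \<Longrightarrow> p \<in> cdom d \<Longrightarrow>
     g c p = transpose (jacobian c d p) ** g d p ** jacobian c d p"
  using metric unfolding riemannian_metric_def by blast

lemma invertible_metric: "c \<in> A \<Longrightarrow> p \<in> cdom c \<Longrightarrow> invertible (g c p)"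
  using riemannian_metric_invertible[OF metric] .

lemma smooth_in_metric_inv: "c \<in> A \<Longrightarrow> smooth_in c UNIV (\<lambda>q. matrix_inv (g c q) $ i $ j)"
  unfolding smooth_in_def o_def
  by (rule smooth_on_matrix_inv)
    (use smooth_in_metric open_image_cdom invertible_metric in \<open>auto simp: smooth_in_def o_def\<close>)

lemma smooth_in_christoffel: "c \<in> A \<Longrightarrow> smooth_in c UNIV (\<lambda>q. christoffel g c q i j k)"
  unfolding christoffel_def
  by (intro smooth_in_intros smooth_in_pd smooth_in_metric smooth_in_metric_inv open_UNIV) auto

lemma christoffel_sym: "c \<in> A \<Longrightarrow> p \<in> cdom c \<Longrightarrow> christoffel g c p i j k = christoffel g c p j i k"
  using christoffel_torsion_free[OF manifold] .

text \<open>The connection matrix \<open>\<Gamma>_i\<close>: covariant differentiation becomes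
  \<open>\<partial>_i + \<Gamma>_i\<close>, and compatibility with the metric is an identity of
  matrices.\<close>

definition conn :: "('a, 'n) chart \<Rightarrow> 'n \<Rightarrow> 'a \<Rightarrow> real^'n^'n" where
  "conn c i p = (\<chi> k j. christoffel g c p i j k)"

definition pd_matrix :: "('a, 'n) chart \<Rightarrow> 'n \<Rightarrow> ('a \<Rightarrow> real^'n^'n) \<Rightarrow> 'a \<Rightarrow> real^'n^'n" where
  "pd_matrix c i F p = (\<chi> k j. pd c i (\<lambda>q. F q $ k $ j) p)"

definition pd_vec :: "('a, 'n) chart \<Rightarrow> 'n \<Rightarrow> ('a \<Rightarrow> real^'n) \<Rightarrow> 'a \<Rightarrow> real^'n" where
  "pd_vec c i Y p = (\<chi> k. pd c i (\<lambda>q. Y q $ k) p)"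

lemma cov_deriv_eq: "cov_deriv g c i Y p = pd_vec c i Y p + conn c i p *v Y p"
  by (simp add: cov_deriv_def pd_vec_def conn_def matrix_vector_mult_def vec_eq_iff)

lemma pd_matrix_mult:
  assumes "c \<in> A" "p \<in> cdom c" "\<And>k j. differentiable_in c p (\<lambda>q. F q $ k $ j)"
    "\<And>k j. differentiable_in c p (\<lambda>q. H q $ k $ j)"
  shows "pd_matrix c i (\<lambda>q. F q ** H q) p = F p ** pd_matrix c i H p + pd_matrix c i F p ** H p"
    and "differentiable_in c p (\<lambda>q. (F q ** H q) $ k $ j)"
  using assms
  by (simp_all add: pd_matrix_def matrix_matrix_mult_def vec_eq_iff pd_sum pd_mult
      differentiable_in_intros sum.distrib)

lemma pd_matrix_transpose: "pd_matrix c i (\<lambda>q. transpose (F q)) p = transpose (pd_matrix c i F p)"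
  by (simp add: pd_matrix_def transpose_def)

lemma pd_vec_mult:
  assumes "c \<in> A" "p \<in> cdom c" "\<And>k j. differentiable_in c p (\<lambda>q. F q $ k $ j)"
    "\<And>j. differentiable_in c p (\<lambda>q. Y q $ j)"
  shows "pd_vec c i (\<lambda>q. F q *v Y q) p = F p *v pd_vec c i Y p + pd_matrix c i F p *v Y p"
  using assms
  by (simp add: pd_matrix_def pd_vec_def matrix_vector_mult_def vec_eq_iff pd_sum pd_mult
      differentiable_in_intros sum.distrib)

lemma pd_matrix_metric:
  assumes "c \<in> A" "p \<in> cdom c"
  shows "pd_matrix c i (g c) p = transpose (conn c i p) ** g c p + g c p ** conn c i p"
  by (simp add: pd_matrix_def conn_def matrix_matrix_mult_def transpose_def vec_eq_iff
      christoffel_metric[OF manifold assms] mult.commute)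

lemma differentiable_in_jacobian:
  assumes "c \<in> A" "d \<in> A" "p \<in> cdom c" "p \<in> cdom d"
  shows "differentiable_in c p (\<lambda>q. jacobian c d q $ k $ j)"
  using smooth_in_differentiable[OF assms(1) open_cdom[OF assms(2)] smooth_in_jacobian[OF assms(1,2)]]
    assms by blast

lemma differentiable_in_metric:
  "c \<in> A \<Longrightarrow> p \<in> cdom c \<Longrightarrow> differentiable_in c p (\<lambda>q. g c q $ i $ j)"
  by (rule smooth_in_differentiable[OF _ _ smooth_in_metric]) auto

text \<open>The connection in \<open>c\<close> that one obtains by transforming the Levi-Civita connection of \<open>d\<close> is
  torsion-free and compatible with the metric, so it is the Levi-Civita connection of \<open>c\<close>.\<close>

lemma conn_change:
  assumes c: "c \<in> A" "p \<in> cdom c" and d: "d \<in> A" "p \<in> cdom d"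
  shows "jacobian c d p ** conn c i p =
    pd_matrix c i (jacobian c d) p + (\<Sum>r\<in>UNIV. jacobian c d p $ r $ i *\<^sub>R conn d r p) ** jacobian c d p"
proof -
  let ?J = "jacobian c d p" and ?K = "jacobian d c p" and ?h = "g d p"
  \<comment> \<open>\<open>N i\<close> is the connection of \<open>d\<close> in the direction of the
    \<open>i\<close>-th coordinate vector of \<open>c\<close>. Adding the derivative of the
    Jacobian, \<open>T i\<close> is the expected connection of \<open>c\<close> multiplied by
    \<open>?J\<close> from the left.\<close>
  define N where "N i = (\<Sum>r\<in>UNIV. ?J $ r $ i *\<^sub>R conn d r p)" for i
  define T where "T i = pd_matrix c i (jacobian c d) p + N i ** ?J" for i
  have JK: "?J ** ?K = mat 1" "?K ** ?J = mat 1"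
    by (rule jacobian_inverse[OF d(1) c(1) d(2) c(2)], rule jacobian_inverse[OF c(1) d(1) c(2) d(2)])
  note dJ = differentiable_in_jacobian[OF c(1) d(1) c(2) d(2)]
  have dh: "differentiable_in c p (\<lambda>q. g d q $ k $ j)" for k j
    using c d by (intro differentiable_in_change[OF c(1) d(1)] differentiable_in_metric)
  have pdh: "pd_matrix c i (g d) p = transpose (N i) ** ?h + ?h ** N i" for i
  proof -
    have "pd_matrix c i (g d) p = (\<Sum>r\<in>UNIV. ?J $ r $ i *\<^sub>R pd_matrix d r (g d) p)"
      using c d by (simp add: pd_matrix_def vec_eq_iff pd_change[of c d] differentiable_in_metric)
    also have "\<dots> = transpose (N i) ** ?h + ?h ** N i"
      unfolding N_def pd_matrix_metric[OF d]
      by (simp add: sum_matrix_mul matrix_mul_sum transpose_sum transpose_scalar scaleR_right_distrib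
          sum.distrib scalar_matrix_assoc matrix_scalar_ac)
    finally show ?thesis .
  qed
  have met: "pd_matrix c i (g c) p = transpose (T i) ** ?h ** ?J + transpose ?J ** ?h ** T i" for i
  proof -
    have "pd_matrix c i (g c) p = pd_matrix c i (\<lambda>q. transpose (jacobian c d q) ** g d q ** jacobian c d q) p"
      unfolding pd_matrix_def vec_eq_iff vec_lambda_beta
      by (intro allI pd_cong_open[OF c(1) open_cdom[OF d(1)] d(2) c(2)])
        (simp add: metric_change[OF c(1) d(1)])
    also have "\<dots> = transpose ?J ** ?h ** pd_matrix c i (jacobian c d) p
        + (transpose ?J ** pd_matrix c i (g d) p + transpose (pd_matrix c i (jacobian c d) p) ** ?h) ** ?J"
    proof -
      have dJt: "differentiable_in c p (\<lambda>q. transpose (jacobian c d q) $ k $ j)" for k j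
        using dJ by (simp add: transpose_def)
      show ?thesis
        by (simp add: pd_matrix_mult c dJ dh dJt pd_matrix_transpose)
    qed
    also have "\<dots> = transpose (T i) ** ?h ** ?J + transpose ?J ** ?h ** T i"
      by (simp add: T_def pdh transpose_plus matrix_transpose_mul matrix_add_ldistrib matrix_add_mul_distrib matrix_mul_assoc)
    finally show ?thesis .
  qed
  have gc: "g c p = transpose ?J ** ?h ** ?J" using c d by (intro metric_change)
  have "(?K ** T i) $ k $ j = christoffel g c p i j k" for i j k
  proof (rule christoffel_unique[OF manifold c])
    \<comment> \<open>The first summand is symmetric because second derivatives of the transition
      map commute, the second because the connection of \<open>d\<close> is torsion-free.\<close>
    have "T i $ m $ j = T j $ m $ i" for i j m
    proof -
      have "pd_matrix c i (jacobian c d) p $ m $ j = pd_matrix c j (jacobian c d) p $ m $ i"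
        using pd_commute[OF c(1) open_cdom[OF d(1)] smooth_in_coord[OF c(1) d(1)] c(2) d(2)]
        by (simp add: pd_matrix_def jacobian_def)
      moreover have "(N i ** ?J) $ m $ j = (N j ** ?J) $ m $ i"
      proof -
        have "(N i ** ?J) $ m $ j = (\<Sum>s\<in>UNIV. \<Sum>r\<in>UNIV. ?J $ r $ i * christoffel g d p r s m * ?J $ s $ j)" for i j
          by (simp add: N_def matrix_matrix_mult_def conn_def sum_distrib_right)
        then show ?thesis
          using christoffel_sym[OF d] sum.swap[of "\<lambda>s r. ?J $ r $ i * christoffel g d p r s m * ?J $ s $ j" UNIV UNIV]
          by (simp add: mult_ac)
      qed
      ultimately show ?thesis by (simp add: T_def)
    qed
    then show "(?K ** T i) $ k $ j = (?K ** T j) $ k $ i" for i j k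
      by (simp add: matrix_matrix_mult_def)
    have "transpose (T i) ** ?h ** ?J = transpose (?K ** T i) ** g c p" for i
    proof -
      have "transpose (?K ** T i) ** g c p = transpose (T i) ** (transpose ?K ** transpose ?J) ** ?h ** ?J"
        by (simp add: gc matrix_transpose_mul matrix_mul_assoc)
      also have "transpose ?K ** transpose ?J = mat 1"
        by (simp add: matrix_transpose_mul[symmetric] JK)
      finally show ?thesis by simp
    qed
    moreover have "transpose ?J ** ?h ** T i = g c p ** (?K ** T i)" for i
    proof -
      have "g c p ** (?K ** T i) = transpose ?J ** ?h ** (?J ** ?K) ** T i"
        by (simp only: gc matrix_mul_assoc)
      then show ?thesis by (simp add: JK)
    qed
    ultimately have "pd_matrix c i (g c) p = transpose (?K ** T i) ** g c p + g c p ** (?K ** T i)" for i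
      by (simp only: met)
    then have comp: "pd_matrix c i (g c) p $ j $ k
        = (transpose (?K ** T i) ** g c p + g c p ** (?K ** T i)) $ j $ k" for i j k by simp
    show "pd c i (\<lambda>q. g c q $ j $ k) p = (\<Sum>l\<in>UNIV. (?K ** T i) $ l $ j * g c p $ l $ k)
        + (\<Sum>l\<in>UNIV. (?K ** T i) $ l $ k * g c p $ j $ l)" for i j k
    proof -
      have "(transpose P ** M) $ j $ k = (\<Sum>l\<in>UNIV. P $ l $ j * M $ l $ k)"
        "(M ** P) $ j $ k = (\<Sum>l\<in>UNIV. P $ l $ k * M $ j $ l)" for M P :: "real^'n^'n" and j k
        by (simp_all add: matrix_matrix_mult_def transpose_def mult.commute)
      note this(1)[of "?K ** T i" "g c p"] this(2)[of "g c p" "?K ** T i"]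
      with comp[of i j k] show ?thesis by (simp add: pd_matrix_def)
    qed
  qed
  then have "?K ** T i = conn c i p"
    by (simp add: vec_eq_iff conn_def)
  then have "?J ** conn c i p = (?J ** ?K) ** T i"
    by (metis matrix_mul_assoc)
  then show ?thesis by (simp add: JK T_def N_def)
qed

text \<open>The matrix of the endomorphism \<open>v \<mapsto> \<nabla>_v Y\<close>. The direction of
  differentiation is the column index, so the trace is the divergence.\<close>

definition cov_matrix :: "('a, 'n) chart \<Rightarrow> ('a \<Rightarrow> real^'n) \<Rightarrow> 'a \<Rightarrow> real^'n^'n" where
  "cov_matrix c Y p = (\<chi> k i. cov_deriv g c i Y p $ k)"

text \<open>The inhomogeneous term in \<open>conn_change\<close> is exactly the term that the
  product rule produces by differentiating the Jacobian in \<open>Yd = J Yc\<close>.\<close>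

lemma cov_matrix_change:
  assumes c: "c \<in> A" "p \<in> cdom c" and d: "d \<in> A" "p \<in> cdom d" and W: "open W" "p \<in> W"
    and Y: "\<And>q. q \<in> W \<Longrightarrow> q \<in> cdom c \<Longrightarrow> q \<in> cdom d \<Longrightarrow> Yd q = jacobian c d q *v Yc q"
    and dc: "\<And>k. differentiable_in c p (\<lambda>q. Yc q $ k)" and dd: "\<And>k. differentiable_in d p (\<lambda>q. Yd q $ k)"
  shows "jacobian c d p ** cov_matrix c Yc p = cov_matrix d Yd p ** jacobian c d p"
proof -
  let ?J = "jacobian c d p"
  have "?J *v cov_deriv g c i Yc p = (\<Sum>r\<in>UNIV. ?J $ r $ i *\<^sub>R cov_deriv g d r Yd p)" for i
  proof -
    have "pd_vec c i Yd p = pd_vec c i (\<lambda>q. jacobian c d q *v Yc q) p"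
      unfolding pd_vec_def vec_eq_iff vec_lambda_beta
      using c d open_cdom W Y by (intro allI pd_cong_open[of c "W \<inter> cdom d"]) auto
    also have "\<dots> = ?J *v pd_vec c i Yc p + pd_matrix c i (jacobian c d) p *v Yc p"
      using c d dc by (intro pd_vec_mult differentiable_in_jacobian)
    finally have 1: "pd_vec c i Yd p = ?J *v pd_vec c i Yc p + pd_matrix c i (jacobian c d) p *v Yc p" .
    have 2: "pd_vec c i Yd p = (\<Sum>r\<in>UNIV. ?J $ r $ i *\<^sub>R pd_vec d r Yd p)"
      using c d dd by (simp add: pd_vec_def vec_eq_iff pd_change[of c d])
    have Yp: "Yd p = ?J *v Yc p" using c d W Y by auto
    have "?J *v cov_deriv g c i Yc p = ?J *v pd_vec c i Yc p + (?J ** conn c i p) *v Yc p"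
      by (simp add: cov_deriv_eq matrix_vector_right_distrib matrix_vector_mul_assoc)
    also have "\<dots> = pd_vec c i Yd p + (\<Sum>r\<in>UNIV. ?J $ r $ i *\<^sub>R conn d r p) *v Yd p"
      by (simp add: conn_change[OF c d] 1 Yp matrix_vector_mult_add_rdistrib matrix_vector_mul_assoc)
    also have "(\<Sum>r\<in>UNIV. ?J $ r $ i *\<^sub>R conn d r p) *v Yd p = (\<Sum>r\<in>UNIV. ?J $ r $ i *\<^sub>R (conn d r p *v Yd p))"
      by (simp add: sum_matrix_vector_mul scaleR_matrix_vector_assoc)
    finally show ?thesis
      by (simp add: 2 cov_deriv_eq scaleR_right_distrib sum.distrib)
  qed
  then show ?thesis
    by (simp add: vec_eq_iff cov_matrix_def matrix_matrix_mult_def matrix_vector_mult_def mult.commute)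
qed

definition divergence_in :: "('a, 'n) chart \<Rightarrow> ('a \<Rightarrow> real^'n) \<Rightarrow> 'a \<Rightarrow> real" where
  "divergence_in c Y p = trace (cov_matrix c Y p)"

lemma divergence_in_change:
  assumes c: "c \<in> A" "p \<in> cdom c" and d: "d \<in> A" "p \<in> cdom d" and W: "open W" "p \<in> W"
    and Y: "\<And>q. q \<in> W \<Longrightarrow> q \<in> cdom c \<Longrightarrow> q \<in> cdom d \<Longrightarrow> Yd q = jacobian c d q *v Yc q"
    and dc: "\<And>k. differentiable_in c p (\<lambda>q. Yc q $ k)" and dd: "\<And>k. differentiable_in d p (\<lambda>q. Yd q $ k)"
  shows "divergence_in c Yc p = divergence_in d Yd p"
  unfolding divergence_in_def
  by (rule trace_similar(1)[OF cov_matrix_change[OF assms] jacobian_inverse[OF c(1) d(1) c(2) d(2)]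
        jacobian_inverse[OF d(1) c(1) d(2) c(2)]])

lemma divergence_in_eq: "divergence_in c Y p = (\<Sum>i\<in>UNIV. pd c i (\<lambda>q. Y q $ i) p) + (\<Sum>i\<in>UNIV. \<Sum>j\<in>UNIV. christoffel g c p i j i * Y p $ j)"
  by (simp add: divergence_in_def trace_def cov_matrix_def cov_deriv_def sum.distrib)

end


section \<open>The Bochner identity\<close>

lemma sum_swap_pairs:
  "(\<Sum>a\<in>P. \<Sum>b\<in>Q. \<Sum>c\<in>R. \<Sum>d\<in>S. f a b c d) = (\<Sum>c\<in>R. \<Sum>d\<in>S. \<Sum>a\<in>P. \<Sum>b\<in>Q. f a b c d)"
proof -
  have "(\<Sum>a\<in>P. \<Sum>b\<in>Q. \<Sum>c\<in>R. \<Sum>d\<in>S. f a b c d) = (\<Sum>a\<in>P. \<Sum>c\<in>R. \<Sum>b\<in>Q. \<Sum>d\<in>S. f a b c d)"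
    by (intro sum.cong refl sum.swap)
  also have "\<dots> = (\<Sum>c\<in>R. \<Sum>a\<in>P. \<Sum>b\<in>Q. \<Sum>d\<in>S. f a b c d)" by (rule sum.swap)
  also have "\<dots> = (\<Sum>c\<in>R. \<Sum>a\<in>P. \<Sum>d\<in>S. \<Sum>b\<in>Q. f a b c d)" by (intro sum.cong refl sum.swap)
  also have "\<dots> = (\<Sum>c\<in>R. \<Sum>d\<in>S. \<Sum>a\<in>P. \<Sum>b\<in>Q. f a b c d)" by (intro sum.cong refl sum.swap)
  finally show ?thesis .
qed

text \<open>Here \<open>x j\<close>, \<open>dx i j\<close>, \<open>ddx l i j\<close>, \<open>\<Gamma> i j k\<close> and \<open>d\<Gamma> l i j k\<close> stand for the values of \<open>X\<^sup>j\<close>,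
  \<open>\<partial>\<^sub>iX\<^sup>j\<close>, \<open>\<partial>\<^sub>l\<partial>\<^sub>iX\<^sup>j\<close>, \<open>\<Gamma>\<^sup>k\<^sub>i\<^sub>j\<close> and \<open>\<partial>\<^sub>l\<Gamma>\<^sup>k\<^sub>i\<^sub>j\<close> at a point, so that \<open>a k i\<close> is \<open>\<nabla>\<^sub>iX\<^sup>k\<close> and \<open>da l k i\<close>
  is its derivative in the direction \<open>l\<close>.\<close>

lemma bochner_algebra:
  fixes x :: "'n::finite \<Rightarrow> real" and dx :: "'n \<Rightarrow> 'n \<Rightarrow> real" and ddx \<Gamma> :: "'n \<Rightarrow> 'n \<Rightarrow> 'n \<Rightarrow> real"
    and d\<Gamma> :: "'n \<Rightarrow> 'n \<Rightarrow> 'n \<Rightarrow> 'n \<Rightarrow> real"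
  assumes \<Gamma>_sym: "\<And>i j k. \<Gamma> i j k = \<Gamma> j i k" and ddx_sym: "\<And>i j k. ddx i j k = ddx j i k"
  defines "a \<equiv> \<lambda>k i. dx i k + (\<Sum>j\<in>UNIV. \<Gamma> i j k * x j)"
  defines "da \<equiv> \<lambda>l k i. ddx l i k + (\<Sum>j\<in>UNIV. \<Gamma> i j k * dx l j + d\<Gamma> l i j k * x j)"
  defines "ric \<equiv> \<lambda>j k. \<Sum>i\<in>UNIV. d\<Gamma> i j k i - d\<Gamma> j i k i
    + (\<Sum>m\<in>UNIV. \<Gamma> i m i * \<Gamma> j k m - \<Gamma> j m i * \<Gamma> i k m)"
  shows "(\<Sum>i\<in>UNIV. (\<Sum>j\<in>UNIV. a i j * dx i j + da i i j * x j)
        - ((\<Sum>j\<in>UNIV. a j j) * dx i i + (\<Sum>j\<in>UNIV. da i j j) * x i))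
      + (\<Sum>i\<in>UNIV. \<Sum>m\<in>UNIV. \<Gamma> i m i * ((\<Sum>j\<in>UNIV. a m j * x j) - (\<Sum>j\<in>UNIV. a j j) * x m))
    = (\<Sum>i\<in>UNIV. \<Sum>j\<in>UNIV. a i j * a j i) - (\<Sum>i\<in>UNIV. a i i)\<^sup>2
      + (\<Sum>j\<in>UNIV. x j * (\<Sum>k\<in>UNIV. ric j k * x k))"
proof -
  let ?U = "UNIV :: 'n set"
  define t where "t = (\<Sum>i\<in>?U. a i i)"
  \<comment> \<open>\<open>T1\<close> is the part of the Ricci contraction with derivatives of
    \<open>\<Gamma>\<close>, \<open>Q1\<close> and \<open>Q2\<close> are its quadratic parts.
    \<open>T2\<close> and \<open>T3\<close> pair \<open>\<Gamma>\<close> with covariant derivatives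
    and must cancel in the end.\<close>
  define T1 where "T1 j = (\<Sum>i\<in>?U. \<Sum>k\<in>?U. (d\<Gamma> i j k i - d\<Gamma> j i k i) * x k)" for j
  define T2 where "T2 j = (\<Sum>i\<in>?U. \<Sum>m\<in>?U. \<Gamma> j m i * a m i)" for j
  define T3 where "T3 j = (\<Sum>i\<in>?U. \<Sum>m\<in>?U. \<Gamma> i m i * a m j)" for j
  define Q1 where "Q1 j = (\<Sum>i\<in>?U. \<Sum>m\<in>?U. \<Sum>k\<in>?U. \<Gamma> j m i * \<Gamma> i k m * x k)" for j
  define Q2 where "Q2 j = (\<Sum>i\<in>?U. \<Sum>m\<in>?U. \<Sum>k\<in>?U. \<Gamma> i m i * \<Gamma> j k m * x k)" for j
  have dx: "dx i k = a k i - (\<Sum>j\<in>?U. \<Gamma> i j k * x j)" for i k by (simp add: a_def)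
  \<comment> \<open>The second derivatives of the field cancel here, leaving terms of order at most
    one.\<close>
  have diff: "da i i j - da j i i = (\<Sum>k\<in>?U. (d\<Gamma> i j k i - d\<Gamma> j i k i) * x k)
      + (\<Sum>m\<in>?U. \<Gamma> j m i * dx i m) - (\<Sum>m\<in>?U. \<Gamma> i m i * dx j m)" for i j
    using ddx_sym[of i j i] by (simp add: da_def sum.distrib left_diff_distrib sum_subtractf)
  have gdx: "(\<Sum>m\<in>?U. \<Gamma> j m i * dx l m)
      = (\<Sum>m\<in>?U. \<Gamma> j m i * a m l) - (\<Sum>m\<in>?U. \<Sum>k\<in>?U. \<Gamma> j m i * \<Gamma> l k m * x k)" for i j l
    by (simp add: dx right_diff_distrib sum_subtractf sum_distrib_left mult.assoc)
  have sum_da: "(\<Sum>i\<in>?U. da i i j - da j i i) = T1 j + T2 j - Q1 j - T3 j + Q2 j" for j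
    unfolding diff gdx T1_def T2_def T3_def Q1_def Q2_def
    by (simp add: sum.distrib sum_subtractf)
  have T2': "(\<Sum>i\<in>?U. \<Sum>m\<in>?U. a i m * \<Gamma> i j m) = T2 j" for j
    unfolding T2_def by (subst sum.swap) (simp add: \<Gamma>_sym[of _ j] mult.commute)
  have ricx: "(\<Sum>k\<in>?U. ric j k * x k) = T1 j - Q1 j + Q2 j" for j
  proof -
    have "(\<Sum>k\<in>?U. ric j k * x k) = (\<Sum>i\<in>?U. \<Sum>k\<in>?U. (d\<Gamma> i j k i - d\<Gamma> j i k i
        + (\<Sum>m\<in>?U. \<Gamma> i m i * \<Gamma> j k m - \<Gamma> j m i * \<Gamma> i k m)) * x k)"
      unfolding ric_def sum_distrib_right by (rule sum.swap)
    also have "\<dots> = T1 j + (\<Sum>i\<in>?U. \<Sum>k\<in>?U. \<Sum>m\<in>?U. \<Gamma> i m i * \<Gamma> j k m * x k)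
        - (\<Sum>i\<in>?U. \<Sum>k\<in>?U. \<Sum>m\<in>?U. \<Gamma> j m i * \<Gamma> i k m * x k)"
      unfolding T1_def
      by (simp add: distrib_right sum.distrib sum_subtractf sum_distrib_right left_diff_distrib)
    also have "(\<Sum>i\<in>?U. \<Sum>k\<in>?U. \<Sum>m\<in>?U. \<Gamma> i m i * \<Gamma> j k m * x k) = Q2 j"
      unfolding Q2_def by (intro sum.cong refl sum.swap)
    also have "(\<Sum>i\<in>?U. \<Sum>k\<in>?U. \<Sum>m\<in>?U. \<Gamma> j m i * \<Gamma> i k m * x k) = Q1 j"
      unfolding Q1_def by (intro sum.cong refl sum.swap)
    finally show ?thesis by simp
  qed
  have E: "(\<Sum>j\<in>?U. x j * (\<Sum>k\<in>?U. ric j k * x k))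
      = (\<Sum>j\<in>?U. x j * (\<Sum>i\<in>?U. da i i j - da j i i)) + (\<Sum>j\<in>?U. x j * T3 j)
        - (\<Sum>j\<in>?U. x j * T2 j)"
  proof -
    have "(\<Sum>k\<in>?U. ric j k * x k) = (\<Sum>i\<in>?U. da i i j - da j i i) + T3 j - T2 j" for j
      by (simp add: ricx sum_da)
    then show ?thesis
      by (simp only: distrib_left right_diff_distrib sum.distrib sum_subtractf)
  qed
  have E1: "(\<Sum>j\<in>?U. x j * (\<Sum>i\<in>?U. da i i j - da j i i))
      = (\<Sum>i\<in>?U. \<Sum>j\<in>?U. da i i j * x j) - (\<Sum>i\<in>?U. (\<Sum>j\<in>?U. da i j j) * x i)"
  proof -
    have "(\<Sum>j\<in>?U. x j * (\<Sum>i\<in>?U. da i i j)) = (\<Sum>i\<in>?U. \<Sum>j\<in>?U. da i i j * x j)"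
      unfolding sum_distrib_left by (subst sum.swap) (simp add: mult.commute)
    then show ?thesis by (simp add: sum_subtractf right_diff_distrib mult.commute[of "x _"])
  qed
  have E2: "(\<Sum>j\<in>?U. x j * T3 j) = (\<Sum>i\<in>?U. \<Sum>m\<in>?U. \<Gamma> i m i * (\<Sum>j\<in>?U. a m j * x j))"
  proof -
    have "(\<Sum>j\<in>?U. x j * T3 j) = (\<Sum>i\<in>?U. \<Sum>j\<in>?U. \<Sum>m\<in>?U. x j * (\<Gamma> i m i * a m j))"
      unfolding T3_def sum_distrib_left by (rule sum.swap)
    also have "\<dots> = (\<Sum>i\<in>?U. \<Sum>m\<in>?U. \<Sum>j\<in>?U. x j * (\<Gamma> i m i * a m j))"
      by (intro sum.cong refl sum.swap)
    finally show ?thesis by (simp add: sum_distrib_left mult_ac)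
  qed
  \<comment> \<open>Replacing one plain derivative by a covariant one costs \<open>T2\<close>;
    together with \<open>T3\<close> in \<open>E2\<close> this removes the surplus terms of
    \<open>E\<close>.\<close>
  have E3: "(\<Sum>i\<in>?U. \<Sum>j\<in>?U. a i j * dx i j) = (\<Sum>i\<in>?U. \<Sum>j\<in>?U. a i j * a j i) - (\<Sum>j\<in>?U. x j * T2 j)"
  proof -
    have "(\<Sum>j\<in>?U. x j * T2 j) = (\<Sum>i\<in>?U. \<Sum>j\<in>?U. \<Sum>m\<in>?U. x j * (a i m * \<Gamma> i j m))"
      unfolding T2'[symmetric] sum_distrib_left by (rule sum.swap)
    also have "\<dots> = (\<Sum>i\<in>?U. \<Sum>m\<in>?U. \<Sum>j\<in>?U. x j * (a i m * \<Gamma> i j m))"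
      by (intro sum.cong refl sum.swap)
    finally show ?thesis
      by (simp add: dx right_diff_distrib sum_subtractf sum_distrib_left mult_ac)
  qed
  have E4: "(\<Sum>i\<in>?U. t * dx i i) + (\<Sum>i\<in>?U. \<Sum>m\<in>?U. \<Gamma> i m i * (t * x m)) = t\<^sup>2"
  proof -
    have "t = (\<Sum>i\<in>?U. dx i i) + (\<Sum>i\<in>?U. \<Sum>m\<in>?U. \<Gamma> i m i * x m)"
      by (simp add: t_def a_def sum.distrib)
    then have "t * t = t * (\<Sum>i\<in>?U. dx i i) + t * (\<Sum>i\<in>?U. \<Sum>m\<in>?U. \<Gamma> i m i * x m)"
      by (simp add: distrib_left)
    then show ?thesis
      by (simp add: power2_eq_square sum_distrib_left mult_ac)
  qed
  show ?thesis
    unfolding t_def[symmetric] E E1 E2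
    using E3 E4 by (simp add: sum.distrib sum_subtractf right_diff_distrib)
qed

context riemannian
begin

lemma smooth_in_cov_matrix:
  assumes "c \<in> A" "\<And>j. smooth_in c UNIV (\<lambda>q. Y q $ j)"
  shows "smooth_in c UNIV (\<lambda>q. cov_matrix c Y q $ k $ i)"
  using assms unfolding cov_matrix_def cov_deriv_def vec_lambda_beta
  by (intro smooth_in_intros smooth_in_pd smooth_in_christoffel open_UNIV)

lemma smooth_in_differentiable_UNIV:
  "c \<in> A \<Longrightarrow> p \<in> cdom c \<Longrightarrow> smooth_in c UNIV f \<Longrightarrow> differentiable_in c p f"
  by (rule smooth_in_differentiable[where W = UNIV]) auto

lemma ricci_matrix_eq:
  "ricci_matrix g c p $ j $ k = (\<Sum>i\<in>UNIV. pd c i (\<lambda>q. christoffel g c q j k i) p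
     - pd c j (\<lambda>q. christoffel g c q i k i) p
     + (\<Sum>m\<in>UNIV. christoffel g c p i m i * christoffel g c p j k m
         - christoffel g c p j m i * christoffel g c p i k m))"
proof -
  have 1: "cov_deriv g c j (\<lambda>_. axis k 1) = (\<lambda>q. \<chi> l. christoffel g c q j k l)" for j
    by (simp add: cov_deriv_def fun_eq_iff pd_const mult.commute[of "christoffel g _ _ _ _ _"] sum_axis)
  have "cov_deriv g c i (cov_deriv g c j (\<lambda>_. axis k 1)) p $ l = pd c i (\<lambda>q. christoffel g c q j k l) p
      + (\<Sum>m\<in>UNIV. christoffel g c p i m l * christoffel g c p j k m)" for i j l
    unfolding 1 by (simp add: cov_deriv_def)
  then show ?thesis
    by (simp add: ricci_matrix_def curvature_def sum_subtractf sum.distrib)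
qed

text \<open>The divergence of \<open>\<nabla>\<^sub>X X - (div X) X\<close>. The second covariant derivatives of \<open>X\<close> commute up to
  the curvature because the connection is torsion-free.\<close>

lemma bochner:
  assumes c: "c \<in> A" "p \<in> cdom c" and X: "\<And>j. smooth_in c UNIV (\<lambda>q. X q $ j)"
  shows "divergence_in c (\<lambda>q. cov_matrix c X q *v X q - divergence_in c X q *\<^sub>R X q) p
    = trace (cov_matrix c X p ** cov_matrix c X p) - (divergence_in c X p)\<^sup>2 + X p \<bullet> (ricci_matrix g c p *v X p)"
proof -
  define x where "x j = X p $ j" for j
  define dx where "dx i j = pd c i (\<lambda>q. X q $ j) p" for i j
  define ddx where "ddx l i k = pd c l (pd c i (\<lambda>q. X q $ k)) p" for l i k
  define \<Gamma> where "\<Gamma> i j k = christoffel g c p i j k" for i j k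
  define d\<Gamma> where "d\<Gamma> l i j k = pd c l (\<lambda>q. christoffel g c q i j k) p" for l i j k
  have \<Gamma>_sym: "\<Gamma> i j k = \<Gamma> j i k" for i j k using christoffel_sym c by (simp add: \<Gamma>_def)
  have ddx_sym: "ddx i j k = ddx j i k" for i j k
    unfolding ddx_def using c X by (intro pd_commute[where W = UNIV]) auto
  note D = smooth_in_differentiable_UNIV[OF c]
  have Dx: "differentiable_in c p (\<lambda>q. X q $ j)" for j by (intro D X)
  have Da: "differentiable_in c p (\<lambda>q. cov_matrix c X q $ k $ i)" for k i
    by (intro D smooth_in_cov_matrix X c)
  have a: "cov_matrix c X p $ k $ i = dx i k + (\<Sum>j\<in>UNIV. \<Gamma> i j k * x j)" for k i
    by (simp add: cov_matrix_def cov_deriv_def dx_def \<Gamma>_def x_def)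
  have da: "pd c l (\<lambda>q. cov_matrix c X q $ k $ i) p
      = ddx l i k + (\<Sum>j\<in>UNIV. \<Gamma> i j k * dx l j + d\<Gamma> l i j k * x j)" for l k i
  proof -
    have "differentiable_in c p (pd c i (\<lambda>q. X q $ k))"
      "differentiable_in c p (\<lambda>q. christoffel g c q i j k)" for j
      by (intro D smooth_in_pd smooth_in_christoffel X c open_UNIV)+
    then show ?thesis
      using c Dx by (simp add: cov_matrix_def cov_deriv_def pd_add pd_sum pd_mult differentiable_in_intros
          ddx_def dx_def \<Gamma>_def d\<Gamma>_def x_def)
  qed
  have V: "pd c l (\<lambda>q. (cov_matrix c X q *v X q - divergence_in c X q *\<^sub>R X q) $ k) p
      = (\<Sum>j\<in>UNIV. cov_matrix c X p $ k $ j * dx l j + pd c l (\<lambda>q. cov_matrix c X q $ k $ j) p * x j)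
        - ((\<Sum>j\<in>UNIV. cov_matrix c X p $ j $ j) * dx l k
            + (\<Sum>j\<in>UNIV. pd c l (\<lambda>q. cov_matrix c X q $ j $ j) p) * x k)" for l k
  proof -
    have eq: "(cov_matrix c X q *v X q - divergence_in c X q *\<^sub>R X q) $ k
        = (\<Sum>j\<in>UNIV. cov_matrix c X q $ k $ j * X q $ j) - (\<Sum>j\<in>UNIV. cov_matrix c X q $ j $ j) * X q $ k" for q
      by (simp add: matrix_vector_mult_def divergence_in_def trace_def)
    show ?thesis
      unfolding eq using c Dx Da
      by (simp add: pd_diff pd_sum pd_mult differentiable_in_intros dx_def x_def)
  qed
  show ?thesis
    unfolding divergence_in_eq[of c "\<lambda>q. cov_matrix c X q *v X q - divergence_in c X q *\<^sub>R X q"] V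
    using bochner_algebra[of \<Gamma> ddx dx x d\<Gamma>, OF \<Gamma>_sym ddx_sym]
    unfolding a[symmetric] da[symmetric]
    by (simp add: \<Gamma>_def[symmetric] d\<Gamma>_def[symmetric] x_def[symmetric] ricci_matrix_eq inner_vec_def
        matrix_vector_mult_def trace_def matrix_matrix_mult_def divergence_in_def)
qed

section \<open>Gradient and Hessian\<close>

definition gradient :: "('a \<Rightarrow> real) \<Rightarrow> ('a, 'n) chart \<Rightarrow> 'a \<Rightarrow> real^'n" where
  "gradient u c p = matrix_inv (g c p) *v diff_form c u p"

lemma smooth_in_gradient:
  assumes "smooth_fun A u" "c \<in> A"
  shows "smooth_in c UNIV (\<lambda>q. gradient u c q $ i)"
  using assms unfolding gradient_def matrix_vector_mult_def diff_form_def vec_lambda_beta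
  by (intro smooth_in_intros smooth_in_pd smooth_in_metric_inv open_UNIV) (auto simp: smooth_fun_def)

lemma metric_gradient: "c \<in> A \<Longrightarrow> p \<in> cdom c \<Longrightarrow> g c p *v gradient u c p = diff_form c u p"
  by (simp add: gradient_def matrix_vector_mul_assoc matrix_inv_inverse invertible_metric)

text \<open>The inverse metric is not transformed directly: both sides become the same covector when
  the metric is applied, and the metric is invertible.\<close>

lemma gradient_change:
  assumes u: "smooth_fun A u" and c: "c \<in> A" "p \<in> cdom c" and d: "d \<in> A" "p \<in> cdom d"
  shows "gradient u d p = jacobian c d p *v gradient u c p"
proof -
  let ?J = "jacobian c d p" and ?K = "jacobian d c p"
  have "differentiable_in d p u"
    using u d by (intro smooth_in_differentiable_UNIV) (auto simp: smooth_fun_def)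
  then have du: "diff_form c u p = transpose ?J *v diff_form d u p"
    using c d by (simp add: diff_form_def vec_eq_iff matrix_vector_mult_def transpose_def pd_change[of c d])
  have KJ: "transpose ?K ** transpose ?J = mat 1"
    by (simp add: matrix_transpose_mul[symmetric] jacobian_inverse c d)
  have "g d p *v (?J *v gradient u c p) = (transpose ?K ** transpose ?J) *v (g d p *v (?J *v gradient u c p))"
    by (simp add: KJ)
  also have "\<dots> = transpose ?K *v (g c p *v gradient u c p)"
    by (simp add: metric_change[OF c(1) d(1) c(2) d(2)] matrix_vector_mul_assoc matrix_mul_assoc)
  also have "\<dots> = (transpose ?K ** transpose ?J) *v diff_form d u p"
    by (simp only: metric_gradient[OF c] du matrix_vector_mul_assoc)
  finally have "g d p *v (?J *v gradient u c p) = diff_form d u p" by (simp add: KJ)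
  then have "gradient u d p = (matrix_inv (g d p) ** g d p) *v (?J *v gradient u c p)"
    by (simp add: gradient_def[of u d] matrix_vector_mul_assoc[symmetric])
  then show ?thesis by (simp add: matrix_inv_inverse invertible_metric d)
qed

lemma smooth_vector_field_gradient: "smooth_fun A u \<Longrightarrow> smooth_vector_field A (gradient u)"
  unfolding smooth_vector_field_def using smooth_in_gradient gradient_change by blast

lemma hess_matrix_eq:
  "hess_matrix g c u p $ i $ j = pd c i (pd c j u) p - (\<Sum>k\<in>UNIV. christoffel g c p i j k * pd c k u p)"
  by (simp add: hess_matrix_def cov_deriv_form_def diff_form_def)

lemma hess_matrix_sym:
  assumes "smooth_fun A u" "c \<in> A" "p \<in> cdom c"
  shows "hess_matrix g c u p $ i $ j = hess_matrix g c u p $ j $ i"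
  using assms pd_commute[where W = UNIV] by (simp add: hess_matrix_eq smooth_fun_def christoffel_sym)

text \<open>Lowering an index commutes with covariant differentiation. Differentiating
  \<open>g X = du\<close>, metric compatibility yields two Christoffel terms: one completes the
  derivative of \<open>X\<close> to \<open>\<nabla>X\<close>, the other turns second derivatives of
  \<open>u\<close> into the Hessian.\<close>

lemma metric_cov_matrix_gradient:
  assumes u: "smooth_fun A u" and c: "c \<in> A" "p \<in> cdom c"
  shows "(\<Sum>k\<in>UNIV. g c p $ m $ k * cov_matrix c (gradient u c) p $ k $ i) = hess_matrix g c u p $ i $ m"
proof -
  let ?X = "gradient u c"
  have grad: "pd c m u q = (\<Sum>k\<in>UNIV. g c q $ m $ k * ?X q $ k)" if "q \<in> cdom c" for q m
    using metric_gradient[OF c(1) that, of u] by (simp add: vec_eq_iff matrix_vector_mult_def diff_form_def)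
  have "pd c i (pd c m u) p = pd c i (\<lambda>q. \<Sum>k\<in>UNIV. g c q $ m $ k * ?X q $ k) p"
    by (rule pd_cong_open[OF c(1) open_cdom[OF c(1)] c(2) c(2)]) (rule grad)
  also have "\<dots> = (\<Sum>k\<in>UNIV. g c p $ m $ k * pd c i (\<lambda>q. ?X q $ k) p + pd c i (\<lambda>q. g c q $ m $ k) p * ?X p $ k)"
    using c smooth_in_differentiable_UNIV[OF c smooth_in_gradient[OF u c(1)]]
    by (simp add: pd_sum pd_mult differentiable_in_intros differentiable_in_metric)
  also have "(\<Sum>k\<in>UNIV. g c p $ m $ k * pd c i (\<lambda>q. ?X q $ k) p + pd c i (\<lambda>q. g c q $ m $ k) p * ?X p $ k)
    = (\<Sum>k\<in>UNIV. g c p $ m $ k * pd c i (\<lambda>q. ?X q $ k) p)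
     + (\<Sum>k\<in>UNIV. \<Sum>l\<in>UNIV. christoffel g c p i m l * g c p $ l $ k * ?X p $ k)
     + (\<Sum>k\<in>UNIV. \<Sum>l\<in>UNIV. christoffel g c p i k l * g c p $ m $ l * ?X p $ k)"
    by (simp add: christoffel_metric[OF manifold c, of i m] sum.distrib distrib_right sum_distrib_right)
  also have "(\<Sum>k\<in>UNIV. \<Sum>l\<in>UNIV. christoffel g c p i m l * g c p $ l $ k * ?X p $ k)
     = (\<Sum>l\<in>UNIV. christoffel g c p i m l * pd c l u p)"
    unfolding grad[OF c(2)] sum_distrib_left by (subst sum.swap) (simp add: mult.assoc)
  also have "(\<Sum>k\<in>UNIV. \<Sum>l\<in>UNIV. christoffel g c p i k l * g c p $ m $ l * ?X p $ k)
     = (\<Sum>l\<in>UNIV. g c p $ m $ l * (\<Sum>k\<in>UNIV. christoffel g c p i k l * ?X p $ k))"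
    unfolding sum_distrib_left by (subst sum.swap) (simp add: mult_ac)
  finally show ?thesis
    by (simp add: hess_matrix_eq cov_matrix_def cov_deriv_def distrib_left sum.distrib)
qed

lemma cov_matrix_gradient:
  assumes u: "smooth_fun A u" and c: "c \<in> A" "p \<in> cdom c"
  shows "cov_matrix c (gradient u c) p $ k $ i = (\<Sum>m\<in>UNIV. matrix_inv (g c p) $ k $ m * hess_matrix g c u p $ i $ m)"
proof -
  let ?B = "cov_matrix c (gradient u c) p"
  have "g c p ** ?B = transpose (hess_matrix g c u p)"
    using metric_cov_matrix_gradient[OF assms]
    by (simp add: matrix_matrix_mult_def transpose_def vec_eq_iff)
  then have "?B = matrix_inv (g c p) ** transpose (hess_matrix g c u p)"
    by (metis c invertible_metric matrix_inv_inverse(2) matrix_mul_assoc matrix_mul_lid)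
  then show ?thesis by (simp add: matrix_matrix_mult_def transpose_def vec_eq_iff)
qed

lemma metric_inv_sym: "c \<in> A \<Longrightarrow> p \<in> cdom c \<Longrightarrow> matrix_inv (g c p) $ i $ j = matrix_inv (g c p) $ j $ i"
proof -
  assume c: "c \<in> A" "p \<in> cdom c"
  let ?G = "matrix_inv (g c p)"
  note inv = matrix_inv_inverse[OF invertible_metric[OF c]]
  have "transpose ?G ** g c p = transpose (g c p ** ?G)"
    by (simp add: matrix_transpose_mul transpose_metric c)
  then have "transpose ?G ** g c p = mat 1" by (simp add: inv)
  then have "transpose ?G = ?G"
    by (metis inv(1) matrix_mul_assoc matrix_mul_lid matrix_mul_rid)
  then have "transpose ?G $ j $ i = ?G $ j $ i" by simp
  then show ?thesis by (simp add: transpose_def)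
qed

lemma metric_inv_pos: "c \<in> A \<Longrightarrow> p \<in> cdom c \<Longrightarrow> v \<noteq> 0 \<Longrightarrow> 0 < v \<bullet> (matrix_inv (g c p) *v v)"
proof -
  assume c: "c \<in> A" "p \<in> cdom c" and v: "v \<noteq> 0"
  define w where "w = matrix_inv (g c p) *v v"
  have gw: "g c p *v w = v"
    by (simp add: w_def matrix_vector_mul_assoc matrix_inv_inverse invertible_metric c)
  with v have "w \<noteq> 0" by auto
  then have "0 < w \<bullet> (g c p *v w)" by (rule metric_pos[OF c])
  then show ?thesis by (simp add: gw w_def[symmetric] inner_commute)
qed

text \<open>Raising one index of the symmetric tensor \<open>H\<close> gives \<open>B\<close>, so
  contractions with \<open>G\<close> become traces. Nonnegativity of the trace is what permits
  undoing the square root in \<open>hess_norm\<close>.\<close>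

lemma
  assumes u: "smooth_fun A u" and c: "c \<in> A" "p \<in> cdom c"
  defines "G \<equiv> matrix_inv (g c p)" and "H \<equiv> hess_matrix g c u p" and "B \<equiv> cov_matrix c (gradient u c) p"
  shows hess_square_eq: "(\<Sum>i\<in>UNIV. \<Sum>j\<in>UNIV. \<Sum>k\<in>UNIV. \<Sum>l\<in>UNIV. G $ i $ k * G $ j $ l * H $ i $ j * H $ k $ l)
      = trace (B ** B)"
    and hess_trace_eq: "(\<Sum>i\<in>UNIV. \<Sum>j\<in>UNIV. G $ i $ j * H $ i $ j) = trace B"
    and trace_square_nonneg: "0 \<le> trace (B ** B)"
proof -
  have B: "B $ k $ i = (\<Sum>m\<in>UNIV. G $ k $ m * H $ i $ m)" for k i
    unfolding B_def G_def H_def by (rule cov_matrix_gradient[OF u c])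
  have Gs: "G $ i $ j = G $ j $ i" for i j unfolding G_def by (rule metric_inv_sym[OF c])
  have Hs: "H $ i $ j = H $ j $ i" for i j unfolding H_def by (rule hess_matrix_sym[OF u c])
  show eq: "(\<Sum>i\<in>UNIV. \<Sum>j\<in>UNIV. \<Sum>k\<in>UNIV. \<Sum>l\<in>UNIV. G $ i $ k * G $ j $ l * H $ i $ j * H $ k $ l) = trace (B ** B)"
  proof -
    have "trace (B ** B) = (\<Sum>l\<in>UNIV. \<Sum>i\<in>UNIV. (\<Sum>j\<in>UNIV. G $ j $ l * H $ i $ j) * (\<Sum>k\<in>UNIV. G $ i $ k * H $ k $ l))"
      unfolding trace_def matrix_matrix_mult_def vec_lambda_beta B
      by (intro sum.cong refl arg_cong2[where f = "(*)"] Gs Hs)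
    also have "\<dots> = (\<Sum>i\<in>UNIV. \<Sum>l\<in>UNIV. \<Sum>j\<in>UNIV. \<Sum>k\<in>UNIV. G $ i $ k * G $ j $ l * H $ i $ j * H $ k $ l)"
      by (subst sum.swap) (simp add: sum_product mult_ac)
    also have "\<dots> = (\<Sum>i\<in>UNIV. \<Sum>j\<in>UNIV. \<Sum>l\<in>UNIV. \<Sum>k\<in>UNIV. G $ i $ k * G $ j $ l * H $ i $ j * H $ k $ l)"
      by (intro sum.cong refl sum.swap)
    also have "\<dots> = (\<Sum>i\<in>UNIV. \<Sum>j\<in>UNIV. \<Sum>k\<in>UNIV. \<Sum>l\<in>UNIV. G $ i $ k * G $ j $ l * H $ i $ j * H $ k $ l)"
      by (intro sum.cong refl sum.swap)
    finally show ?thesis by simp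
  qed
  show "(\<Sum>i\<in>UNIV. \<Sum>j\<in>UNIV. G $ i $ j * H $ i $ j) = trace B"
    by (simp add: trace_def B)
  \<comment> \<open>In matrix form \<open>M\<close> is the transpose of \<open>H\<close> times
    \<open>G H\<close>, hence semidefinite. The squared norm is its pairing with the positive
    definite \<open>G\<close>, so no orthonormal frame has to be chosen.\<close>
  define M where "M j l = (\<Sum>i\<in>UNIV. \<Sum>k\<in>UNIV. G $ i $ k * H $ i $ j * H $ k $ l)" for j l
  have quad: "(\<Sum>j\<in>UNIV. \<Sum>l\<in>UNIV. G $ j $ l * x j * x l) = (\<chi> j. x j) \<bullet> (G *v (\<chi> j. x j))" for x
    by (simp add: inner_vec_def matrix_vector_mult_def sum_distrib_left mult_ac)
  have G0: "0 \<le> v \<bullet> (G *v v)" for v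
    using metric_inv_pos[OF c, of v] by (cases "v = 0") (auto simp: G_def)
  have "0 \<le> (\<Sum>j\<in>UNIV. \<Sum>l\<in>UNIV. G $ j $ l * M j l)"
  proof (rule sum_mult_nonneg_if_semidefinite)
    show "0 < (\<Sum>j\<in>UNIV. \<Sum>l\<in>UNIV. G $ j $ l * x j * x l)" if "x j \<noteq> 0" for x j
      unfolding quad unfolding G_def using that by (intro metric_inv_pos[OF c]) (auto simp: vec_eq_iff)
    show "0 \<le> (\<Sum>j\<in>UNIV. \<Sum>l\<in>UNIV. M j l * x j * x l)" for x
    proof -
      define y where "y i = (\<Sum>j\<in>UNIV. H $ i $ j * x j)" for i
      have "(\<Sum>i\<in>UNIV. \<Sum>k\<in>UNIV. G $ i $ k * y i * y k)
          = (\<Sum>i\<in>UNIV. \<Sum>k\<in>UNIV. \<Sum>j\<in>UNIV. \<Sum>l\<in>UNIV. G $ i $ k * H $ i $ j * H $ k $ l * x j * x l)"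
        unfolding y_def mult.assoc sum_product by (simp add: sum_distrib_left mult_ac)
      also have "\<dots> = (\<Sum>j\<in>UNIV. \<Sum>l\<in>UNIV. M j l * x j * x l)"
        unfolding M_def sum_distrib_right by (rule sum_swap_pairs)
      finally show ?thesis using quad G0 by metis
    qed
  qed (auto intro: Gs)
  also have "(\<Sum>j\<in>UNIV. \<Sum>l\<in>UNIV. G $ j $ l * M j l)
      = (\<Sum>i\<in>UNIV. \<Sum>j\<in>UNIV. \<Sum>k\<in>UNIV. \<Sum>l\<in>UNIV. G $ i $ k * G $ j $ l * H $ i $ j * H $ k $ l)"
  proof -
    have "(\<Sum>j\<in>UNIV. \<Sum>l\<in>UNIV. G $ j $ l * M j l)
        = (\<Sum>j\<in>UNIV. \<Sum>l\<in>UNIV. \<Sum>i\<in>UNIV. \<Sum>k\<in>UNIV. G $ i $ k * G $ j $ l * H $ i $ j * H $ k $ l)"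
      by (simp add: M_def sum_distrib_left mult_ac)
    also have "\<dots> = (\<Sum>i\<in>UNIV. \<Sum>k\<in>UNIV. \<Sum>j\<in>UNIV. \<Sum>l\<in>UNIV. G $ i $ k * G $ j $ l * H $ i $ j * H $ k $ l)"
      by (rule sum_swap_pairs)
    also have "\<dots> = (\<Sum>i\<in>UNIV. \<Sum>j\<in>UNIV. \<Sum>k\<in>UNIV. \<Sum>l\<in>UNIV. G $ i $ k * G $ j $ l * H $ i $ j * H $ k $ l)"
      by (intro sum.cong refl sum.swap)
    finally show ?thesis .
  qed
  finally show "0 \<le> trace (B ** B)" unfolding eq .
qed

lemma divergence_in_scale:
  assumes c: "c \<in> A" "p \<in> cdom c" and f: "differentiable_in c p f" and Y: "\<And>j. differentiable_in c p (\<lambda>q. Y q $ j)"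
  shows "divergence_in c (\<lambda>q. f q *\<^sub>R Y q) p = f p * divergence_in c Y p + (\<Sum>i\<in>UNIV. pd c i f p * Y p $ i)"
  using assms by (simp add: divergence_in_eq pd_mult sum.distrib sum_distrib_left distrib_left mult_ac)


section \<open>The volume measure and the divergence theorem\<close>

definition vol_density :: "('a, 'n) chart \<Rightarrow> 'a \<Rightarrow> real" where
  "vol_density c p = sqrt (det (g c p))"

text \<open>A Borel measure on the whole manifold with all its mass on \<open>cdom c\<close>. The
  restriction to the image of the chart is there because \<open>cinv c\<close> is controlled only on
  it.\<close>

definition chart_volume :: "('a, 'n) chart \<Rightarrow> 'a measure" where
  "chart_volume c = distr (density (restrict_space lborel (coord c ` cdom c))
     (\<lambda>x. ennreal (vol_density c (cinv c x)))) borel (cinv c)"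

lemma det_metric_pos: "c \<in> A \<Longrightarrow> p \<in> cdom c \<Longrightarrow> 0 < det (g c p)"
  by (rule det_pos_if_positive_definite) (rule metric_pos)

lemma vol_density_pos: "c \<in> A \<Longrightarrow> p \<in> cdom c \<Longrightarrow> 0 < vol_density c p"
  by (simp add: vol_density_def det_metric_pos)

lemma continuous_on_vol_density:
  assumes "c \<in> A"
  shows "continuous_on (coord c ` cdom c) (\<lambda>x. vol_density c (cinv c x))"
proof -
  have "smooth_on (coord c ` cdom c) (\<lambda>x. det (g c (cinv c x)))"
    using smooth_in_metric[OF assms] open_image_cdom[OF assms]
    by (intro smooth_on_det) (auto simp: smooth_in_def o_def)
  then show ?thesis unfolding vol_density_def
    by (intro continuous_on_real_sqrt smooth_on_continuous)
qed

lemma measurable_cinv: "c \<in> A \<Longrightarrow> cinv c \<in> measurable (restrict_space borel (coord c ` cdom c)) borel"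
  by (intro borel_measurable_continuous_on_restrict continuous_on_cinv)

lemma measurable_vol_density:
  "c \<in> A \<Longrightarrow> (\<lambda>x. vol_density c (cinv c x)) \<in> borel_measurable (restrict_space borel (coord c ` cdom c))"
  by (intro borel_measurable_continuous_on_restrict continuous_on_vol_density)

lemma sets_restrict_lborel: "sets (restrict_space lborel U) = sets (restrict_space borel U)"
  by (simp add: sets_restrict_space)

lemma coord_image_eq: "c \<in> A \<Longrightarrow> coord c ` (B \<inter> cdom c) = {x \<in> coord c ` cdom c. cinv c x \<in> B}"
  by force

lemma sets_coord_image:
  assumes "c \<in> A" "B \<in> sets borel"
  shows "coord c ` (B \<inter> cdom c) \<in> sets borel"
proof -
  have "cinv c -` B \<inter> space (restrict_space borel (coord c ` cdom c)) \<in> sets (restrict_space borel (coord c ` cdom c))"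
    using measurable_sets[OF measurable_cinv] assms by blast
  moreover have "cinv c -` B \<inter> space (restrict_space borel (coord c ` cdom c)) = coord c ` (B \<inter> cdom c)"
    unfolding coord_image_eq[OF assms(1)] by (auto simp: space_restrict_space)
  ultimately show ?thesis
    using open_image_cdom[OF assms(1)] by (simp add: sets_restrict_space_iff)
qed

lemma sets_chart_volume [simp]: "sets (chart_volume c) = sets borel"
  by (simp add: chart_volume_def)

lemma emeasure_chart_volume:
  assumes c: "c \<in> A" and B: "B \<in> sets borel"
  shows "emeasure (chart_volume c) B
    = (\<integral>\<^sup>+x. ennreal (indicator (coord c ` (B \<inter> cdom c)) x * vol_density c (cinv c x)) \<partial>lborel)"
proof -
  let ?U = "coord c ` cdom c" and ?\<rho> = "\<lambda>x. vol_density c (cinv c x)"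
  let ?L = "restrict_space lborel ?U"
  have U: "?U \<inter> space lborel \<in> sets lborel" using open_image_cdom[OF c] by simp
  have \<rho>: "(\<lambda>x. ennreal (?\<rho> x)) \<in> borel_measurable ?L"
    using measurable_vol_density[OF c] by (simp add: measurable_cong_sets[OF sets_restrict_lborel refl])
  have cinv: "cinv c \<in> measurable (density ?L (\<lambda>x. ennreal (?\<rho> x))) borel"
    using measurable_cinv[OF c] by (simp add: measurable_cong_sets[OF sets_restrict_lborel refl])
  have im: "cinv c -` B \<inter> space (density ?L (\<lambda>x. ennreal (?\<rho> x))) = coord c ` (B \<inter> cdom c)"
    unfolding coord_image_eq[OF c] by (auto simp: space_restrict_space)
  have mem: "coord c ` (B \<inter> cdom c) \<in> sets ?L"
    using sets_coord_image[OF assms] U by (auto simp: sets_restrict_space_iff)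
  have "emeasure (chart_volume c) B = emeasure (density ?L (\<lambda>x. ennreal (?\<rho> x))) (coord c ` (B \<inter> cdom c))"
    unfolding chart_volume_def by (subst emeasure_distr[OF cinv B]) (simp only: im)
  also have "\<dots> = (\<integral>\<^sup>+x. ennreal (?\<rho> x) * indicator (coord c ` (B \<inter> cdom c)) x \<partial>?L)"
    by (rule emeasure_density[OF \<rho> mem])
  also have "\<dots> = (\<integral>\<^sup>+x. ennreal (?\<rho> x) * indicator (coord c ` (B \<inter> cdom c)) x * indicator ?U x \<partial>lborel)"
    using U by (simp add: nn_integral_restrict_space)
  also have "\<dots> = (\<integral>\<^sup>+x. ennreal (indicator (coord c ` (B \<inter> cdom c)) x * ?\<rho> x) \<partial>lborel)"
    by (intro nn_integral_cong) (auto simp: indicator_def)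
  finally show ?thesis .
qed

lemma measurable_indicator_vol_density:
  assumes "c \<in> A" "B \<in> sets borel" "B \<subseteq> coord c ` cdom c"
  shows "(\<lambda>x. indicator B x * vol_density c (cinv c x)) \<in> borel_measurable borel"
proof -
  have "(\<lambda>x. indicator (coord c ` cdom c) x *\<^sub>R vol_density c (cinv c x)) \<in> borel_measurable borel"
    using measurable_vol_density[OF assms(1)] open_image_cdom[OF assms(1)]
    by (subst (asm) borel_measurable_restrict_space_iff) auto
  then have "(\<lambda>x. indicator B x * (indicator (coord c ` cdom c) x *\<^sub>R vol_density c (cinv c x))) \<in> borel_measurable borel"
    using assms(2) by measurable
  moreover have "indicator B x * (indicator (coord c ` cdom c) x *\<^sub>R vol_density c (cinv c x))
      = indicator B x * vol_density c (cinv c x)" for x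
    using assms(3) by (auto simp: indicator_def)
  ultimately show ?thesis by (simp only:)
qed

lemma vol_density_change:
  assumes "c \<in> A" "d \<in> A" "p \<in> cdom c" "p \<in> cdom d"
  shows "vol_density c p = \<bar>det (jacobian c d p)\<bar> * vol_density d p"
proof -
  have "det (g c p) = (det (jacobian c d p))\<^sup>2 * det (g d p)"
    by (simp add: metric_change[OF assms] det_mul det_transpose power2_eq_square)
  then show ?thesis by (simp add: vol_density_def real_sqrt_mult)
qed

text \<open>Change of variables along the transition map: its Jacobian determinant is the factor
  between the two densities, as \<open>vol_density_change\<close> states.\<close>

lemma chart_volume_change:
  assumes c: "c \<in> A" and d: "d \<in> A" and B: "B \<in> sets borel" "B \<subseteq> cdom c" "B \<subseteq> cdom d"
  shows "emeasure (chart_volume c) B = emeasure (chart_volume d) B"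
proof -
  let ?\<tau> = "coord d \<circ> cinv c" and ?S = "coord c ` B" and ?J = "\<lambda>x. jacobian c d (cinv c x)"
  have Bc: "B \<inter> cdom c = B" "B \<inter> cdom d = B" using B by auto
  have S: "?S \<in> sets borel" and T: "coord d ` B \<in> sets borel"
    using sets_coord_image[OF c B(1)] sets_coord_image[OF d B(1)] by (simp_all add: Bc)
  have im: "?\<tau> ` ?S = coord d ` B" using c B by (force simp: image_comp)
  have dens: "indicator ?S x * (\<bar>det (?J x)\<bar> * vol_density d (cinv d (?\<tau> x)))
      = indicator ?S x * vol_density c (cinv c x)" for x
    using vol_density_change[OF c d] B c d by (cases "x \<in> ?S") (auto simp: subset_iff)
  have "(\<integral>\<^sup>+y. ennreal (indicator (?\<tau> ` ?S) y * vol_density d (cinv d y)) \<partial>lborel)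
    = (\<integral>\<^sup>+x. ennreal (indicator ?S x * (\<bar>det (?J x)\<bar> * vol_density d (cinv d (?\<tau> x)))) \<partial>lborel)"
  proof (rule nn_integral_change_of_variables[OF S])
    show "(?\<tau> has_derivative (*v) (?J x)) (at x)" if "x \<in> ?S" for x
    proof -
      from that obtain q where "q \<in> B" "x = coord c q" by auto
      then show ?thesis using has_derivative_transition[OF c d, of q] B c by (simp add: subset_iff)
    qed
    show "inj_on ?\<tau> ?S"
    proof (rule inj_onI)
      fix x y assume xy: "x \<in> ?S" "y \<in> ?S" "?\<tau> x = ?\<tau> y"
      then obtain p q where pq: "p \<in> B" "q \<in> B" "x = coord c p" "y = coord c q" by auto
      then have "coord d p = coord d q" using xy(3) B c by (simp add: subset_iff)
      then have "cinv d (coord d p) = cinv d (coord d q)" by simp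
      then show "x = y" using pq B d by (simp add: subset_iff)
    qed
    show "0 \<le> vol_density d (cinv d y)" if "y \<in> ?\<tau> ` ?S" for y
      using that vol_density_pos[OF d] B d unfolding im by (auto simp: subset_iff intro!: less_imp_le)
    show "(\<lambda>y. indicator (?\<tau> ` ?S) y * vol_density d (cinv d y)) \<in> borel_measurable borel"
      unfolding im using measurable_indicator_vol_density[OF d T] B by blast
    show "(\<lambda>x. indicator ?S x * (\<bar>det (?J x)\<bar> * vol_density d (cinv d (?\<tau> x)))) \<in> borel_measurable borel"
      unfolding dens using measurable_indicator_vol_density[OF c S] B by blast
    show "?\<tau> ` ?S \<in> sets borel" unfolding im by (rule T)
  qed
  then show ?thesis
    by (simp only: emeasure_chart_volume[OF c B(1)] emeasure_chart_volume[OF d B(1)] Bc dens im)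
qed

text \<open>Second countability gives a countable subcover, without which chart volumes could not be
  glued by a series or determine the measure.\<close>

lemma countable_charts:
  obtains D :: "nat \<Rightarrow> ('a, 'n) chart" where "range D \<subseteq> A" "(\<Union>n. cdom (D n)) = UNIV"
proof -
  obtain F where F: "F \<subseteq> cdom ` A" "countable F" "\<Union>F = \<Union>(cdom ` A)"
    using Lindelof[of "cdom ` A"] open_cdom by blast
  obtain A0 where A0: "countable A0" "A0 \<subseteq> A" "F = cdom ` A0"
    using F(1,2) by (metis countable_subset_image)
  have "\<Union>(cdom ` A) = UNIV" using atlas by (simp add: smooth_atlas_def)
  with F A0 have U: "(\<Union>c\<in>A0. cdom c) = UNIV" by simp
  then have "A0 \<noteq> {}" by auto
  then show ?thesis
    using that[of "from_nat_into A0"] A0 U by (metis UN_simps(10) range_from_nat_into)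
qed

section \<open>Existence and uniqueness of the volume measure\<close>

definition is_volume :: "'a measure \<Rightarrow> bool" where
  "is_volume \<mu> \<longleftrightarrow> sets \<mu> = sets borel \<and>
     (\<forall>c\<in>A. \<forall>B\<in>sets borel. B \<subseteq> cdom c \<longrightarrow> emeasure \<mu> B = emeasure (chart_volume c) B)"

lemma riemannian_volume_eq: "riemannian_volume A g = (THE \<mu>. is_volume \<mu>)"
proof -
  have "emeasure (chart_volume c) B = (\<integral>\<^sup>+x\<in>coord c ` B. ennreal (sqrt (det (g c (cinv c x)))) \<partial>lborel)"
    if "c \<in> A" "B \<in> sets borel" "B \<subseteq> cdom c" for c B
  proof -
    have "B \<inter> cdom c = B" using that by auto
    then show ?thesis
      using that by (auto simp: emeasure_chart_volume vol_density_def indicator_def intro!: nn_integral_cong)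
  qed
  then have "is_volume = (\<lambda>\<mu>. sets \<mu> = sets borel \<and> (\<forall>c\<in>A. \<forall>B\<in>sets borel. B \<subseteq> cdom c \<longrightarrow>
      emeasure \<mu> B = (\<integral>\<^sup>+x\<in>coord c ` B. ennreal (sqrt (det (g c (cinv c x)))) \<partial>lborel)))"
    unfolding is_volume_def fun_eq_iff by auto
  then show ?thesis by (simp add: riemannian_volume_def)
qed

text \<open>A countable cover by charts is made disjoint, and the chart volumes of the pieces are
  added. The same decomposition shows uniqueness, since a volume measure is prescribed on subsets of
  each piece.\<close>

lemma is_volume_riemannian_volume: "is_volume (riemannian_volume A g)"
proof -
  obtain D :: "nat \<Rightarrow> ('a, 'n) chart" where D: "range D \<subseteq> A" "(\<Union>n. cdom (D n)) = UNIV"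
    by (rule countable_charts)
  have DA: "D n \<in> A" for n using D by auto
  define E where "E = disjointed (\<lambda>n. cdom (D n))"
  have E: "E n \<in> sets borel" for n
  proof -
    have "range (\<lambda>n. cdom (D n)) \<subseteq> sets borel" using open_cdom[OF DA] by auto
    from sets.range_disjointed_sets[OF this] show ?thesis unfolding E_def by blast
  qed
  have Edisj: "disjoint_family E" and EU: "(\<Union>n. E n) = UNIV"
    using D by (simp_all add: E_def disjoint_family_disjointed UN_disjointed_eq)
  have Esub: "E n \<subseteq> cdom (D n)" for n unfolding E_def by (rule disjointed_subset)
  have split: "(\<Sum>n. emeasure M (B \<inter> E n)) = emeasure M B" if "sets M = sets borel" "B \<in> sets borel" for M B
  proof -
    have "disjoint_family (\<lambda>n. B \<inter> E n)" using Edisj unfolding disjoint_family_on_def by blast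
    then have "(\<Sum>n. emeasure M (B \<inter> E n)) = emeasure M (\<Union>n. B \<inter> E n)"
      using that E by (intro suminf_emeasure) auto
    also have "(\<Union>n. B \<inter> E n) = B" using EU by auto
    finally show ?thesis .
  qed
  define \<mu> where "\<mu> = measure_of UNIV (sets borel) (\<lambda>B. \<Sum>n. emeasure (chart_volume (D n)) (B \<inter> E n))"
  have sets: "sets \<mu> = sets borel"
    unfolding \<mu>_def using sets.sigma_sets_eq[of borel] by (simp add: sets_measure_of)
  have \<mu>: "emeasure \<mu> B = (\<Sum>n. emeasure (chart_volume (D n)) (B \<inter> E n))" if "B \<in> sets borel" for B
  proof (rule emeasure_measure_of[OF \<mu>_def])
    show "positive (sets \<mu>) (\<lambda>B. \<Sum>n. emeasure (chart_volume (D n)) (B \<inter> E n))"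
      by (simp add: positive_def)
    show "countably_additive (sets \<mu>) (\<lambda>B. \<Sum>n. emeasure (chart_volume (D n)) (B \<inter> E n))"
    proof (rule countably_additiveI)
      fix F :: "nat \<Rightarrow> 'a set" assume F: "range F \<subseteq> sets \<mu>" "disjoint_family F"
      have UN_Int_E: "(\<Union>i. F i) \<inter> E n = (\<Union>i. F i \<inter> E n)" for n by blast
      \<comment> \<open>The double series is exchanged by reading the outer sum as an integral over
        the counting measure.\<close>
      have "(\<Sum>i. \<Sum>n. emeasure (chart_volume (D n)) (F i \<inter> E n))
          = (\<integral>\<^sup>+i. (\<Sum>n. emeasure (chart_volume (D n)) (F i \<inter> E n)) \<partial>count_space UNIV)"
        by (simp add: nn_integral_count_space_nat)
      also have "\<dots> = (\<Sum>n. \<Sum>i. emeasure (chart_volume (D n)) (F i \<inter> E n))"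
        by (subst nn_integral_suminf) (simp_all add: nn_integral_count_space_nat)
      also have "\<dots> = (\<Sum>n. emeasure (chart_volume (D n)) (\<Union>i. F i \<inter> E n))"
      proof (intro suminf_cong suminf_emeasure)
        show "disjoint_family (\<lambda>i. F i \<inter> E n)" for n using F(2) unfolding disjoint_family_on_def by blast
        show "range (\<lambda>i. F i \<inter> E n) \<subseteq> sets (chart_volume (D n))" for n using F(1) E by (auto simp: sets)
      qed
      finally show "(\<Sum>i. \<Sum>n. emeasure (chart_volume (D n)) (F i \<inter> E n))
          = (\<Sum>n. emeasure (chart_volume (D n)) ((\<Union>i. F i) \<inter> E n))"
        by (simp only: UN_Int_E)
    qed
  qed (use that sets in auto)
  have "is_volume \<mu>"
    unfolding is_volume_def
  proof (intro conjI sets ballI impI)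
    fix c B assume c: "c \<in> A" and B: "B \<in> sets borel" "B \<subseteq> cdom c"
    \<comment> \<open>\<open>B \<inter> E n\<close> lies in the domains of both \<open>c\<close> and
      \<open>D n\<close>, where the two chart volumes agree.\<close>
    have "emeasure \<mu> B = (\<Sum>n. emeasure (chart_volume c) (B \<inter> E n))"
      unfolding \<mu>[OF B(1)]
      using B E Esub by (intro suminf_cong chart_volume_change DA c) blast+
    then show "emeasure \<mu> B = emeasure (chart_volume c) B" using B by (simp add: split)
  qed
  moreover have "\<nu> = \<mu>" if \<nu>: "is_volume \<nu>" for \<nu>
  proof (rule measure_eqI)
    show "sets \<nu> = sets \<mu>" using \<nu> sets by (simp add: is_volume_def)
    fix B assume "B \<in> sets \<nu>"
    then have B: "B \<in> sets borel" using \<nu> by (simp add: is_volume_def)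
    have "emeasure \<nu> (B \<inter> E n) = emeasure \<mu> (B \<inter> E n)" for n
    proof -
      have "B \<inter> E n \<in> sets borel" "B \<inter> E n \<subseteq> cdom (D n)" using B E Esub by auto
      then show ?thesis
        using \<nu> \<open>is_volume \<mu>\<close> DA unfolding is_volume_def by metis
    qed
    then show "emeasure \<nu> B = emeasure \<mu> B"
      using split[of \<nu> B] split[of \<mu> B] \<nu> sets B by (simp add: is_volume_def)
  qed
  ultimately show ?thesis
    unfolding riemannian_volume_eq by (rule theI)
qed

section \<open>Integration against the volume measure\<close>

abbreviation "vol \<equiv> riemannian_volume A g"

lemma sets_vol [simp]: "sets vol = sets borel"
  using is_volume_riemannian_volume by (simp add: is_volume_def)

lemma space_vol [simp]: "space vol = UNIV"
  using sets_eq_imp_space_eq[OF sets_vol] by simp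

lemma emeasure_vol: "c \<in> A \<Longrightarrow> B \<in> sets borel \<Longrightarrow> B \<subseteq> cdom c \<Longrightarrow> emeasure vol B = emeasure (chart_volume c) B"
  using is_volume_riemannian_volume unfolding is_volume_def by blast

lemma integral_vol_chart:
  fixes f :: "'a \<Rightarrow> real"
  assumes c: "c \<in> A" and f: "f \<in> borel_measurable borel" and zero: "\<And>p. p \<notin> cdom c \<Longrightarrow> f p = 0"
  shows "integral\<^sup>L vol f = (\<integral>x. indicator (coord c ` cdom c) x * (vol_density c (cinv c x) * f (cinv c x)) \<partial>lborel)"
proof -
  let ?U = "coord c ` cdom c" and ?\<rho> = "\<lambda>x. vol_density c (cinv c x)"
  let ?L = "restrict_space lborel ?U"
  have U: "?U \<inter> space lborel \<in> sets lborel" using open_image_cdom[OF c] by simp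
  have \<rho>: "?\<rho> \<in> borel_measurable ?L"
    using measurable_vol_density[OF c] by (simp add: measurable_cong_sets[OF sets_restrict_lborel refl])
  have cinv: "cinv c \<in> measurable ?L borel"
    using measurable_cinv[OF c] by (simp add: measurable_cong_sets[OF sets_restrict_lborel refl])
  have nonneg: "AE x in ?L. 0 \<le> ?\<rho> x"
    using vol_density_pos[OF c] c by (intro AE_I2) (auto simp: space_restrict_space intro: less_imp_le)
  have dom: "cdom c \<in> sets borel" using open_cdom[OF c] by simp
  have ind: "indicator (cdom c) p * f p = f p" for p using zero by (auto simp: indicator_def)
  \<comment> \<open>The defining property controls only Borel sets inside the chart, so the two
    measures are compared after restriction; \<open>f\<close> vanishes elsewhere.\<close>
  have restr: "restrict_space vol (cdom c) = restrict_space (chart_volume c) (cdom c)"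
  proof (rule measure_eqI)
    fix B assume "B \<in> sets (restrict_space vol (cdom c))"
    then have B: "B \<in> sets borel" "B \<subseteq> cdom c"
      using dom by (auto simp: sets_restrict_space)
    then show "emeasure (restrict_space vol (cdom c)) B = emeasure (restrict_space (chart_volume c) (cdom c)) B"
      using dom emeasure_vol[OF c B] sets_eq_imp_space_eq[OF sets_chart_volume[of c]]
      by (simp add: emeasure_restrict_space)
  qed (simp add: sets_restrict_space)
  have "integral\<^sup>L vol f = integral\<^sup>L (restrict_space vol (cdom c)) f"
    using dom by (subst integral_restrict_space) (simp_all add: ind)
  also have "\<dots> = integral\<^sup>L (chart_volume c) f"
    unfolding restr using dom sets_eq_imp_space_eq[OF sets_chart_volume[of c]]
    by (subst integral_restrict_space) (simp_all add: ind)
  also have "\<dots> = (\<integral>x. f (cinv c x) \<partial>density ?L (\<lambda>x. ennreal (?\<rho> x)))"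
    unfolding chart_volume_def using cinv f by (intro integral_distr) simp_all
  also have "\<dots> = (\<integral>x. ?\<rho> x *\<^sub>R f (cinv c x) \<partial>?L)"
    using measurable_compose[OF cinv f] \<rho> nonneg by (rule integral_density)
  also have "\<dots> = (\<integral>x. indicator ?U x *\<^sub>R (?\<rho> x *\<^sub>R f (cinv c x)) \<partial>lborel)"
    using U by (rule integral_restrict_space)
  finally show ?thesis by simp
qed

text \<open>The density is continuous, hence integrable over a closed coordinate ball. Finitely many
  of the open balls cover \<open>K\<close>.\<close>

lemma emeasure_vol_compact:
  assumes "compact K"
  shows "emeasure vol K < \<infinity>"
proof -
  have "\<exists>V L. open V \<and> p \<in> V \<and> V \<subseteq> L \<and> L \<in> sets borel \<and> emeasure vol L < \<infinity>" for p
  proof -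
    obtain c where c: "c \<in> A" "p \<in> cdom c" using in_chart .
    obtain r where r: "r > 0" "cball (coord c p) r \<subseteq> coord c ` cdom c"
      using open_image_cdom[OF c(1)] c open_contains_cball by blast
    let ?C = "cball (coord c p) r" and ?B = "ball (coord c p) r"
    define L where "L = cinv c ` ?C"
    have L: "compact L" "L \<subseteq> cdom c"
      unfolding L_def using c r continuous_on_subset[OF continuous_on_cinv]
      by (auto intro!: compact_continuous_image)
    have Lb: "L \<in> sets borel" using L by (simp add: borel_closed compact_imp_closed)
    have "openin (top_of_set (cdom c)) (cdom c \<inter> coord c -` ?B)"
      using continuous_on_coord[OF c(1)] by (intro continuous_openin_preimage_gen) auto
    then have V: "open (cdom c \<inter> coord c -` ?B)"
      using open_cdom[OF c(1)] openin_open_trans by blast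
    have "cdom c \<inter> coord c -` ?B \<subseteq> L"
    proof
      fix q assume q: "q \<in> cdom c \<inter> coord c -` ?B"
      then have "coord c q \<in> ?C" by auto
      then have "cinv c (coord c q) \<in> L" unfolding L_def by blast
      then show "q \<in> L" using q c by simp
    qed
    moreover have "emeasure vol L < \<infinity>"
    proof -
      have im: "coord c ` (L \<inter> cdom c) = ?C"
      proof -
        have "coord c ` L = ?C" unfolding L_def image_image
          using r coord_cinv[OF c(1)] by (intro image_cong[THEN trans, OF refl _ image_ident]) blast
        moreover have "L \<inter> cdom c = L" using L by auto
        ultimately show ?thesis by simp
      qed
      have "integrable lborel (\<lambda>x. indicator ?C x *\<^sub>R vol_density c (cinv c x))"
        using continuous_on_subset[OF continuous_on_vol_density[OF c(1)] r(2)]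
        by (intro borel_integrable_compact) auto
      then have "(\<integral>\<^sup>+x. ennreal (norm (indicator ?C x *\<^sub>R vol_density c (cinv c x))) \<partial>lborel) < \<infinity>"
        by (simp add: integrable_iff_bounded)
      moreover have "norm (indicator ?C x *\<^sub>R vol_density c (cinv c x)) = indicator ?C x * vol_density c (cinv c x)" for x
        using vol_density_pos[OF c(1) cinv_in[OF c(1)]] r(2) by (auto simp: indicator_def less_imp_le)
      ultimately show ?thesis
        by (simp add: emeasure_vol[OF c(1) Lb L(2)] emeasure_chart_volume[OF c(1) Lb] im)
    qed
    ultimately show ?thesis using V Lb c r(1) by (intro exI[of _ "cdom c \<inter> coord c -` ?B"] exI[of _ L]) auto
  qed
  then obtain V L where VL: "\<And>p. open (V p)" "\<And>p. p \<in> V p" "\<And>p. V p \<subseteq> L p" "\<And>p. L p \<in> sets borel"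
    "\<And>p. emeasure vol (L p) < \<infinity>" by metis
  have "K \<subseteq> (\<Union>p\<in>K. V p)" using VL(2) by auto
  then obtain I where I: "I \<subseteq> K" "finite I" "K \<subseteq> (\<Union>p\<in>I. V p)"
    using compactE_image[OF assms, of K V] VL(1) by metis
  have "K \<subseteq> (\<Union>p\<in>I. L p)" using I(3) VL(3) by blast
  then have "emeasure vol K \<le> emeasure vol (\<Union>p\<in>I. L p)"
    using I(2) VL(4) by (intro emeasure_mono) auto
  also have "\<dots> \<le> (\<Sum>p\<in>I. emeasure vol (L p))"
    using I VL(4) by (intro emeasure_subadditive_finite) auto
  also have "\<dots> < \<infinity>" using I(2) VL(5) by (simp add: less_top)
  finally show ?thesis .
qed

lemma integrable_vol:
  fixes f :: "'a \<Rightarrow> real"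
  assumes cont: "continuous_on UNIV f" and K: "compact K" and zero: "\<And>p. p \<notin> K \<Longrightarrow> f p = 0"
  shows "integrable vol f"
proof -
  have "compact (f ` K)" using K cont continuous_on_subset by (intro compact_continuous_image) blast
  then obtain B where B: "\<And>p. p \<in> K \<Longrightarrow> norm (f p) \<le> B"
    by (metis compact_imp_bounded bounded_iff imageI)
  have fm: "f \<in> borel_measurable vol"
    using borel_measurable_continuous_onI[OF cont] by (simp add: measurable_cong_sets[OF sets_vol refl])
  show ?thesis
    by (rule integrableI_bounded_set[of K _ _ B])
      (use K fm B zero emeasure_vol_compact[OF K] in \<open>auto simp: borel_closed compact_imp_closed\<close>)
qed

text \<open>Jacobi's formula gives half the trace of \<open>G\<close> times the derivative of the
  metric as logarithmic derivative of the density, and this is the contracted Christoffel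
  symbol.\<close>

lemma
  assumes c: "c \<in> A" "p \<in> cdom c"
  shows differentiable_in_vol_density: "differentiable_in c p (vol_density c)"
    and pd_vol_density: "pd c i (vol_density c) p = vol_density c p * (\<Sum>m\<in>UNIV. christoffel g c p i m m)"
proof -
  let ?x = "coord c p" and ?G = "matrix_inv (g c p)"
  have cp: "cinv c ?x = p" using c by simp
  have "((\<lambda>x. g c (cinv c x) $ k $ l) has_derivative
      (\<lambda>v. \<Sum>i\<in>UNIV. v $ i * pd c i (\<lambda>q. g c q $ k $ l) p)) (at ?x)" for k l
    using has_derivative_partial_deriv[of "(\<lambda>q. g c q $ k $ l) \<circ> cinv c" ?x] differentiable_in_metric[OF c]
    by (simp add: differentiable_in_def pd_def o_def)
  from has_derivative_det[OF this]
  have D: "((\<lambda>x. det (g c (cinv c x))) has_derivative (\<lambda>v. det (g c p) *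
      (\<Sum>k\<in>UNIV. \<Sum>l\<in>UNIV. ?G $ l $ k * (\<Sum>i\<in>UNIV. v $ i * pd c i (\<lambda>q. g c q $ k $ l) p)))) (at ?x)"
    by (simp add: cp invertible_metric[OF c])
  have pos: "0 < det (g c p)" by (rule det_metric_pos[OF c])
  have s: "(sqrt has_derivative (*) (inverse (sqrt (det (g c p))) / 2)) (at (det (g c (cinv c ?x))))"
    using DERIV_real_sqrt[OF pos] unfolding cp has_field_derivative_def .
  have D2: "(vol_density c \<circ> cinv c has_derivative (\<lambda>v. inverse (sqrt (det (g c p))) / 2 * (det (g c p) *
      (\<Sum>k\<in>UNIV. \<Sum>l\<in>UNIV. ?G $ l $ k * (\<Sum>i\<in>UNIV. v $ i * pd c i (\<lambda>q. g c q $ k $ l) p))))) (at ?x)"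
    using diff_chain_at[OF D s] by (simp add: o_def vol_density_def[abs_def])
  then show "differentiable_in c p (vol_density c)"
    by (auto simp: differentiable_in_def differentiable_def)
  have tr: "(\<Sum>m\<in>UNIV. christoffel g c p i m m) = (\<Sum>k\<in>UNIV. \<Sum>l\<in>UNIV. ?G $ l $ k * pd c i (\<lambda>q. g c q $ k $ l) p) / 2"
  proof -
    \<comment> \<open>By symmetry of \<open>?G\<close>, two of the three terms in the Christoffel
      symbol cancel under contraction.\<close>
    have "(\<Sum>m\<in>UNIV. \<Sum>l\<in>UNIV. ?G $ m $ l * pd c m (\<lambda>q. g c q $ i $ l) p)
        = (\<Sum>m\<in>UNIV. \<Sum>l\<in>UNIV. ?G $ m $ l * pd c l (\<lambda>q. g c q $ i $ m) p)"
      by (subst sum.swap) (simp add: metric_inv_sym[OF c])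
    then have "(\<Sum>m\<in>UNIV. christoffel g c p i m m)
        = (\<Sum>m\<in>UNIV. \<Sum>l\<in>UNIV. ?G $ m $ l * pd c i (\<lambda>q. g c q $ m $ l) p) / 2"
      by (simp add: christoffel_def sum_divide_distrib[symmetric] sum.distrib sum_subtractf distrib_left
          right_diff_distrib)
    then show ?thesis by (simp add: metric_inv_sym[OF c])
  qed
  have "pd c i (vol_density c) p = inverse (sqrt (det (g c p))) / 2 * (det (g c p) *
      (\<Sum>k\<in>UNIV. \<Sum>l\<in>UNIV. ?G $ l $ k * pd c i (\<lambda>q. g c q $ k $ l) p))"
    unfolding pd_def[of c i "vol_density c"] by (subst partial_deriv_eq[OF D2]) (simp add: sum_axis)
  also have "\<dots> = inverse (sqrt (det (g c p))) * det (g c p) * (\<Sum>m\<in>UNIV. christoffel g c p i m m)"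
    by (simp add: tr)
  also have "inverse (sqrt (det (g c p))) * det (g c p) = vol_density c p"
    using pos by (simp add: vol_density_def real_div_sqrt divide_inverse[symmetric] mult.commute)
  finally show "pd c i (vol_density c) p = vol_density c p * (\<Sum>m\<in>UNIV. christoffel g c p i m m)" .
qed

lemma C1_at_vol_density:
  assumes c: "c \<in> A" "p \<in> cdom c"
  shows "C1_at c p (vol_density c)"
proof -
  have vd: "continuous_on (cdom c) (vol_density c)"
    using differentiable_in_isCont differentiable_in_vol_density c(1)
    by (intro continuous_at_imp_continuous_on) blast
  have ch: "continuous_on (cdom c) (\<lambda>q. christoffel g c q i j k)" for i j k
    using smooth_in_continuous_on[OF c(1) smooth_in_christoffel[OF c(1)]] by simp
  have "continuous_on (cdom c) (\<lambda>q. vol_density c q * (\<Sum>m\<in>UNIV. christoffel g c q i m m))" for i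
    by (intro continuous_on_mult continuous_on_sum vd ch)
  moreover have "continuous_on (cdom c) (pd c i (vol_density c)) \<longleftrightarrow>
      continuous_on (cdom c) (\<lambda>q. vol_density c q * (\<Sum>m\<in>UNIV. christoffel g c q i m m))" for i
    by (rule continuous_on_cong[OF refl]) (rule pd_vol_density[OF c(1)])
  ultimately have "continuous_on (cdom c) (pd c i (vol_density c))" for i by blast
  then show ?thesis
    unfolding C1_at_def using c open_cdom differentiable_in_vol_density by (intro exI[of _ "cdom c"]) auto
qed

text \<open>The Voss-Weyl formula, which reduces the integral of a divergence to integrals of
  partial derivatives in coordinates. Torsion-freeness matches the two contractions of the
  Christoffel symbols.\<close>

lemma sum_pd_density_eq_divergence:
  assumes c: "c \<in> A" "p \<in> cdom c" and Y: "\<And>i. differentiable_in c p (\<lambda>q. Y q $ i)"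
  shows "(\<Sum>i\<in>UNIV. pd c i (\<lambda>q. vol_density c q * Y q $ i) p) = vol_density c p * divergence_in c Y p"
proof -
  have "(\<Sum>i\<in>UNIV. \<Sum>j\<in>UNIV. christoffel g c p i j i * Y p $ j)
      = (\<Sum>j\<in>UNIV. (\<Sum>i\<in>UNIV. christoffel g c p j i i) * Y p $ j)"
    by (subst sum.swap) (simp add: sum_distrib_right christoffel_sym[OF c])
  then show ?thesis
    using assms by (simp add: pd_mult differentiable_in_vol_density pd_vol_density divergence_in_eq sum.distrib
        distrib_left sum_distrib_left mult_ac)
qed

section \<open>The divergence theorem\<close>

lemma divergence_in_cong_open:
  assumes "c \<in> A" "open W" "p \<in> W" "p \<in> cdom c" "\<And>q. q \<in> W \<Longrightarrow> q \<in> cdom c \<Longrightarrow> Y q = Z q"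
  shows "divergence_in c Y p = divergence_in c Z p"
proof -
  have "pd c i (\<lambda>q. Y q $ i) p = pd c i (\<lambda>q. Z q $ i) p" for i
    by (rule pd_cong_open[OF assms(1-4)]) (simp add: assms(5))
  then show ?thesis using assms by (simp add: divergence_in_eq)
qed

lemma divergence_in_zero: "divergence_in c (\<lambda>_. 0) p = 0"
  by (simp add: divergence_in_eq pd_const)

lemma divergence_in_sum:
  assumes "c \<in> A" "p \<in> cdom c" "finite I" "\<And>a i. a \<in> I \<Longrightarrow> differentiable_in c p (\<lambda>q. Y a q $ i)"
  shows "divergence_in c (\<lambda>q. \<Sum>a\<in>I. Y a q) p = (\<Sum>a\<in>I. divergence_in c (Y a) p)"
proof -
  have "(\<Sum>i\<in>UNIV. \<Sum>a\<in>I. pd c i (\<lambda>q. Y a q $ i) p) = (\<Sum>a\<in>I. \<Sum>i\<in>UNIV. pd c i (\<lambda>q. Y a q $ i) p)"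
    by (rule sum.swap)
  moreover have "(\<Sum>i\<in>UNIV. \<Sum>j\<in>UNIV. christoffel g c p i j i * (\<Sum>a\<in>I. Y a p $ j))
      = (\<Sum>a\<in>I. \<Sum>i\<in>UNIV. \<Sum>j\<in>UNIV. christoffel g c p i j i * Y a p $ j)"
  proof -
    have "(\<Sum>i\<in>UNIV. \<Sum>j\<in>UNIV. christoffel g c p i j i * (\<Sum>a\<in>I. Y a p $ j))
        = (\<Sum>i\<in>UNIV. \<Sum>a\<in>I. \<Sum>j\<in>UNIV. christoffel g c p i j i * Y a p $ j)"
      unfolding sum_distrib_left by (intro sum.cong refl sum.swap)
    also have "\<dots> = (\<Sum>a\<in>I. \<Sum>i\<in>UNIV. \<Sum>j\<in>UNIV. christoffel g c p i j i * Y a p $ j)"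
      by (rule sum.swap)
    finally show ?thesis .
  qed
  ultimately show ?thesis
    using assms by (simp add: divergence_in_eq pd_sum sum.distrib)
qed

text \<open>In a chart the divergence theorem says that the partial derivatives of the components
  \<open>\<surd>det(g) Y\<^sup>i\<close>, extended by zero to the whole Euclidean space, have vanishing integrals.\<close>

lemma divergence_theorem_chart:
  assumes c: "c \<in> A" and Y: "\<And>p i. p \<in> cdom c \<Longrightarrow> C1_at c p (\<lambda>q. Y q $ i)"
    and K: "compact K" "K \<subseteq> cdom c" and zero: "\<And>q. q \<in> cdom c \<Longrightarrow> q \<notin> K \<Longrightarrow> Y q = 0"
  defines "D \<equiv> \<lambda>p. if p \<in> cdom c then divergence_in c Y p else 0"
  shows "integrable vol D" "integral\<^sup>L vol D = 0"
proof -
  let ?U = "coord c ` cdom c"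
  have oU: "open ?U" and oc: "open (cdom c)" using open_image_cdom open_cdom c by auto
  have oK: "open (- K)" using K by (simp add: compact_imp_closed open_Compl)
  have D0: "D p = 0" if "p \<notin> K" for p
    using that divergence_in_cong_open[OF c oK, of p Y "\<lambda>_. 0"] zero by (simp add: D_def divergence_in_zero)
  have Dcont: "isCont D p" for p
  proof (cases "p \<in> cdom c")
    case True
    have "isCont (divergence_in c Y) p"
      unfolding divergence_in_eq[abs_def]
    proof (intro continuous_add continuous_sum continuous_mult)
      show "isCont (pd c i (\<lambda>q. Y q $ i)) p" for i by (rule C1_at_isCont_pd[OF c Y[OF True]])
      have "C1_at c p (\<lambda>q. christoffel g c q i j k)" for i j k
        by (rule smooth_in_C1_at[OF c open_UNIV smooth_in_christoffel[OF c] True]) simp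
      then show "isCont (\<lambda>q. christoffel g c q i j i) p" for i j
        using C1_at_isCont c by blast
      show "isCont (\<lambda>q. Y q $ j) p" for j by (rule C1_at_isCont[OF c Y[OF True]])
    qed
    moreover have "\<forall>\<^sub>F q in nhds p. divergence_in c Y q = D q"
      using eventually_nhds_in_open[OF oc True] by eventually_elim (simp add: D_def)
    ultimately show ?thesis using isCont_cong by fast
  next
    case False
    then have "p \<in> - K" using K by blast
    from eventually_nhds_in_open[OF oK this] have "\<forall>\<^sub>F q in nhds p. (\<lambda>_. 0) q = D q"
      by (rule eventually_mono) (simp add: D0)
    then have "isCont (\<lambda>_. 0 :: real) p \<longleftrightarrow> isCont D p" by (rule isCont_cong)
    then show ?thesis by simp
  qed
  then have contD: "continuous_on UNIV D" by (simp add: continuous_at_imp_continuous_on)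
  show "integrable vol D" by (rule integrable_vol[OF contD K(1) D0])
  define h where "h i q = vol_density c q * Y q $ i" for i q
  define F where "F i x = (if x \<in> ?U then h i (cinv c x) else 0)" for i x
  have h: "C1_at c p (h i)" if "p \<in> cdom c" for p i
    unfolding h_def using that by (intro C1_at_mult C1_at_vol_density Y c)
  have K': "compact (coord c ` K)" using K continuous_on_subset[OF continuous_on_coord[OF c]]
    by (intro compact_continuous_image) auto
  have oK': "open (- (coord c ` K))" using K' by (simp add: compact_imp_closed open_Compl)
  have F0: "F i x = 0" if "x \<notin> coord c ` K" for i x
  proof (cases "x \<in> ?U")
    case True
    then obtain q where q: "q \<in> cdom c" "x = coord c q" by auto
    with that have "q \<notin> K" by blast
    then show ?thesis using q zero c by (simp add: F_def h_def)
  qed (simp add: F_def)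
  have F1: "F i y = (h i \<circ> cinv c) y" if "y \<in> ?U" for i y using that by (simp add: F_def)
  \<comment> \<open>Two open sets cover Euclidean space: the image of the chart, where
    \<open>F\<close> is the coordinate expression, and the complement of the image of
    \<open>K\<close>, where \<open>F\<close> is zero. Regularity is checked on each.\<close>
  have in_or_out: "x \<in> ?U \<or> x \<in> - (coord c ` K)" for x using K by auto
  have diffF: "F i differentiable at x" for i x
    using in_or_out[of x]
  proof
    assume x: "x \<in> ?U"
    have "(h i \<circ> cinv c) differentiable at x"
      using C1_at_differentiable[OF h[OF cinv_in[OF c x]], of i] coord_cinv[OF c x] by (simp add: differentiable_in_def)
    then show ?thesis
      using differentiable_cong_open[OF oU x, of "F i" "h i \<circ> cinv c"] F1 by blast
  next
    assume x: "x \<in> - (coord c ` K)"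
    then show ?thesis
      using differentiable_cong_open[OF oK' x, of "F i" "\<lambda>_. 0"] F0 by simp
  qed
  have pF1: "partial_deriv j (F i) x = pd c j (h i) (cinv c x)" if x: "x \<in> ?U" for i j x
    using partial_deriv_cong[OF oU x, of "F i" "h i \<circ> cinv c" j] F1 pd_eq_partial_deriv[OF c x] by metis
  have pF0: "partial_deriv j (F i) x = 0" if x: "x \<in> - (coord c ` K)" for i j x
    using partial_deriv_cong[OF oK' x, of "F i" "\<lambda>_. 0" j] F0
    by (simp add: partial_deriv_eq[OF has_derivative_const])
  have contF: "isCont (partial_deriv j (F i)) x" for i j x
    using in_or_out[of x]
  proof
    assume x: "x \<in> ?U"
    have "isCont (cinv c) x"
      using continuous_on_cinv[OF c] continuous_on_eq_continuous_at[OF oU] x by blast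
    moreover have "isCont (pd c j (h i)) (cinv c x)"
      by (rule C1_at_isCont_pd[OF c h[OF cinv_in[OF c x]]])
    ultimately have "isCont (\<lambda>y. pd c j (h i) (cinv c y)) x" by (rule isCont_o2)
    moreover have "\<forall>\<^sub>F y in nhds x. pd c j (h i) (cinv c y) = partial_deriv j (F i) y"
      using eventually_nhds_in_open[OF oU x] by eventually_elim (rule pF1[symmetric])
    ultimately show ?thesis using isCont_cong by fast
  next
    assume x: "x \<in> - (coord c ` K)"
    from eventually_nhds_in_open[OF oK' this]
    have "\<forall>\<^sub>F y in nhds x. (\<lambda>_. 0) y = partial_deriv j (F i) y"
      by (rule eventually_mono) (simp add: pF0)
    then have "isCont (\<lambda>_. 0 :: real) x \<longleftrightarrow> isCont (partial_deriv j (F i)) x" by (rule isCont_cong)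
    then show ?thesis by simp
  qed
  have int: "integrable lborel (partial_deriv i (F i))" "(\<integral>x. partial_deriv i (F i) x \<partial>lborel) = 0" for i
    using integral_partial_deriv_eq_0[OF diffF continuous_at_imp_continuous_on K' F0] contF by blast+
  have "indicator ?U x * (vol_density c (cinv c x) * D (cinv c x)) = (\<Sum>i\<in>UNIV. partial_deriv i (F i) x)" for x
  proof (cases "x \<in> ?U")
    case True
    note q = cinv_in[OF c True]
    show ?thesis
      using sum_pd_density_eq_divergence[OF c q C1_at_differentiable[OF Y[OF q]]] True q
      by (simp add: pF1 D_def h_def[abs_def])
  next
    case False
    then have "x \<in> - (coord c ` K)" using in_or_out by blast
    then show ?thesis using False by (simp add: pF0)
  qed
  then have "integral\<^sup>L vol D = (\<integral>x. (\<Sum>i\<in>UNIV. partial_deriv i (F i) x) \<partial>lborel)"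
    using integral_vol_chart[OF c borel_measurable_continuous_onI[OF contD]] by (simp add: D_def)
  also have "\<dots> = 0" using int by (subst Bochner_Integration.integral_sum) auto
  finally show "integral\<^sup>L vol D = 0" .
qed

definition divergence :: "(('a, 'n) chart \<Rightarrow> 'a \<Rightarrow> real^'n) \<Rightarrow> 'a \<Rightarrow> real" where
  "divergence V p = divergence_in (chart_at A p) (V (chart_at A p)) p"

text \<open>Near \<open>K\<close> the field is the sum of the fields \<open>\<eta> a V\<close>, each
  supported in one chart. Differentiating these products as a whole, the gradients of the cut-off
  functions never appear separately; chart independence moves each divergence into its own
  chart.\<close>

lemma divergence_theorem:
  assumes V: "\<And>c p i. c \<in> A \<Longrightarrow> p \<in> cdom c \<Longrightarrow> C1_at c p (\<lambda>q. V c q $ i)"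
    and change: "\<And>c d p. c \<in> A \<Longrightarrow> d \<in> A \<Longrightarrow> p \<in> cdom c \<Longrightarrow> p \<in> cdom d \<Longrightarrow> V d p = jacobian c d p *v V c p"
    and K: "compact K" and zero: "\<And>c p. c \<in> A \<Longrightarrow> p \<in> cdom c \<Longrightarrow> p \<notin> K \<Longrightarrow> V c p = 0"
  shows "integrable vol (divergence V)" "integral\<^sup>L vol (divergence V) = 0"
proof -
  obtain I :: "'a set" and c \<eta> L W where I: "finite I" and W: "open W" "K \<subseteq> W"
    and cA: "\<And>a. a \<in> I \<Longrightarrow> c a \<in> A" and L: "\<And>a. a \<in> I \<Longrightarrow> compact (L a)" "\<And>a. a \<in> I \<Longrightarrow> L a \<subseteq> cdom (c a)"
    and \<eta>0: "\<And>a q. a \<in> I \<Longrightarrow> q \<notin> L a \<Longrightarrow> \<eta> a q = 0"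
    and \<eta>C1: "\<And>a d q. a \<in> I \<Longrightarrow> d \<in> A \<Longrightarrow> q \<in> cdom d \<Longrightarrow> q \<in> W \<Longrightarrow> C1_at d q (\<eta> a)"
    and \<eta>1: "\<And>q. q \<in> W \<Longrightarrow> (\<Sum>a\<in>I. \<eta> a q) = 1"
    by (rule partition_of_unity[OF K]) (rule that)
  have oK: "open (- K)" using K by (simp add: compact_imp_closed open_Compl)
  define D where "D a p = (if p \<in> cdom (c a) then divergence_in (c a) (\<lambda>q. \<eta> a q *\<^sub>R V (c a) q) p else 0)" for a p
  have C1: "C1_at d p (\<lambda>q. (\<eta> a q *\<^sub>R V d q) $ i)" if "a \<in> I" "d \<in> A" "p \<in> cdom d" for a d p i
  proof (cases "p \<in> W")
    case True
    then show ?thesis using that by (auto intro!: C1_at_mult V \<eta>C1)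
  next
    case False
    \<comment> \<open>Nothing is known about the regularity of \<open>\<eta> a\<close> outside
      \<open>W\<close>, but the field vanishes near such a point.\<close>
    then have p: "p \<in> - K \<inter> cdom d" using W that by auto
    show ?thesis
      by (rule C1_at_cong[OF that(2) _ p, where f = "\<lambda>_. 0"])
        (use that oK zero open_cdom in \<open>auto intro: C1_at_const\<close>)
  qed
  have D: "integrable vol (D a)" "integral\<^sup>L vol (D a) = 0" if a: "a \<in> I" for a
    unfolding D_def[abs_def]
    by (rule divergence_theorem_chart[OF cA[OF a] C1[OF a cA[OF a]] L(1)[OF a] L(2)[OF a]];
        simp add: \<eta>0[OF a])+
  have "divergence V p = (\<Sum>a\<in>I. D a p)" for p
  proof -
    let ?d = "chart_at A p"
    have d: "?d \<in> A" "p \<in> cdom ?d" by (rule chart_at_in, rule in_chart_at)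
    show ?thesis
    proof (cases "p \<in> K")
      case True
      then have pW: "p \<in> W" using W by auto
      have diff: "differentiable_in d' p (\<lambda>q. (\<eta> a q *\<^sub>R V d' q) $ i)" if "a \<in> I" "d' \<in> A" "p \<in> cdom d'" for a d' i
        by (rule C1_at_differentiable[OF C1[OF that]])
      have "divergence V p = divergence_in ?d (\<lambda>q. \<Sum>a\<in>I. \<eta> a q *\<^sub>R V ?d q) p"
        unfolding divergence_def
        by (rule divergence_in_cong_open[OF d(1) W(1) pW d(2)]) (simp add: scaleR_sum_left[symmetric] \<eta>1)
      also have "\<dots> = (\<Sum>a\<in>I. divergence_in ?d (\<lambda>q. \<eta> a q *\<^sub>R V ?d q) p)"
        using diff d by (intro divergence_in_sum I) auto
      also have "\<dots> = (\<Sum>a\<in>I. D a p)"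
      proof (rule sum.cong[OF refl])
        fix a assume a: "a \<in> I"
        show "divergence_in ?d (\<lambda>q. \<eta> a q *\<^sub>R V ?d q) p = D a p"
        proof (cases "p \<in> cdom (c a)")
          case True
          have "divergence_in ?d (\<lambda>q. \<eta> a q *\<^sub>R V ?d q) p = divergence_in (c a) (\<lambda>q. \<eta> a q *\<^sub>R V (c a) q) p"
          proof (rule divergence_in_change[OF d cA[OF a] True open_UNIV UNIV_I])
            show "\<eta> a q *\<^sub>R V (c a) q = jacobian ?d (c a) q *v (\<eta> a q *\<^sub>R V ?d q)"
              if "q \<in> cdom ?d" "q \<in> cdom (c a)" for q
              using change[OF d(1) cA[OF a] that] by (simp add: matrix_vector_mult_scaleR)
          qed (use diff[OF a] d cA[OF a] True in auto)
          then show ?thesis using True by (simp add: D_def)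
        next
          \<comment> \<open>Here \<open>D a p\<close> is 0 by definition, and the cut-off function
            vanishes near \<open>p\<close> because its compact support lies in the chart.\<close>
          case False
          have "open (- L a)" "p \<in> - L a"
            using L[OF a] False by (auto simp: compact_imp_closed open_Compl)
          then have "divergence_in ?d (\<lambda>q. \<eta> a q *\<^sub>R V ?d q) p = divergence_in ?d (\<lambda>_. 0) p"
            by (intro divergence_in_cong_open[OF d(1) _ _ d(2)]) (auto simp: \<eta>0[OF a])
          then show ?thesis using False by (simp add: D_def divergence_in_zero)
        qed
      qed
      finally show ?thesis .
    next
      case False
      then have p: "p \<in> - K" by simp
      have "divergence V p = divergence_in ?d (\<lambda>_. 0) p"
        unfolding divergence_def by (rule divergence_in_cong_open[OF d(1) oK p d(2)]) (use zero d in auto)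
      moreover have "D a p = 0" if a: "a \<in> I" for a
      proof (cases "p \<in> cdom (c a)")
        case True
        have "divergence_in (c a) (\<lambda>q. \<eta> a q *\<^sub>R V (c a) q) p = divergence_in (c a) (\<lambda>_. 0) p"
          by (rule divergence_in_cong_open[OF cA[OF a] oK p True]) (use zero cA[OF a] in auto)
        then show ?thesis by (simp add: D_def divergence_in_zero)
      qed (simp add: D_def)
      ultimately show ?thesis by (simp add: divergence_in_zero)
    qed
  qed
  then have eq: "divergence V = (\<lambda>p. \<Sum>a\<in>I. D a p)" by blast
  show "integrable vol (divergence V)" unfolding eq using D(1) by (intro Bochner_Integration.integrable_sum)
  have "integral\<^sup>L vol (divergence V) = integral\<^sup>L vol (\<lambda>p. \<Sum>a\<in>I. D a p)" by (simp only: eq)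
  also have "\<dots> = (\<Sum>a\<in>I. integral\<^sup>L vol (D a))"
    using D(1) by (rule Bochner_Integration.integral_sum)
  also have "\<dots> = 0" using D(2) by simp
  finally show "integral\<^sup>L vol (divergence V) = 0" .
qed


section \<open>The estimate\<close>

lemma L2_norm_square: "(L2_norm \<mu> f)\<^sup>2 = (\<integral>p. (f p)\<^sup>2 \<partial>\<mu>)"
  by (simp add: L2_norm_def integral_nonneg)

lemma smooth_in_isCont:
  assumes "c \<in> A" "smooth_in c UNIV f" "p \<in> cdom c"
  shows "isCont f p"
  by (rule C1_at_isCont[OF assms(1) smooth_in_C1_at[OF assms(1) open_UNIV assms(2,3) UNIV_I]])

text \<open>Meant for scalars defined through \<open>chart_at\<close>, whose chart may jump from
  point to point: continuity is read off from the expression in one fixed chart around each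
  point.\<close>

lemma continuous_on_if_smooth_in_charts:
  assumes "\<And>c p. c \<in> A \<Longrightarrow> p \<in> cdom c \<Longrightarrow> h p = k c p" "\<And>c. c \<in> A \<Longrightarrow> smooth_in c UNIV (k c)"
  shows "continuous_on UNIV h"
proof (intro continuous_at_imp_continuous_on ballI)
  fix p
  obtain c where c: "c \<in> A" "p \<in> cdom c" using in_chart .
  have "\<forall>\<^sub>F q in nhds p. k c q = h q"
    using eventually_nhds_in_open[OF open_cdom[OF c(1)] c(2)]
    by eventually_elim (rule assms(1)[OF c(1), symmetric])
  then show "isCont h p"
    using isCont_cong smooth_in_isCont[OF c(1) assms(2)[OF c(1)] c(2)] by fast
qed

lemma smooth_in_divergence:
  assumes "c \<in> A" "\<And>j. smooth_in c UNIV (\<lambda>q. Y q $ j)"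
  shows "smooth_in c UNIV (divergence_in c Y)"
  unfolding divergence_in_def[abs_def] trace_def using assms by (intro smooth_in_sum smooth_in_cov_matrix) auto

lemma cov_matrix_gradient_change:
  assumes u: "smooth_fun A u" and c: "c \<in> A" "p \<in> cdom c" and d: "d \<in> A" "p \<in> cdom d"
  shows "jacobian c d p ** cov_matrix c (gradient u c) p = cov_matrix d (gradient u d) p ** jacobian c d p"
proof (rule cov_matrix_change[OF c d open_UNIV UNIV_I])
  show "gradient u d q = jacobian c d q *v gradient u c q" if "q \<in> cdom c" "q \<in> cdom d" for q
    using gradient_change[OF u c(1) that(1) d(1) that(2)] .
qed (use smooth_in_differentiable_UNIV smooth_in_gradient u c d in blast)+

text \<open>The passage from the chart chosen by \<open>chart_at\<close> to an arbitrary one: both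
  quantities are traces, and the matrices are similar.\<close>

lemma
  assumes u: "smooth_fun A u" and c: "c \<in> A" "p \<in> cdom c"
  shows laplacian_eq_divergence: "laplacian A g u p = - divergence_in c (gradient u c) p"
    and hess_norm_square_eq: "(hess_norm A g u p)\<^sup>2
      = trace (cov_matrix c (gradient u c) p ** cov_matrix c (gradient u c) p)"
proof -
  let ?d = "chart_at A p"
  have d: "?d \<in> A" "p \<in> cdom ?d" by (rule chart_at_in, rule in_chart_at)
  note sim = trace_similar[OF cov_matrix_gradient_change[OF u c d]
      jacobian_inverse[OF c(1) d(1) c(2) d(2)] jacobian_inverse[OF d(1) c(1) d(2) c(2)]]
  show "laplacian A g u p = - divergence_in c (gradient u c) p"
    using hess_trace_eq[OF u d] sim(1) by (simp add: laplacian_def Let_def divergence_in_def)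
  show "(hess_norm A g u p)\<^sup>2 = trace (cov_matrix c (gradient u c) p ** cov_matrix c (gradient u c) p)"
    \<comment> \<open>The square of \<open>sqrt x\<close> is the absolute value of \<open>x\<close>,
      hence the appeal to nonnegativity.\<close>
    using hess_square_eq[OF u d] trace_square_nonneg[OF u d] sim(2)
    by (simp add: hess_norm_def Let_def)
qed

lemma metric_norm_square_gradient:
  assumes "smooth_fun A u"
  shows "(metric_norm A g (gradient u) p)\<^sup>2
    = (\<Sum>i\<in>UNIV. pd (chart_at A p) i u p * gradient u (chart_at A p) p $ i)"
proof -
  let ?d = "chart_at A p"
  have d: "?d \<in> A" "p \<in> cdom ?d" by (rule chart_at_in, rule in_chart_at)
  let ?X = "gradient u ?d p"
  have "0 \<le> ?X \<bullet> (g ?d p *v ?X)"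
    using metric_pos[OF d, of ?X] by (cases "?X = 0") auto
  moreover have "?X \<bullet> (g ?d p *v ?X) = (\<Sum>i\<in>UNIV. pd ?d i u p * ?X $ i)"
    unfolding metric_gradient[OF d] by (simp add: inner_vec_def diff_form_def mult.commute)
  ultimately show ?thesis by (simp add: metric_norm_def metric_inner_def Let_def)
qed

lemma gradient_zero:
  assumes c: "c \<in> A" "p \<in> cdom c" and W: "open W" "p \<in> W" and zero: "\<And>q. q \<in> W \<Longrightarrow> u q = 0"
  shows "gradient u c p = 0"
proof -
  have "pd c j u p = pd c j (\<lambda>_. 0) p" for j
    by (rule pd_cong_open[OF c(1) W c(2)]) (rule zero)
  then have "diff_form c u p = 0" by (simp add: diff_form_def vec_eq_iff pd_const)
  then show ?thesis by (simp add: gradient_def)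
qed

lemma cov_matrix_gradient_zero:
  assumes c: "c \<in> A" "p \<in> cdom c" and W: "open W" "p \<in> W" and zero: "\<And>q. q \<in> W \<Longrightarrow> u q = 0"
  shows "cov_matrix c (gradient u c) p = 0"
proof -
  have "pd c i (\<lambda>q. gradient u c q $ k) p = pd c i (\<lambda>_. 0) p" for i k
    by (rule pd_cong_open[OF c(1) W c(2)]) (simp add: gradient_zero[OF c(1) _ W(1) _ zero])
  then show ?thesis
    by (simp add: cov_matrix_def cov_deriv_def vec_eq_iff pd_const gradient_zero[OF assms])
qed

lemma hessian_estimate:
  assumes Ric: "\<And>X p. smooth_vector_field A X \<Longrightarrow> Ric A g X X p \<ge> - (C\<^sup>2) * (metric_norm A g X p)\<^sup>2"
    and \<epsilon>: "\<epsilon> > 0" and u: "smooth_compact_support A u"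
  shows "(L2_norm vol (hess_norm A g u))\<^sup>2 \<le> C\<^sup>2 * \<epsilon>\<^sup>2 / 2 * (L2_norm vol u)\<^sup>2
             + (1 + C\<^sup>2 / (2 * \<epsilon>\<^sup>2)) * (L2_norm vol (laplacian A g u))\<^sup>2"
proof -
  let ?H = "\<lambda>p. (hess_norm A g u p)\<^sup>2" and ?l = "laplacian A g u"
  define X where "X = gradient u"
  define N where "N p = (metric_norm A g X p)\<^sup>2" for p
  define K where "K = closure {p. u p \<noteq> 0}"
  have su: "smooth_fun A u" and K: "compact K"
    using u by (auto simp: smooth_compact_support_def K_def)
  have oK: "open (- K)" by (simp add: K_def open_Compl)
  have u0: "u q = 0" if "q \<in> - K" for q
    using that closure_subset[of "{p. u p \<noteq> 0}"] by (auto simp: K_def)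
  have uin: "smooth_in c UNIV u" if "c \<in> A" for c using su that by (simp add: smooth_fun_def)
  have Xin: "smooth_in c UNIV (\<lambda>q. X c q $ j)" if "c \<in> A" for c j
    unfolding X_def by (rule smooth_in_gradient[OF su that])
  define B where "B c = cov_matrix c (X c)" for c
  have Bin: "smooth_in c UNIV (\<lambda>q. B c q $ i $ j)" if "c \<in> A" for c i j
    unfolding B_def by (rule smooth_in_cov_matrix[OF that Xin[OF that]])
  have din: "smooth_in c UNIV (divergence_in c (X c))" if "c \<in> A" for c
    by (rule smooth_in_divergence[OF that Xin[OF that]])
  have H: "?H p = trace (B c p ** B c p)" and l: "?l p = - divergence_in c (X c) p" if "c \<in> A" "p \<in> cdom c" for c p
    using hess_norm_square_eq[OF su that] laplacian_eq_divergence[OF su that] by (simp_all add: B_def X_def)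
  have X0: "X c p = 0" and B0: "B c p = 0" if "c \<in> A" "p \<in> cdom c" "p \<notin> K" for c p
    using gradient_zero[OF that(1,2) oK _ u0] cov_matrix_gradient_zero[OF that(1,2) oK _ u0] that(3)
    by (auto simp: X_def B_def)
  have Hl0: "?H p = 0" "?l p = 0" if "p \<notin> K" for p
  proof -
    obtain c where c: "c \<in> A" "p \<in> cdom c" using in_chart .
    show "?H p = 0" "?l p = 0"
      using H[OF c] l[OF c] B0[OF c that] by (simp_all add: divergence_in_def B_def trace_def matrix_matrix_mult_def)
  qed
  have cu: "continuous_on UNIV u"
    by (rule continuous_on_if_smooth_in_charts[where k = "\<lambda>_. u"]) (simp_all add: uin)
  have cl: "continuous_on UNIV ?l"
  proof (rule continuous_on_if_smooth_in_charts)
    show "?l p = 0 - divergence_in c (X c) p" if "c \<in> A" "p \<in> cdom c" for c p using l[OF that] by simp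
    show "smooth_in c UNIV (\<lambda>p. 0 - divergence_in c (X c) p)" if "c \<in> A" for c
      using that by (intro smooth_in_diff smooth_in_const din open_UNIV)
  qed
  have cH: "continuous_on UNIV ?H"
    by (rule continuous_on_if_smooth_in_charts[where k = "\<lambda>c p. trace (B c p ** B c p)"])
      (auto simp: H trace_def matrix_matrix_mult_def intro!: smooth_in_sum smooth_in_mult Bin)
  have iH: "integrable vol ?H" by (rule integrable_vol[OF cH K Hl0(1)])
  have il: "integrable vol (\<lambda>p. (?l p)\<^sup>2)"
    by (rule integrable_vol[OF continuous_on_power[OF cl] K]) (simp add: Hl0)
  have iu: "integrable vol (\<lambda>p. (u p)\<^sup>2)"
    by (rule integrable_vol[OF continuous_on_power[OF cu] K]) (simp add: u0)
  have iul: "integrable vol (\<lambda>p. u p * ?l p)"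
    by (rule integrable_vol[OF continuous_on_mult[OF cu cl] K]) (simp add: u0)
  have Xchange: "X d p = jacobian c d p *v X c p" if "c \<in> A" "d \<in> A" "p \<in> cdom c" "p \<in> cdom d" for c d p
    unfolding X_def using that by (intro gradient_change[OF su])
  have at: "C1_at c p f" if "c \<in> A" "p \<in> cdom c" "smooth_in c UNIV f" for c p f
    using smooth_in_C1_at[OF that(1) open_UNIV that(3,2)] by simp
  define V where "V c q = B c q *v X c q - divergence_in c (X c) q *\<^sub>R X c q" for c q
  have "C1_at c p (\<lambda>q. V c q $ i)" if "c \<in> A" "p \<in> cdom c" for c p i
    using that unfolding V_def
    by (intro at) (auto simp: matrix_vector_mult_def intro!: smooth_in_diff smooth_in_sum smooth_in_mult Bin Xin din)
  moreover have "V d p = jacobian c d p *v V c p" if "c \<in> A" "d \<in> A" "p \<in> cdom c" "p \<in> cdom d" for c d p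
  proof -
    have "jacobian c d p *v (B c p *v X c p) = B d p *v X d p"
      using cov_matrix_gradient_change[OF su that(1,3,2,4)]
      by (simp add: matrix_vector_mul_assoc B_def X_def Xchange[unfolded X_def, OF that])
    moreover have "divergence_in c (X c) p = divergence_in d (X d) p"
      using l[OF that(1,3)] l[OF that(2,4)] by simp
    ultimately show ?thesis
      by (simp add: V_def matrix_vector_mult_diff_distrib matrix_vector_mult_scaleR Xchange[OF that])
  qed
  moreover have "V c p = 0" if "c \<in> A" "p \<in> cdom c" "p \<notin> K" for c p
    by (simp add: V_def X0[OF that])
  ultimately have divV: "integrable vol (divergence V)" "integral\<^sup>L vol (divergence V) = 0"
    using divergence_theorem[OF _ _ K, of V] by blast+
  have V: "divergence V p = ?H p - (?l p)\<^sup>2 + Ric A g X X p" for p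
  proof -
    let ?d = "chart_at A p"
    have d: "?d \<in> A" "p \<in> cdom ?d" by (rule chart_at_in, rule in_chart_at)
    show ?thesis
      using bochner[OF d Xin[OF d(1)]] H[OF d] l[OF d]
      by (simp add: divergence_def V_def[abs_def] B_def Ric_def Let_def)
  qed
  define V' where "V' c q = u q *\<^sub>R X c q" for c q
  have "C1_at c p (\<lambda>q. V' c q $ i)" if "c \<in> A" "p \<in> cdom c" for c p i
    using that unfolding V'_def by (intro at) (auto intro!: smooth_in_mult Xin uin)
  moreover have "V' d p = jacobian c d p *v V' c p" if "c \<in> A" "d \<in> A" "p \<in> cdom c" "p \<in> cdom d" for c d p
    by (simp add: V'_def matrix_vector_mult_scaleR Xchange[OF that])
  moreover have "V' c p = 0" if "c \<in> A" "p \<in> cdom c" "p \<notin> K" for c p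
    by (simp add: V'_def X0[OF that])
  ultimately have divV': "integrable vol (divergence V')" "integral\<^sup>L vol (divergence V') = 0"
    using divergence_theorem[OF _ _ K, of V'] by blast+
  \<comment> \<open>The sign comes from \<open>\<Delta>u = - div X\<close>. Integrability of
    \<open>|X|^2\<close> is inherited from the two summands.\<close>
  have N: "N p = divergence V' p + u p * ?l p" for p
  proof -
    let ?d = "chart_at A p"
    have d: "?d \<in> A" "p \<in> cdom ?d" by (rule chart_at_in, rule in_chart_at)
    have "divergence V' p = u p * divergence_in ?d (X ?d) p + (\<Sum>i\<in>UNIV. pd ?d i u p * X ?d p $ i)"
      unfolding divergence_def V'_def
      by (rule divergence_in_scale[OF d]) (intro smooth_in_differentiable_UNIV d uin Xin)+
    then show ?thesis
      using metric_norm_square_gradient[OF su, of p] l[OF d] by (simp add: N_def X_def)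
  qed
  have iN: "integrable vol N" using divV'(1) iul by (simp add: N[abs_def])
  have intN: "integral\<^sup>L vol N = (\<integral>p. u p * ?l p \<partial>vol)"
    using divV' iul by (simp add: N[abs_def])
  have young: "u p * ?l p \<le> \<epsilon>\<^sup>2 / 2 * (u p)\<^sup>2 + 1 / (2 * \<epsilon>\<^sup>2) * (?l p)\<^sup>2" for p
  proof -
    \<comment> \<open>Young's inequality with weight \<open>\<epsilon>\<close>; after multiplication
      by \<open>C^2\<close> it produces the two constants of the estimate.\<close>
    have "0 \<le> (\<epsilon> * u p - ?l p / \<epsilon>)\<^sup>2" by simp
    also have "\<dots> = \<epsilon>\<^sup>2 * (u p)\<^sup>2 + (?l p)\<^sup>2 / \<epsilon>\<^sup>2 - 2 * (u p * ?l p)"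
      using \<epsilon> by (simp add: power2_diff power_mult_distrib power_divide)
    finally show ?thesis using \<epsilon> by (simp add: field_simps)
  qed
  have "integral\<^sup>L vol N \<le> (\<integral>p. \<epsilon>\<^sup>2 / 2 * (u p)\<^sup>2 + 1 / (2 * \<epsilon>\<^sup>2) * (?l p)\<^sup>2 \<partial>vol)"
    unfolding intN using iul iu il young by (intro integral_mono) auto
  also have "\<dots> = \<epsilon>\<^sup>2 / 2 * (\<integral>p. (u p)\<^sup>2 \<partial>vol) + 1 / (2 * \<epsilon>\<^sup>2) * (\<integral>p. (?l p)\<^sup>2 \<partial>vol)"
    using iu il by simp
  finally have bound: "C\<^sup>2 * integral\<^sup>L vol N
      \<le> C\<^sup>2 * (\<epsilon>\<^sup>2 / 2 * (\<integral>p. (u p)\<^sup>2 \<partial>vol) + 1 / (2 * \<epsilon>\<^sup>2) * (\<integral>p. (?l p)\<^sup>2 \<partial>vol))"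
    by (intro mult_left_mono) auto
  \<comment> \<open>The curvature bound is inserted pointwise before integrating, so the function
    \<open>Ric(X, X)\<close> never has to be integrated on its own.\<close>
  have "(\<integral>p. ?H p - (?l p)\<^sup>2 - C\<^sup>2 * N p \<partial>vol) \<le> integral\<^sup>L vol (divergence V)"
  proof (rule integral_mono)
    have "smooth_vector_field A X" unfolding X_def by (rule smooth_vector_field_gradient[OF su])
    from Ric[OF this] show "?H p - (?l p)\<^sup>2 - C\<^sup>2 * N p \<le> divergence V p" for p
      by (simp add: V N_def)
  qed (use iH il iN divV in auto)
  then have "(\<integral>p. ?H p \<partial>vol) \<le> (\<integral>p. (?l p)\<^sup>2 \<partial>vol) + C\<^sup>2 * integral\<^sup>L vol N"
    using iH il iN divV(2) by simp
  with bound show ?thesis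
    unfolding L2_norm_square by (simp add: algebra_simps)
qed

end

theorem proposition4p1:
  fixes A :: "('a::{t2_space,second_countable_topology}, 'n::finite) chart set"
    and g :: "('a, 'n) metric"
    and C \<epsilon> :: real
    and u :: "'a \<Rightarrow> real"
  assumes "riemannian_manifold A g"
    and "\<forall>X. smooth_vector_field A X \<longrightarrow>
           (\<forall>p. Ric A g X X p \<ge> - (C\<^sup>2) * (metric_norm A g X p)\<^sup>2)"
    and "\<epsilon> > 0"
    and "smooth_compact_support A u"
  shows "(L2_norm (riemannian_volume A g) (hess_norm A g u))\<^sup>2
           \<le> C\<^sup>2 * \<epsilon>\<^sup>2 / 2 * (L2_norm (riemannian_volume A g) u)\<^sup>2
             + (1 + C\<^sup>2 / (2 * \<epsilon>\<^sup>2)) * (L2_norm (riemannian_volume A g) (laplacian A g u))\<^sup>2"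
proof -
  interpret riemannian A g
    using assms(1) by unfold_locales (auto simp: riemannian_manifold_def)
  show ?thesis using assms(2-4) by (intro hessian_estimate) auto
qed

end
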